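(* Let $K$ be a global field and let $f(x) \in K[x]$ be an irreducible polynomial of degree $n$. Let $g(x) = f(x-\mu)$ for some $\mu \in K$, with $g(0)\neq 0$ (so that the Newton polygons of $g$ are defined), and let $\mathscr{N}_g$ be the Newton index of $g$. Then $\mathscr{N}_g$ divides the order of the Galois group of $f$ over $K$. Moreover, if $\mathscr{N}_g$ has a prime divisor $q$ in the range $n/2 < q < n-2$, then the Galois group of $f$ over $K$ contains the alternating group $A_n$.
   Context: A global field is a finite extension of $\mathbb{Q}$ (number field case) or of $\mathbb{F}(T)$ with $\mathbb{F}$ a finite field (function field case). A discrete valuation $v$ on $K$ is normalized if $v(K^* ) = \mathbb{Z}$. Newton polygon: for $h(x) = a_m x^m + a_{m-1}x^{m-1} + \cdots + a_0 \in K[x]$ with $a_0 a_m \neq 0$ and a normalized discrete valuation $v$ of $K$, the $v$-adic Newton polygon $NP_v(h)$ is the lower convex hull of the set of points $\{(0,v(a_0)),(1,v(a_1)),\ldots,(m,v(a_m))\}$ (points with $a_i=0$, i.e. $v(a_i)=\infty$, are omitted); it is the highest convex polygonal line from $(0,v(a_0))$ to $(m,v(a_m))$ passing on or below all these points. Its slopes are the slopes of its line segments. Newton index: $\mathscr{N}_h$ is the least common multiple of the denominators (in lowest terms) of all slopes of $NP_v(h)$, as $v$ ranges over all normalized discrete valuations of $K$. The slope $0$ has denominator $1$. (For all but finitely many $v$, all nonzero coefficients of $h$ have $v$-adic valuation $0$ and $NP_v(h)$ is a single segment of slope $0$, so $\mathscr{N}_h$ is well defined.) The Galois group of $f$ over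 $K$ is the Galois group over $K$ of the splitting field of $f$, viewed as a permutation group on the roots of $f$.
   Formalization: In the function field case f is additionally assumed separable, so that its splitting field is Galois over K; without this the claim fails, e.g. f = x^p − T over F_p(T) with μ = 0 has Newton index p but trivial automorphism group. *)

theory Defs
  imports
    "HOL-Analysis.Analysis"
    "HOL-Combinatorics.Combinatorics"
    "HOL-Algebra.Bij"
    "HOL-Algebra.Generated_Fields"
    "HOL-Algebra.Algebraic_Closure_Type"
begin

section \<open>Global fields\<close>

text \<open>
  Fields are types of class \<open>field\<close>; \<open>ring_of_type_algebra\<close> is the \<open>ring\<close> record with carrier
  \<open>UNIV\<close> on such a type, which gives access to the subfields and dimensions of HOL-Algebra.
\<close>

definition number_field :: "'a::field itself \<Rightarrow> bool" where
  "number_field _ \<longleftrightarrow>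
     (\<exists>\<phi> \<in> ring_hom (ring_of_type_algebra :: rat ring) (ring_of_type_algebra :: 'a ring).
        ring.finite_dimension (ring_of_type_algebra :: 'a ring) (range \<phi>) UNIV)"

text \<open>
  The rational function field \<open>F(T)\<close> over a finite field is realised inside the extension, as the
  subfield generated by a finite subfield \<open>F\<close> and an element \<open>T\<close> transcendental over \<open>F\<close>.
\<close>

definition global_function_field :: "'a::field itself \<Rightarrow> bool" where
  "global_function_field _ \<longleftrightarrow>
     (\<exists>F T. subfield F (ring_of_type_algebra :: 'a ring) \<and> finite F \<and>
        ring.transcendental (ring_of_type_algebra :: 'a ring) F T \<and>
        ring.finite_dimension (ring_of_type_algebra :: 'a ring)
          (generate_field (ring_of_type_algebra :: 'a ring) (insert T F)) UNIV)"

definition global_field :: "'a::field itself \<Rightarrow> bool" where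
  "global_field K \<longleftrightarrow> number_field K \<or> global_function_field K"


section \<open>Newton polygons and the Newton index\<close>

text \<open>
  The value \<open>v 0\<close> stands for infinity; it is left unconstrained here and never used below.
\<close>

definition normalized_discrete_valuation :: "('a::field \<Rightarrow> int) \<Rightarrow> bool" where
  "normalized_discrete_valuation v \<longleftrightarrow>
     (\<forall>x y. x \<noteq> 0 \<longrightarrow> y \<noteq> 0 \<longrightarrow> v (x * y) = v x + v y) \<and>
     (\<forall>x y. x \<noteq> 0 \<longrightarrow> y \<noteq> 0 \<longrightarrow> x + y \<noteq> 0 \<longrightarrow> min (v x) (v y) \<le> v (x + y)) \<and>
     v ` (UNIV - {0}) = UNIV"

definition newton_points :: "('a::field \<Rightarrow> int) \<Rightarrow> 'a poly \<Rightarrow> (real \<times> real) set" where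
  "newton_points v h =
     {(real i, real_of_int (v (Polynomial.coeff h i))) | i. Polynomial.coeff h i \<noteq> 0}"

text \<open>
  The Newton polygon, as a subset of the plane: the lower boundary of the convex hull.
\<close>

definition newton_polygon :: "('a::field \<Rightarrow> int) \<Rightarrow> 'a poly \<Rightarrow> (real \<times> real) set" where
  "newton_polygon v h =
     {(x, y). (x, y) \<in> convex hull (newton_points v h) \<and>
        (\<forall>y'. (x, y') \<in> convex hull (newton_points v h) \<longrightarrow> y \<le> y')}"

text \<open>
  All nondegenerate segments inside the polygon are admitted; each lies on one of the finitely many
  maximal segments, so no slopes are added.
\<close>

definition newton_slopes :: "('a::field \<Rightarrow> int) \<Rightarrow> 'a poly \<Rightarrow> real set" where
  "newton_slopes v h =
     {(snd Q - snd P) / (fst Q - fst P) | P Q.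
        fst P < fst Q \<and> closed_segment P Q \<subseteq> newton_polygon v h}"

text \<open>
  The vertices of the polygon have integer coordinates, so all slopes are rational. The denominators
  are at most the degree of \<open>h\<close>, so this is the \<open>Lcm\<close> of a finite set.
\<close>

definition newton_index :: "'a::field poly \<Rightarrow> nat" where
  "newton_index h =
     Lcm {nat (snd (quotient_of s)) | s v.
            normalized_discrete_valuation v \<and> real_of_rat s \<in> newton_slopes v h}"


section \<open>Galois groups\<close>

definition ac_roots :: "'a::field poly \<Rightarrow> 'a alg_closure set" where
  "ac_roots f = {x. poly (map_poly to_ac f) x = 0}"

text \<open>
  The splitting field of an irreducible \<open>f\<close> is a Galois extension iff \<open>f\<close> is separable, which is
  automatic in characteristic 0. Over \<open>F\<^sub>p(T)\<close> it can fail: \<open>x^p - T\<close> is irreducible with Newton slope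
  \<open>-1/p\<close> at \<open>T\<close>, but its splitting field has no nontrivial automorphism over the base field.
\<close>

definition separable_poly :: "'a::field poly \<Rightarrow> bool" where
  "separable_poly f \<longleftrightarrow> rsquarefree (map_poly to_ac f)"

definition splitting_field :: "'a::field poly \<Rightarrow> 'a alg_closure set" where
  "splitting_field f =
     generate_field (ring_of_type_algebra :: 'a alg_closure ring) (range to_ac \<union> ac_roots f)"

text \<open>
  As in \<^const>\<open>AutoGroup\<close>, the automorphisms are extensional functions on the splitting field.
\<close>

definition galois_group :: "'a::field poly \<Rightarrow> ('a alg_closure \<Rightarrow> 'a alg_closure) monoid" where
  "galois_group f =
     BijGroup (splitting_field f)
       \<lparr>carrier := {\<sigma> \<in> Bij (splitting_field f).
          \<sigma> \<in> ring_hom (ring_of_type_algebra \<lparr>carrier := splitting_field f\<rparr>)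
                     (ring_of_type_algebra \<lparr>carrier := splitting_field f\<rparr>) \<and>
          (\<forall>a. \<sigma> (to_ac a) = to_ac a)}\<rparr>"

text \<open>
  The Galois group as a group of permutations of the roots; the permutations are the identity
  off the set of roots, as required by \<^const>\<open>permutes\<close>.
\<close>

definition galois_permutations :: "'a::field poly \<Rightarrow> ('a alg_closure \<Rightarrow> 'a alg_closure) set" where
  "galois_permutations f = (\<lambda>\<sigma>. perm_restrict \<sigma> (ac_roots f)) ` carrier (galois_group f)"

definition alternating_permutations :: "'b set \<Rightarrow> ('b \<Rightarrow> 'b) set" where
  "alternating_permutations S = {p. p permutes S \<and> evenperm p}"

end

theory Submission
  imports Defs "HOL-Algebra.Sylow"
begin

text \<open>
  A discrete valuation \<open>v\<close> of \<open>K\<close> extends to a nonarchimedean norm \<open>N\<close> of the algebraic closure, and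
  a slope \<open>s\<close> of the Newton polygon of \<open>g\<close> is minus the valuation of some root \<open>\<beta>\<close>, which lies in the
  splitting field \<open>L\<close> of \<open>f\<close>. Let \<open>D\<close> be the decomposition group of \<open>N\<close> in the Galois group \<open>G\<close>. By
  weak approximation some \<open>y \<in> L\<close> has the valuation of \<open>\<beta>\<close> while its conjugates by elements
  outside \<open>D\<close> have valuation 0. The product of all conjugates of \<open>y\<close> lies in \<open>K\<close> and has valuation
  \<open>- card D * s\<close>, so the denominator of \<open>s\<close> divides \<open>card D\<close>, hence the order of \<open>G\<close>.

  A prime \<open>q > n / 2\<close> dividing the order of the transitive group \<open>G\<close> gives a \<open>q\<close>-cycle in \<open>G\<close>, and
  for \<open>q < n - 2\<close> Jordan's theorem yields all even permutations.
\<close>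

section \<open>Permutation groups containing a cycle of large prime length\<close>

text \<open>The textbook route to divisibility passes to completions, where the denominator divides
  a ramification index and that index divides the order of the decomposition group. Nothing is
  completed here. The norm \<open>N\<close> is in general not invariant under the Galois group; its
  conjugates on the splitting field are the norms that approximation has to keep apart. Since the
  base field has elements of every norm \<open>2 powr m\<close>, on which all conjugates agree, two
  conjugates that differ anywhere can be separated.

  Separability enters twice: an element fixed by the group lies in the base field, and
  \<open>f\<close> has exactly \<open>n\<close> distinct roots.

  The bounds on \<open>q\<close> have separate purposes. From \<open>n < 2 * q\<close> an element of
  order \<open>q\<close> is a single \<open>q\<close>-cycle whose support is more than half of the
  roots, so that any two images of the support meet. From \<open>q + 2 < n\<close> the cycle fixes
  at least three roots, enough room for a 3-cycle. Primitivity is established on the support of the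
  cycle only and is carried from there to larger sets, one point at a time.\<close>

lemma funpow_prime_order_fixed:
  assumes "Factorial_Ring.prime (q::nat)" "(c ^^ q) x = x" "(c ^^ i) x = x" "\<not> q dvd i"
  shows "c x = x"
proof -
  have fix_mult: "(c ^^ (k * m)) x = x" if "(c ^^ m) x = x" for k m
    using that by (induction k) (auto simp: funpow_add)
  have "coprime i q"
    using prime_imp_coprime[OF assms(1,4)] by (simp add: coprime_commute)
  moreover have "i \<noteq> 0" using assms(4) by (metis dvd_0_right)
  moreover have "q \<noteq> 1" using assms(1) by auto
  \<comment> \<open>Bezout over the naturals: \<open>i * a\<close> iterates are \<open>q * b\<close>
    iterates and one more, so the argument stays with forward iterates of \<open>c\<close>.\<close>
  ultimately obtain a b where ab: "i * a = Suc (q * b)"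
    using coprime_bezout_strong[of i q] by auto
  have "c x = c ((c ^^ (q * b)) x)"
    using fix_mult[OF assms(2), of b] by (simp add: mult.commute)
  also have "\<dots> = (c ^^ (i * a)) x" by (simp add: ab)
  also have "\<dots> = x" using fix_mult[OF assms(3), of a] by (simp add: mult.commute)
  finally show ?thesis .
qed

lemma funpow_prime_order_inj_on:
  assumes "Factorial_Ring.prime (q::nat)" "(c ^^ q) x = x" "c x \<noteq> x" "inj c"
  shows "inj_on (\<lambda>i. (c ^^ i) x) {..<q}"
proof -
  show ?thesis
  proof (rule linorder_inj_onI')
    fix i j assume ij: "i \<in> {..<q}" "j \<in> {..<q}" "i < j"
    show "(c ^^ i) x \<noteq> (c ^^ j) x"
    proof
      assume eq: "(c ^^ i) x = (c ^^ j) x"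
      have "(c ^^ j) x = (c ^^ (i + (j - i))) x" using ij(3) by simp
      also have "\<dots> = (c ^^ i) ((c ^^ (j - i)) x)" by (simp only: funpow_add comp_apply)
      finally have "(c ^^ i) ((c ^^ (j - i)) x) = (c ^^ i) x" using eq by simp
      hence "(c ^^ (j - i)) x = x" using inj_fn[OF assms(4), of i] by (rule injD[rotated])
      moreover have "\<not> q dvd (j - i)" using ij by (auto dest: dvd_imp_le)
      ultimately show False using funpow_prime_order_fixed[OF assms(1,2)] assms(3) by blast
    qed
  qed
qed

text \<open>As \<open>q\<close> is prime and no point is fixed, every orbit has exactly
  \<open>q\<close> points; the orbits are removed one at a time.\<close>

lemma card_dvd_if_fixed_point_free:
  fixes Y :: "'b set"
  assumes "finite Y" "Factorial_Ring.prime (q::nat)" "inj_on c Y"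
    and "\<And>x. x \<in> Y \<Longrightarrow> c x \<in> Y" "\<And>x. x \<in> Y \<Longrightarrow> (c ^^ q) x = x" "\<And>x. x \<in> Y \<Longrightarrow> c x \<noteq> x"
  shows "q dvd card Y"
  using assms
proof (induction "card Y" arbitrary: Y rule: less_induct)
  case less
  show ?case
  proof (cases "Y = {}")
    case False
    then obtain x where x: "x \<in> Y" by blast
    \<comment> \<open>\<open>c\<close> is injective only on \<open>Y\<close>; continued by the
      identity it becomes globally injective, as the orbit count demands.\<close>
    define c' where "c' = (\<lambda>y. if y \<in> Y then c y else y)"
    have q0: "q > 0" using less.prems(2) by (rule prime_gt_0_nat)
    have "inj c'"
      unfolding c'_def using less.prems(3,4) by (auto simp: inj_on_def)
    have pow: "(c' ^^ i) y = (c ^^ i) y \<and> (c ^^ i) y \<in> Y" if "y \<in> Y" for i y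
      using that less.prems(4) by (induction i) (auto simp: c'_def)
    define Orb where "Orb = (\<lambda>i. (c' ^^ i) x) ` {..<q}"
    have "inj_on (\<lambda>i. (c' ^^ i) x) {..<q}"
      using x less.prems pow[OF x] \<open>inj c'\<close> by (intro funpow_prime_order_inj_on) (auto simp: c'_def)
    hence cardO: "card Orb = q"
      by (simp add: Orb_def card_image)
    have OY: "Orb \<subseteq> Y"
      using pow[OF x] by (auto simp: Orb_def)
    have mem: "(c' ^^ i) x \<in> Orb" for i
    proof -
      have "(c' ^^ i) x = (c' ^^ (i mod q)) x"
        using funpow_mod_eq[where f = c' and n = q and x = x and m = i] pow[OF x] less.prems(5)[OF x] by metis
      thus ?thesis using q0 by (auto simp: Orb_def)
    qed
    \<comment> \<open>The complement of an orbit stays stable under \<open>c\<close>, because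
      \<open>y\<close> is recovered from \<open>c y\<close> by \<open>q - 1\<close> further
      steps.\<close>
    have inv: "y \<in> Orb" if y: "y \<in> Y" "c y \<in> Orb" for y
    proof -
      obtain i where "c y = (c' ^^ i) x"
        using y(2) by (auto simp: Orb_def)
      hence i: "c' y = (c' ^^ i) x"
        using y(1) by (simp add: c'_def)
      have "y = (c' ^^ q) y"
        using pow[OF that(1)] less.prems(5)[OF that(1)] by simp
      also have "\<dots> = (c' ^^ (q - 1)) (c' y)"
        using q0 by (metis Suc_pred' comp_apply funpow_Suc_right)
      also have "\<dots> = (c' ^^ (q - 1 + i)) x"
        by (simp add: i funpow_add)
      finally show ?thesis using mem by metis
    qed
    have "finite Orb" by (simp add: Orb_def)
    have "q dvd card (Y - Orb)"
    proof (rule less.hyps)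
      show "card (Y - Orb) < card Y"
        using OY card_mono[OF less.prems(1) OY] cardO q0 \<open>finite Orb\<close>
        by (simp add: card_Diff_subset)
      show "inj_on c (Y - Orb)"
        using less.prems(3) by (auto simp: inj_on_def)
    qed (use less.prems inv in auto)
    moreover have "card Y = card (Y - Orb) + card Orb"
      using OY less.prems(1) \<open>finite Orb\<close> by (simp add: card_Diff_subset card_mono)
    ultimately show ?thesis by (simp add: cardO)
  qed simp
qed

text \<open>Sylow conjugacy in the case where \<open>q\<close> divides the order just once. Right
  translation by \<open>x\<close> permutes the right cosets of \<open>P\<close>; without a fixed
  coset \<open>q\<close> would divide the index, hence \<open>q * q\<close> the order. A fixed coset
  \<open>P #> h\<close> says that \<open>h \<otimes> x \<otimes> inv h\<close> lies in
  \<open>P\<close>.\<close>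

lemma (in group) conjugate_in_subgroup_of_prime_order:
  assumes "finite (carrier G)" "Factorial_Ring.prime q" "\<not> q * q dvd Coset.order G"
    and P: "subgroup P G" "card P = q"
    and x: "x \<in> carrier G" "x [^] q = \<one>"
  shows "\<exists>h\<in>carrier G. h \<otimes> x \<otimes> inv h \<in> P"
proof (rule ccontr)
  assume no: "\<not> ?thesis"
  have PG: "P \<subseteq> carrier G" using P(1) by (rule subgroup.subset)
  define c where "c = (\<lambda>C. C #> x)"
  have pow: "(c ^^ i) (P #> h) = P #> (h \<otimes> x [^] i)" if "h \<in> carrier G" for h i
    using that x by (induction i) (simp_all add: c_def coset_mult_assoc PG m_assoc)
  have "q dvd card (rcosets P)"
  proof (rule card_dvd_if_fixed_point_free)
    show "finite (rcosets P)"
      using assms(1) by (simp add: RCOSETS_def)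
    show "Factorial_Ring.prime q" by fact
    show "inj_on c (rcosets P)"
    proof (rule inj_onI)
      fix A B assume AB: "A \<in> rcosets P" "B \<in> rcosets P" "c A = c B"
      have "A \<subseteq> carrier G" "B \<subseteq> carrier G"
        using AB(1,2) subgroup.rcosets_carrier[OF P(1) is_group] by simp_all
      hence "A = c A #> inv x" "B = c B #> inv x"
        unfolding c_def using x(1) coset_mult_assoc by simp_all
      thus "A = B" using AB(3) by simp
    qed
    fix A assume "A \<in> rcosets P"
    then obtain h where h: "h \<in> carrier G" "A = P #> h"
      by (auto simp: RCOSETS_def)
    show "c A \<in> rcosets P"
      using h x PG by (auto simp: c_def coset_mult_assoc intro!: rcosetsI)
    show "(c ^^ q) A = A"
      using pow[OF h(1)] h x by simp
    show "c A \<noteq> A"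
    proof
      assume "c A = A"
      hence "P #> (h \<otimes> x) = P #> h"
        using h x PG by (simp add: c_def coset_mult_assoc)
      hence "P #> (h \<otimes> x \<otimes> inv h) = P"
        using h(1) x(1) PG by (rule_tac coset_mult_inv2) simp_all
      hence "h \<otimes> x \<otimes> inv h \<in> P"
        using h(1) x(1) P(1) by (rule_tac coset_join1) simp_all
      thus False using no h by blast
    qed
  qed
  hence "q * q dvd card (rcosets P) * card P"
    using P(2) by simp
  thus False
    using lagrange[OF P(1)] assms(3) by simp
qed

section \<open>Permutation groups given as sets of functions\<close>

abbreviation transposition :: "'b \<Rightarrow> 'b \<Rightarrow> 'b \<Rightarrow> 'b" where
  "transposition \<equiv> Transposition.transpose"

abbreviation invp :: "('b \<Rightarrow> 'b) \<Rightarrow> 'b \<Rightarrow> 'b" where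
  "invp \<equiv> inv_into UNIV"

locale permutation_group =
  fixes G :: "('b \<Rightarrow> 'b) set" and \<Omega> :: "'b set"
  assumes finite_\<Omega>: "finite \<Omega>"
    and permutes: "g \<in> G \<Longrightarrow> g permutes \<Omega>"
    and id_mem: "id \<in> G"
    and comp_mem: "g \<in> G \<Longrightarrow> h \<in> G \<Longrightarrow> g \<circ> h \<in> G"
    and inv_mem: "g \<in> G \<Longrightarrow> invp g \<in> G"
begin

text \<open>The record view opens the theorems of Lagrange and Sylow; elsewhere \<open>G\<close> is
  handled by plain composition of functions.\<close>

definition group_record :: "('b \<Rightarrow> 'b) monoid" where
  "group_record = \<lparr>carrier = G, monoid.mult = (\<circ>), one = id\<rparr>"

lemma group_record_simps [simp]:
  "carrier group_record = G" "monoid.mult group_record = (\<circ>)" "\<one>\<^bsub>group_record\<^esub> = id"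
  by (simp_all add: group_record_def)

lemma inv_comp: "g \<in> G \<Longrightarrow> invp g \<circ> g = id" "g \<in> G \<Longrightarrow> g \<circ> invp g = id"
  using permutes_inv_o[OF permutes, of g] by simp_all

lemma inv_apply: "g \<in> G \<Longrightarrow> invp g (g x) = x" "g \<in> G \<Longrightarrow> g (invp g x) = x"
  using permutes_inverses[OF permutes, of g] by simp_all

lemma mem_\<Omega>: "g \<in> G \<Longrightarrow> g x \<in> \<Omega> \<longleftrightarrow> x \<in> \<Omega>"
  by (rule permutes_in_image[OF permutes])

lemma apply_eq_iff: "g \<in> G \<Longrightarrow> g x = g y \<longleftrightarrow> x = y"
  by (metis inv_apply(1))

lemma inj_mem: "g \<in> G \<Longrightarrow> inj g"
  by (simp add: apply_eq_iff inj_def)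

lemma funpow_mem: "g \<in> G \<Longrightarrow> g ^^ i \<in> G"
  by (induction i) (auto simp: id_mem[unfolded id_def] id_mem comp_mem)

lemma group: "group group_record"
proof (rule groupI; simp add: comp_mem id_mem o_assoc)
  show "\<exists>y\<in>G. y \<circ> x = id" if "x \<in> G" for x
    using inv_mem[OF that] inv_comp(1)[OF that] by blast
qed

lemma group_record_pow: "x [^]\<^bsub>group_record\<^esub> (n::nat) = x ^^ n"
  by (induction n) (simp_all add: nat_pow_def funpow_Suc_right del: funpow.simps(2))

lemma group_record_inv: "x \<in> G \<Longrightarrow> inv\<^bsub>group_record\<^esub> x = invp x"
  using group.inv_equality[OF group, of "invp x" x] inv_comp inv_mem by simp

lemma finite_G: "finite G"
  by (rule finite_subset[OF _ finite_permutations[OF finite_\<Omega>]]) (auto simp: permutes)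

lemma Cauchy:
  assumes "Factorial_Ring.prime q" "q dvd card G"
  obtains c where "c \<in> G" "c ^^ q = id" "c \<noteq> id"
proof -
  interpret \<G>: group group_record by (rule group)
  obtain m where "Coset.order group_record = q ^ 1 * m"
    using assms(2) by (auto simp: order_def)
  then obtain P where P: "subgroup P group_record" "card P = q ^ 1"
    using sylow_thm[OF assms(1) group] finite_G group_record_simps(1) by metis
  have "finite P" using P(2) prime_gt_0_nat[OF assms(1)] by (simp add: card_ge_0_finite)
  moreover have "card P > 1" using P(2) prime_gt_1_nat[OF assms(1)] by simp
  moreover have "id \<in> P" using subgroup.one_closed[OF P(1)] by simp
  ultimately obtain c where c: "c \<in> P" "c \<noteq> id"
    by (metis card_1_singleton_iff is_singletonI' is_singleton_def less_irrefl empty_iff One_nat_def)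
  interpret \<P>: group "group_record\<lparr>carrier := P\<rparr>"
    using P(1) group by (rule subgroup.subgroup_is_group)
  have "c [^]\<^bsub>group_record\<lparr>carrier := P\<rparr>\<^esub> Coset.order (group_record\<lparr>carrier := P\<rparr>) = id"
    using \<P>.pow_order_eq_1[of c] c by simp
  hence "c ^^ q = id"
    using P(2) by (simp add: order_def group_record_pow flip: \<G>.nat_pow_consistent)
  thus thesis using that c subgroup.subset[OF P(1)] by auto
qed


section \<open>Pointwise stabilizers, blocks and multiple transitivity\<close>

definition stab :: "'b set \<Rightarrow> ('b \<Rightarrow> 'b) set" where
  "stab U = {g \<in> G. \<forall>x\<in>\<Omega> - U. g x = x}"

text \<open>This says that \<open>stab U\<close> has no nontrivial block in \<open>U\<close>: an
  image of a block either equals the block or is disjoint from it. It is primitivity, with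
  transitivity kept as a separate assumption.\<close>

definition spreading :: "'b set \<Rightarrow> bool" where
  "spreading U \<longleftrightarrow>
     (\<forall>E\<subseteq>U. 2 \<le> card E \<longrightarrow> E \<noteq> U \<longrightarrow> (\<exists>h\<in>stab U. E \<inter> h ` E \<noteq> {} \<and> h ` E \<noteq> E))"

text \<open>Distinct lists serve as ordered tuples. The set \<open>S\<close> is a parameter because
  the notion is applied to the stabilizers as well as to \<open>G\<close>.\<close>

definition mult_transitive :: "('b \<Rightarrow> 'b) set \<Rightarrow> 'b set \<Rightarrow> nat \<Rightarrow> bool" where
  "mult_transitive S U k \<longleftrightarrow>
     (\<forall>xs ys. distinct xs \<longrightarrow> distinct ys \<longrightarrow> set xs \<subseteq> U \<longrightarrow> set ys \<subseteq> U \<longrightarrow>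
        length xs = k \<longrightarrow> length ys = k \<longrightarrow> (\<exists>g\<in>S. map g xs = ys))"

lemma mult_transitiveD:
  assumes "mult_transitive S U k" "distinct xs" "distinct ys" "set xs \<subseteq> U" "set ys \<subseteq> U"
    "length xs = k" "length ys = k"
  obtains g where "g \<in> S" "map g xs = ys"
  using assms unfolding mult_transitive_def by blast

lemma stabD: "g \<in> stab U \<Longrightarrow> g \<in> G" "g \<in> stab U \<Longrightarrow> x \<notin> U \<Longrightarrow> g x = x"
  using permutes_not_in[OF permutes, of g x] unfolding stab_def by blast+

lemma stab_\<Omega>: "stab \<Omega> = G"
  by (auto simp: stab_def)

lemma stab_mono: "U \<subseteq> V \<Longrightarrow> stab U \<subseteq> stab V"
  by (auto simp: stab_def)

lemma stab_permutation_group: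
  assumes "U \<subseteq> \<Omega>"
  shows "permutation_group (stab U) U"
proof
  show "finite U" using assms finite_\<Omega> by (rule finite_subset)
  show "g permutes U" if "g \<in> stab U" for g
    using stabD(2)[OF that] permutes[OF stabD(1)[OF that]]
    unfolding permutes_def by blast
  show "id \<in> stab U" "\<And>g h. g \<in> stab U \<Longrightarrow> h \<in> stab U \<Longrightarrow> g \<circ> h \<in> stab U"
    unfolding stab_def using id_mem comp_mem by simp_all
  show "invp g \<in> stab U" if "g \<in> stab U" for g
  proof -
    have "invp g x = x" if "x \<in> \<Omega> - U" for x
      using inv_apply(1)[of g x] \<open>g \<in> stab U\<close> that by (auto simp: stab_def)
    thus ?thesis using inv_mem[of g] that by (auto simp: stab_def)
  qed
qed

lemma conj_stab:
  assumes "g \<in> G" "h \<in> stab U"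
  shows "g \<circ> h \<circ> invp g \<in> stab (g ` U)"
proof -
  have "g (h (invp g x)) = x" if "x \<notin> g ` U" for x
  proof -
    have "invp g x \<notin> U"
      using that inv_apply(2)[OF assms(1), of x] by (metis imageI)
    thus ?thesis using stabD(2)[OF assms(2)] inv_apply(2)[OF assms(1)] by simp
  qed
  thus ?thesis
    using comp_mem[OF comp_mem[OF assms(1) stabD(1)[OF assms(2)]] inv_mem[OF assms(1)]]
    by (simp add: stab_def)
qed

lemma spreading_image:
  assumes "spreading U" "g \<in> G"
  shows "spreading (g ` U)"
  unfolding spreading_def
proof (intro allI impI)
  fix E assume E: "E \<subseteq> g ` U" "2 \<le> card E" "E \<noteq> g ` U"
  obtain F where F: "F \<subseteq> U" "E = g ` F"
    using E(1) by (auto simp: subset_image_iff)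
  have "inj g" using assms(2) by (rule inj_mem)
  hence "card F = card E" using F(2) by (simp add: card_image inj_on_subset[OF _ subset_UNIV])
  moreover have "F \<noteq> U" using E(3) F(2) by auto
  ultimately obtain h where h: "h \<in> stab U" "F \<inter> h ` F \<noteq> {}" "h ` F \<noteq> F"
    using assms(1) F(1) E(2) unfolding spreading_def by metis
  have "(g \<circ> h \<circ> invp g) ` E = g ` h ` F"
    using inv_apply[OF assms(2)] by (simp add: F(2) image_image)
  moreover have "g ` h ` F \<noteq> g ` F"
    using h(3) \<open>inj g\<close> by (simp add: inj_image_eq_iff)
  moreover have "g ` F \<inter> g ` h ` F \<noteq> {}"
    using h(2) by blast
  ultimately show "\<exists>h\<in>stab (g ` U). E \<inter> h ` E \<noteq> {} \<and> h ` E \<noteq> E"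
    using conj_stab[OF assms(2) h(1)] F(2) by metis
qed

text \<open>
  Among the images of \<open>U\<close> other than \<open>U\<close>, one with the largest overlap misses just one point of \<open>U\<close>:
  otherwise an element \<open>h\<close> of the conjugate stabilizer would give \<open>h ` U\<close> a larger overlap.
\<close>

lemma exists_near_image:
  assumes U: "U \<subseteq> \<Omega>" "spreading U" "card \<Omega> < 2 * card U" "U \<noteq> \<Omega>"
    and trans: "\<And>x y. x \<in> \<Omega> \<Longrightarrow> y \<in> \<Omega> \<Longrightarrow> \<exists>g\<in>G. g x = y"
  obtains g where "g \<in> G" "card (g ` U - U) = 1"
proof -
  define A where "A = {g \<in> G. g ` U \<noteq> U}"
  define f where "f = (\<lambda>g. card (U \<inter> g ` U))"
  have fin: "finite W" if "W \<subseteq> \<Omega>" for W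
    using that finite_\<Omega> by (rule finite_subset)
  have img: "g ` W \<subseteq> \<Omega>" if "g \<in> G" "W \<subseteq> \<Omega>" for g W
    using that mem_\<Omega> by auto
  have card_img: "card (g ` W) = card W" if "g \<in> G" for g W
    using inj_mem[OF that] by (simp add: card_image inj_on_subset[OF _ subset_UNIV])
  have "A \<noteq> {}"
  proof -
    have "U \<noteq> {}" using U(3) by auto
    then obtain x y where "x \<in> U" "y \<in> \<Omega>" "y \<notin> U" using U(1,4) by blast
    then obtain g where "g \<in> G" "g x = y" using trans U(1) by blast
    hence "g \<in> A" using \<open>x \<in> U\<close> \<open>y \<notin> U\<close> by (auto simp: A_def)
    thus ?thesis by blast
  qed
  moreover have "finite A" using finite_G by (simp add: A_def)
  ultimately have "Max (f ` A) \<in> f ` A" "\<And>h. h \<in> A \<Longrightarrow> f h \<le> Max (f ` A)"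
    by (auto intro!: Max_in Max_ge)
  then obtain g where g: "g \<in> A" and max: "\<And>h. h \<in> A \<Longrightarrow> f h \<le> f g"
    by fastforce
  have gG: "g \<in> G" and gU: "g ` U \<noteq> U" using g by (auto simp: A_def)
  define V E \<Gamma> where "V = g ` U" and "E = V - U" and "\<Gamma> = U \<inter> V"
  have V\<Omega>: "V \<subseteq> \<Omega>" unfolding V_def by (rule img[OF gG U(1)])
  have finUV: "finite U" "finite V" using fin U(1) V\<Omega> by auto
  have cardV: "card V = card U" unfolding V_def by (rule card_img[OF gG])
  have "\<not> V \<subseteq> U"
    using gU cardV finUV card_subset_eq V_def by metis
  hence "E \<noteq> {}" by (auto simp: E_def)
  have finE: "finite E" "finite \<Gamma>" using finUV by (auto simp: E_def \<Gamma>_def)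
  have split: "card E + card \<Gamma> = card U"
  proof -
    have "V = E \<union> \<Gamma>" "E \<inter> \<Gamma> = {}" by (auto simp: E_def \<Gamma>_def)
    hence "card V = card E + card \<Gamma>" using finE by (metis card_Un_disjoint)
    thus ?thesis using cardV by simp
  qed
  have "card E = 1"
  proof (rule ccontr)
    assume "card E \<noteq> 1"
    moreover have "card E \<noteq> 0" using \<open>E \<noteq> {}\<close> finE by simp
    ultimately have "2 \<le> card E" by linarith
    \<comment> \<open>Two disjoint images of \<open>U\<close> do not fit into
      \<open>\<Omega>\<close>.\<close>
    moreover have "E \<noteq> V"
    proof
      assume "E = V"
      hence "U \<inter> V = {}" by (auto simp: E_def)
      hence "card (U \<union> V) = 2 * card U" using finUV cardV by (simp add: card_Un_disjoint)
      moreover have "card (U \<union> V) \<le> card \<Omega>" using U(1) V\<Omega> finite_\<Omega> by (intro card_mono) auto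
      ultimately show False using U(3) by simp
    qed
    moreover have "E \<subseteq> V" by (auto simp: E_def)
    ultimately obtain h where h: "h \<in> stab V" "E \<inter> h ` E \<noteq> {}" "h ` E \<noteq> E"
      using spreading_image[OF U(2) gG] unfolding V_def spreading_def by metis
    have hG: "h \<in> G" using h(1) by (rule stabD)
    have inj: "inj h" using hG by (rule inj_mem)
    have hV: "h ` V = V"
      using permutation_group.permutes[OF stab_permutation_group[OF V\<Omega>] h(1)] by (rule permutes_image)
    have "h ` U \<noteq> U"
    proof
      assume "h ` U = U"
      moreover have "h ` E = h ` V - h ` U" by (simp add: E_def image_set_diff[OF inj])
      ultimately show False using h(3) hV E_def by simp
    qed
    hence "h \<in> A" using hG by (simp add: A_def)
    hence "card (U \<inter> h ` U) \<le> card \<Gamma>"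
      using max[of h] by (simp add: f_def \<Gamma>_def V_def)
    \<comment> \<open>\<open>h\<close> fixes every point outside \<open>V\<close>, so
      \<open>U - V\<close> is kept in the image of \<open>U\<close> under \<open>h\<close> and only
      the part in \<open>\<Gamma>\<close> can shrink.\<close>
    moreover have "card E + card (\<Gamma> \<inter> h ` \<Gamma>) \<le> card (U \<inter> h ` U)"
    proof -
      have "card (U - V) = card E"
        using split finUV by (simp add: card_Diff_subset_Int \<Gamma>_def)
      moreover have "card ((U - V) \<union> (\<Gamma> \<inter> h ` \<Gamma>)) = card (U - V) + card (\<Gamma> \<inter> h ` \<Gamma>)"
        using finUV finE by (intro card_Un_disjoint) (auto simp: \<Gamma>_def)
      moreover have "U - V \<subseteq> h ` U"
      proof
        fix x assume "x \<in> U - V"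
        hence "h x = x" "x \<in> U" using stabD(2)[OF h(1)] by auto
        thus "x \<in> h ` U" by (metis imageI)
      qed
      hence "(U - V) \<union> (\<Gamma> \<inter> h ` \<Gamma>) \<subseteq> U \<inter> h ` U" by (auto simp: \<Gamma>_def)
      hence "card ((U - V) \<union> (\<Gamma> \<inter> h ` \<Gamma>)) \<le> card (U \<inter> h ` U)"
        using finUV by (intro card_mono) auto
      ultimately show ?thesis by linarith
    qed
    \<comment> \<open>\<open>E\<close> and its image under \<open>h\<close> share a point, so
      together they cover at most \<open>2 * card E - 1\<close> points of \<open>V\<close>. The
      point saved makes the new overlap exceed \<open>card \<Gamma>\<close>, against
      maximality.\<close>
    moreover have "card U + 1 \<le> card (\<Gamma> \<inter> h ` \<Gamma>) + 2 * card E"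
    proof -
      have "V = h ` E \<union> h ` \<Gamma>"
        using hV by (auto simp: E_def \<Gamma>_def)
      hence "V \<subseteq> (\<Gamma> \<inter> h ` \<Gamma>) \<union> (E \<union> h ` E)" by (auto simp: E_def \<Gamma>_def)
      hence "card V \<le> card ((\<Gamma> \<inter> h ` \<Gamma>) \<union> (E \<union> h ` E))"
        using finE by (intro card_mono) auto
      also have "\<dots> \<le> card (\<Gamma> \<inter> h ` \<Gamma>) + card (E \<union> h ` E)" by (rule card_Un_le)
      finally have "card V \<le> card (\<Gamma> \<inter> h ` \<Gamma>) + card (E \<union> h ` E)" .
      moreover have "card (E \<union> h ` E) + card (E \<inter> h ` E) = 2 * card E"
        using card_Un_Int[of E "h ` E"] finE card_img[OF hG, of E] by simp
      moreover have "card (E \<inter> h ` E) \<noteq> 0" using h(2) finE by simp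
      ultimately show ?thesis using cardV by linarith
    qed
    ultimately show False using split by linarith
  qed
  thus thesis using that gG by (auto simp: E_def V_def)
qed

text \<open>\<open>stab U\<close> fixes \<open>z\<close> and is \<open>k\<close>-transitive on the
  other points, so it is enough to bring the first entry of a tuple to \<open>z\<close> and correct
  the others inside \<open>stab U\<close>. An arbitrary point reaches \<open>z\<close> by way of
  \<open>w\<close>: \<open>stab U\<close> and its conjugate by \<open>g\<close> act transitively on
  overlapping sets, and only the second contains \<open>z\<close>.\<close>

lemma mult_transitive_extend:
  assumes U: "U \<subseteq> \<Omega>" "2 \<le> card U" "mult_transitive (stab U) U k" "1 \<le> k"
    and trans: "\<And>x y. x \<in> U \<Longrightarrow> y \<in> U \<Longrightarrow> \<exists>g\<in>stab U. g x = y"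
    and g: "g \<in> G" "g ` U - U = {z}"
  shows "mult_transitive (stab (insert z U)) (insert z U) (Suc k)"
proof -
  have z: "z \<in> g ` U" "z \<notin> U" using g(2) by auto
  hence "z \<in> \<Omega>" using mem_\<Omega>[OF g(1)] U(1) by auto
  interpret T: permutation_group "stab (insert z U)" "insert z U"
    using U(1) \<open>z \<in> \<Omega>\<close> by (intro stab_permutation_group) auto
  have sub: "stab U \<subseteq> stab (insert z U)" "stab (g ` U) \<subseteq> stab (insert z U)"
    using g(2) by (intro stab_mono; auto)+
  have "\<not> g ` U \<subseteq> {z}"
  proof
    assume "g ` U \<subseteq> {z}"
    hence "card (g ` U) \<le> 1" using card_mono[of "{z}" "g ` U"] by simp
    thus False using U(2) inj_mem[OF g(1)] by (simp add: card_image inj_on_subset[OF _ subset_UNIV])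
  qed
  then obtain w where w: "w \<in> g ` U" "w \<in> U" using g(2) by auto
  have to_z: "\<exists>t\<in>stab (insert z U). t y = z" if y: "y \<in> insert z U" for y
  proof (cases "y = z")
    case True
    thus ?thesis using T.id_mem by (intro bexI[of _ id]) auto
  next
    case False
    then obtain s where s: "s \<in> stab U" "s y = w" using y trans w by blast
    obtain a b where ab: "a \<in> U" "b \<in> U" "g a = w" "g b = z" using w z by auto
    then obtain r where r: "r \<in> stab U" "r a = b" using trans by blast
    have "(g \<circ> r \<circ> invp g) (s y) = z"
      using s r ab inv_apply(1)[OF g(1), of a] by simp
    thus ?thesis
      using T.comp_mem[OF subsetD[OF sub(2) conj_stab[OF g(1) r(1)]] subsetD[OF sub(1) s(1)]]
      by (intro bexI[of _ "(g \<circ> r \<circ> invp g) \<circ> s"]) simp_all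
  qed
  show ?thesis
    unfolding mult_transitive_def
  proof (intro allI impI)
    fix xs ys assume xs: "distinct xs" "set xs \<subseteq> insert z U" "length xs = Suc k"
      and ys: "distinct ys" "set ys \<subseteq> insert z U" "length ys = Suc k"
    have split: "\<exists>t ws. t \<in> stab (insert z U) \<and> map t ys = z # ws \<and> distinct ws \<and> set ws \<subseteq> U \<and> length ws = k"
      if ys: "distinct ys" "set ys \<subseteq> insert z U" "length ys = Suc k" for ys
    proof -
      obtain y ys' where y: "ys = y # ys'" using ys(3) by (cases ys) auto
      then obtain t where t: "t \<in> stab (insert z U)" "t y = z" using to_z ys(2) by auto
      have "distinct (map t ys)" using ys(1) T.inj_mem[OF t(1)] by (simp add: distinct_map inj_on_subset[OF _ subset_UNIV])
      moreover have "set (map t ys) \<subseteq> insert z U" using ys(2) T.mem_\<Omega>[OF t(1)] by auto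
      moreover have "map t ys = z # map t ys'" using y t(2) by simp
      ultimately have "distinct (z # map t ys')" "set (z # map t ys') \<subseteq> insert z U" by metis+
      hence "distinct (map t ys')" "set (map t ys') \<subseteq> U" by auto
      thus ?thesis
        using t y ys(3) by (intro exI[of _ t] exI[of _ "map t ys'"]) auto
    qed
    obtain t ws where t: "t \<in> stab (insert z U)" "map t xs = z # ws" "distinct ws" "set ws \<subseteq> U" "length ws = k"
      using split[OF xs] by (elim exE conjE) (rule that)
    obtain t' ws' where t': "t' \<in> stab (insert z U)" "map t' ys = z # ws'" "distinct ws'" "set ws' \<subseteq> U" "length ws' = k"
      using split[OF ys] by (elim exE conjE) (rule that)
    obtain s where s: "s \<in> stab U" "map s ws = ws'"
      by (rule mult_transitiveD[OF U(3) t(3) t'(3) t(4) t'(4) t(5) t'(5)])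
    have "map (s \<circ> t) xs = map s (map t xs)" by simp
    also have "\<dots> = map t' ys"
      by (simp only: t(2) t'(2) list.map s(2) stabD(2)[OF s(1) z(2)])
    finally have "map (invp t' \<circ> (s \<circ> t)) xs = map (invp t') (map t' ys)"
      by (metis list.map_comp)
    also have "\<dots> = map (invp t' \<circ> t') ys" by simp
    also have "\<dots> = ys" by (simp only: T.inv_comp(1)[OF t'(1)] list.map_id)
    finally have "map (invp t' \<circ> (s \<circ> t)) xs = ys" .
    thus "\<exists>g\<in>stab (insert z U). map g xs = ys"
      using T.comp_mem[OF T.inv_mem[OF t'(1)] T.comp_mem[OF subsetD[OF sub(1) s(1)] t(1)]] by blast
  qed
qed

lemma mult_transitive_mono:
  assumes "mult_transitive S U k" "j \<le> k" "k \<le> card U" "finite U"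
  shows "mult_transitive S U j"
  unfolding mult_transitive_def
proof (intro allI impI)
  fix xs ys assume xs: "distinct xs" "set xs \<subseteq> U" "length xs = j"
    and ys: "distinct ys" "set ys \<subseteq> U" "length ys = j"
  have extend: "\<exists>zs. distinct (xs @ zs) \<and> set (xs @ zs) \<subseteq> U \<and> length (xs @ zs) = k"
    if xs: "distinct xs" "set xs \<subseteq> U" "length xs = j" for xs
  proof -
    have "card (U - set xs) = card U - j"
      using xs assms(4) by (simp add: card_Diff_subset distinct_card)
    hence "k - j \<le> card (U - set xs)" using assms(3) by simp
    then obtain B where B: "B \<subseteq> U - set xs" "card B = k - j" "finite B"
      by (rule obtain_subset_with_card_n)
    then obtain zs where "set zs = B" "distinct zs" using finite_distinct_list by blast
    thus ?thesis using B xs assms(2) by (intro exI[of _ zs]) (auto simp: distinct_card[symmetric])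
  qed
  obtain zs zs' where zs: "distinct (xs @ zs)" "set (xs @ zs) \<subseteq> U" "length (xs @ zs) = k"
    "distinct (ys @ zs')" "set (ys @ zs') \<subseteq> U" "length (ys @ zs') = k"
    using extend[OF xs] extend[OF ys] by blast
  then obtain g where "g \<in> S" "map g (xs @ zs) = ys @ zs'"
    using mult_transitiveD[OF assms(1)] by metis
  thus "\<exists>g\<in>S. map g xs = ys" using xs(3) ys(3) by auto
qed

lemma transitive_if_mult_transitive:
  assumes "mult_transitive S U 1" "x \<in> U" "y \<in> U"
  shows "\<exists>g\<in>S. g x = y"
  using mult_transitiveD[OF assms(1), of "[x]" "[y]"] assms(2,3) by auto

text \<open>The witness fixes one point of \<open>E\<close> and throws another out of
  \<open>E\<close>, which no block allows.\<close>

lemma spreading_if_2_transitive: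
  assumes "mult_transitive (stab U) U 2"
  shows "spreading U"
  unfolding spreading_def
proof (intro allI impI)
  fix E assume E: "E \<subseteq> U" "2 \<le> card E" "E \<noteq> U"
  obtain a b where ab: "a \<in> E" "b \<in> E" "a \<noteq> b"
    using E(2) by (metis card_le_Suc0_iff_eq card.infinite not_less_eq_eq numeral_2_eq_2 zero_le)
  obtain z where z: "z \<in> U" "z \<notin> E" using E by blast
  obtain h where "h \<in> stab U" "map h [a, b] = [a, z]"
    using mult_transitiveD[OF assms, of "[a, b]" "[a, z]"] ab z E(1) by (auto simp: subset_iff)
  thus "\<exists>h\<in>stab U. E \<inter> h ` E \<noteq> {} \<and> h ` E \<noteq> E"
    using ab z by (intro bexI[of _ h] conjI) (force, force, assumption)
qed

text \<open>Each near image adds one point and one degree of transitivity. The enlarged stabilizer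
  is at least 2-transitive, so \<open>spreading\<close> renews itself, and the size bound only
  improves.\<close>

lemma mult_transitive_chain:
  assumes U: "U \<subseteq> \<Omega>" "spreading U" "card \<Omega> < 2 * card U" "2 \<le> card U"
    and trans: "mult_transitive (stab U) U 1" "\<And>x y. x \<in> \<Omega> \<Longrightarrow> y \<in> \<Omega> \<Longrightarrow> \<exists>g\<in>G. g x = y"
    and "j \<le> card \<Omega> - card U"
  shows "\<exists>V\<subseteq>\<Omega>. card V = card U + j \<and> spreading V \<and> mult_transitive (stab V) V (Suc j)"
  using assms(7)
proof (induction j)
  case 0
  thus ?case using U trans(1) by auto
next
  case (Suc j)
  then obtain V where V: "V \<subseteq> \<Omega>" "card V = card U + j" "spreading V" "mult_transitive (stab V) V (Suc j)"
    by auto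
  have finV: "finite V" using V(1) finite_\<Omega> by (rule finite_subset)
  have "V \<noteq> \<Omega>" using Suc.prems V(2) by auto
  moreover have "card \<Omega> < 2 * card V" using V(2) U(3) by simp
  ultimately obtain g where g: "g \<in> G" "card (g ` V - V) = 1"
    using exists_near_image[OF V(1,3)] trans(2) by metis
  then obtain z where z: "g ` V - V = {z}" by (auto simp: card_1_singleton_iff)
  have "\<And>x y. x \<in> V \<Longrightarrow> y \<in> V \<Longrightarrow> \<exists>g\<in>stab V. g x = y"
    using transitive_if_mult_transitive[OF mult_transitive_mono[OF V(4), of 1]] V(2) U(4) finV by simp
  hence mt: "mult_transitive (stab (insert z V)) (insert z V) (Suc (Suc j))"
    using mult_transitive_extend[OF V(1) _ V(4) _ _ g(1) z] V(2) U(4) by simp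
  have "z \<in> g ` V" "z \<notin> V" using z by auto
  moreover from this have "z \<in> \<Omega>" using V(1) mem_\<Omega>[OF g(1)] by auto
  ultimately have card: "card (insert z V) = card U + Suc j" and "z \<in> \<Omega>"
    using finV V(2) by simp_all
  have "mult_transitive (stab (insert z V)) (insert z V) 2"
    using mult_transitive_mono[OF mt] card U(4) finV by simp
  thus ?case
    using V(1) \<open>z \<in> \<Omega>\<close> card mt spreading_if_2_transitive by (intro exI[of _ "insert z V"] conjI) simp_all
qed

lemma mult_transitive_G:
  assumes U: "U \<subseteq> \<Omega>" "spreading U" "card \<Omega> < 2 * card U" "2 \<le> card U"
    and trans: "mult_transitive (stab U) U 1" "\<And>x y. x \<in> \<Omega> \<Longrightarrow> y \<in> \<Omega> \<Longrightarrow> \<exists>g\<in>G. g x = y"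
    and "k \<le> Suc (card \<Omega> - card U)"
  shows "mult_transitive G \<Omega> k"
proof -
  have le: "card U \<le> card \<Omega>" using U(1) finite_\<Omega> by (rule card_mono[rotated])
  obtain V where V: "V \<subseteq> \<Omega>" "card V = card \<Omega>" "mult_transitive (stab V) V (Suc (card \<Omega> - card U))"
    using mult_transitive_chain[OF U trans order_refl] le by (metis le_add_diff_inverse)
  hence "V = \<Omega>" using finite_\<Omega> card_subset_eq by metis
  hence "mult_transitive G \<Omega> (Suc (card \<Omega> - card U))" using V(3) stab_\<Omega> by simp
  thus ?thesis using mult_transitive_mono assms(7) U(4) le finite_\<Omega> by auto
qed

section \<open>Elements of large prime order\<close>

lemma prime_order_cycle:
  assumes "Factorial_Ring.prime q" "c \<in> G" "c ^^ q = id" "c a \<noteq> a" "card \<Omega> < 2 * q"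
  defines "\<Delta> \<equiv> {x. c x \<noteq> x}"
  shows "\<Delta> \<subseteq> \<Omega>" "card \<Delta> = q"
    and "\<And>x y. x \<in> \<Delta> \<Longrightarrow> y \<in> \<Delta> \<Longrightarrow> \<exists>i<q. (c ^^ i) x = y"
proof -
  have q0: "q > 0" using assms(1) by (rule prime_gt_0_nat)
  show \<Delta>: "\<Delta> \<subseteq> \<Omega>"
    using permutes_not_in[OF permutes[OF assms(2)]] by (auto simp: \<Delta>_def)
  define orb where "orb = (\<lambda>x. (\<lambda>i. (c ^^ i) x) ` {..<q})"
  have pow_fix: "(c ^^ i) x \<in> \<Delta>" if "x \<in> \<Delta>" for x i
  proof -
    have "c ((c ^^ i) x) = (c ^^ i) (c x)" by (simp add: funpow_swap1)
    thus ?thesis using that apply_eq_iff[OF funpow_mem[OF assms(2)]] by (simp add: \<Delta>_def)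
  qed
  have orb: "orb x \<subseteq> \<Delta>" "card (orb x) = q" if "x \<in> \<Delta>" for x
  proof -
    show "orb x \<subseteq> \<Delta>" using pow_fix[OF that] by (auto simp: orb_def)
    have "inj_on (\<lambda>i. (c ^^ i) x) {..<q}"
      using that assms(1,3) inj_mem[OF assms(2)]
      by (intro funpow_prime_order_inj_on) (auto simp: \<Delta>_def)
    thus "card (orb x) = q" by (simp add: orb_def card_image)
  qed
  have mem: "(c ^^ i) x \<in> orb x" for i x
  proof -
    have "(c ^^ i) x = (c ^^ (i mod q)) x"
      using funpow_mod_eq[where f = c and n = q and x = x and m = i] assms(3) by simp
    thus ?thesis using q0 by (auto simp: orb_def)
  qed
  \<comment> \<open>Two different orbits would occupy \<open>2 * q\<close> points, more than
    \<open>\<Omega>\<close> has; so \<open>c\<close> is a single cycle.\<close>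
  have cover: "y \<in> orb x" if "x \<in> \<Delta>" "y \<in> \<Delta>" for x y
  proof (rule ccontr)
    assume "y \<notin> orb x"
    have "orb x \<inter> orb y = {}"
    proof (rule ccontr)
      assume "orb x \<inter> orb y \<noteq> {}"
      then obtain i j where ij: "(c ^^ i) x = (c ^^ j) y" "j < q" by (auto simp: orb_def)
      have "y = (c ^^ (q - j + j)) y" using assms(3) ij(2) by simp
      also have "\<dots> = (c ^^ (q - j)) ((c ^^ j) y)" by (simp only: funpow_add comp_apply)
      also have "\<dots> = (c ^^ (q - j + i)) x" by (simp only: funpow_add comp_apply ij(1))
      finally have "y \<in> orb x" using mem[of "q - j + i" x] by simp
      thus False using \<open>y \<notin> orb x\<close> by contradiction
    qed
    moreover have fin: "finite (orb x)" "finite (orb y)" by (simp_all add: orb_def)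
    ultimately have "card (orb x \<union> orb y) = 2 * q"
      using orb[OF that(1)] orb[OF that(2)] by (simp add: card_Un_disjoint)
    moreover have "card (orb x \<union> orb y) \<le> card \<Omega>"
      using orb[OF that(1)] orb[OF that(2)] \<Delta> finite_\<Omega> by (intro card_mono) auto
    ultimately show False using assms(5) by simp
  qed
  have a: "a \<in> \<Delta>" using assms(4) by (simp add: \<Delta>_def)
  have "orb a = \<Delta>" using orb(1)[OF a] cover[OF a] by auto
  thus "card \<Delta> = q" using orb(2)[OF a] by simp
  show "\<exists>i<q. (c ^^ i) x = y" if "x \<in> \<Delta>" "y \<in> \<Delta>" for x y
    using cover[OF that] by (auto simp: orb_def)
qed

lemma power_mem_stab:
  assumes "c \<in> G"
  shows "c ^^ i \<in> stab {x. c x \<noteq> x}"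
proof -
  have "(c ^^ i) x = x" if "c x = x" for x
    using that by (induction i) auto
  thus ?thesis using funpow_mem[OF assms] by (simp add: stab_def)
qed

text \<open>Some power of \<open>c\<close> takes one point of \<open>E\<close> to another, so
  \<open>E\<close> meets its image. Were \<open>E\<close> invariant under this power, it would be
  invariant under \<open>c\<close>, since the exponent is prime to \<open>q\<close>, and then it
  would contain the whole cycle.\<close>

lemma spreading_prime_order_cycle:
  assumes "Factorial_Ring.prime q" "c \<in> G" "c ^^ q = id" "c a \<noteq> a" "card \<Omega> < 2 * q"
  shows "spreading {x. c x \<noteq> x}" "mult_transitive (stab {x. c x \<noteq> x}) {x. c x \<noteq> x} 1"
proof -
  define \<Delta> where "\<Delta> = {x. c x \<noteq> x}"
  note cyc = prime_order_cycle[OF assms, folded \<Delta>_def]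
  have stab: "c ^^ i \<in> stab \<Delta>" for i
    using power_mem_stab[OF assms(2)] by (simp add: \<Delta>_def)
  show "spreading {x. c x \<noteq> x}"
    unfolding \<Delta>_def[symmetric] spreading_def
  proof (intro allI impI)
    fix E assume E: "E \<subseteq> \<Delta>" "2 \<le> card E" "E \<noteq> \<Delta>"
    obtain x y where xy: "x \<in> E" "y \<in> E" "x \<noteq> y"
      using E(2) by (metis card_le_Suc0_iff_eq card.infinite not_less_eq_eq numeral_2_eq_2 zero_le)
    then obtain i where i: "i < q" "(c ^^ i) x = y"
      using cyc(3)[of x y] E(1) by blast
    have "i \<noteq> 0" using i xy by (metis funpow_0)
    define h where "h = c ^^ i"
    have "h ` E \<noteq> E"
    proof
      assume inv: "h ` E = E"
      obtain z where z: "z \<in> \<Delta>" "z \<notin> E" using E by blast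
      then obtain j where j: "(c ^^ j) x = z" using cyc(3)[of x z] xy E(1) by blast
      have "coprime i q"
        using prime_imp_coprime[OF assms(1), of i] i(1) \<open>i \<noteq> 0\<close> nat_dvd_not_less[of i q]
        by (simp add: coprime_commute)
      moreover have "q \<noteq> 1" using assms(1) by auto
      ultimately obtain u v where uv: "i * u = Suc (q * v)"
        using coprime_bezout_strong[of i q] by auto
      have "(h ^^ k) x \<in> E" for k
        using inv xy(1) by (induction k) auto
      moreover have "(h ^^ (u * j)) x = z"
      proof -
        have "(h ^^ (u * j)) x = (c ^^ (i * (u * j))) x" by (simp add: h_def funpow_mult mult.commute)
        also have "i * (u * j) = j + q * (v * j)" using uv by (metis mult.assoc mult_Suc)
        also have "(c ^^ \<dots>) x = (c ^^ j) x"
          using funpow_mod_eq[where f = c and n = q and x = x and m = "j + q * (v * j)"]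
            funpow_mod_eq[where f = c and n = q and x = x and m = j] assms(3)
          by simp
        finally show ?thesis using j by simp
      qed
      ultimately show False using z(2) by metis
    qed
    moreover have "y \<in> E \<inter> h ` E" using xy i by (auto simp: h_def)
    ultimately show "\<exists>h\<in>stab \<Delta>. E \<inter> h ` E \<noteq> {} \<and> h ` E \<noteq> E"
      using stab[of i] unfolding h_def by blast
  qed
  show "mult_transitive (stab {x. c x \<noteq> x}) {x. c x \<noteq> x} 1"
    unfolding \<Delta>_def[symmetric] mult_transitive_def
  proof (intro allI impI)
    fix xs ys :: "'b list"
    assume "set xs \<subseteq> \<Delta>" "set ys \<subseteq> \<Delta>" "length xs = 1" "length ys = 1"
    then obtain x y where "xs = [x]" "ys = [y]" "x \<in> \<Delta>" "y \<in> \<Delta>"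
      by (auto simp: length_Suc_conv)
    thus "\<exists>g\<in>stab \<Delta>. map g xs = ys" using cyc(3)[of x y] stab by auto
  qed
qed

text \<open>
  Frattini argument: the powers of \<open>c\<close> form a Sylow subgroup of the pointwise stabilizer of the
  fixed points of \<open>c\<close>.
\<close>

lemma exists_normalizing:
  assumes c: "Factorial_Ring.prime q" "c \<in> G" "c ^^ q = id" "c a \<noteq> a" "card \<Omega> < 2 * q"
    and g: "g \<in> G" "g ` {x. c x \<noteq> x} = {x. c x \<noteq> x}"
  obtains u i where "u \<in> G" "u \<circ> c = c ^^ i \<circ> u" "\<And>x. c x = x \<Longrightarrow> u x = g x"
proof -
  define \<Delta> where "\<Delta> = {x. c x \<noteq> x}"
  note cyc = prime_order_cycle[OF c, folded \<Delta>_def]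
  have q0: "q > 0" using c(1) by (rule prime_gt_0_nat)
  interpret H: permutation_group "stab \<Delta>" \<Delta>
    using cyc(1) by (rule stab_permutation_group)
  interpret \<H>: group H.group_record by (rule H.group)
  have stab: "c ^^ i \<in> stab \<Delta>" for i
    using power_mem_stab[OF c(2)] by (simp add: \<Delta>_def)
  define P where "P = (\<lambda>i. c ^^ i) ` {..<q}"
  have memP: "c ^^ i \<in> P" for i
  proof -
    have "c ^^ i = c ^^ (i mod q)"
    proof
      fix x show "(c ^^ i) x = (c ^^ (i mod q)) x"
        using funpow_mod_eq[where f = c and n = q and x = x and m = i] c(3) by simp
    qed
    thus ?thesis using q0 by (auto simp: P_def)
  qed
  have "card P = q"
  proof -
    have "inj_on (\<lambda>i. (c ^^ i) a) {..<q}"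
      using c(1,3,4) inj_mem[OF c(2)] by (intro funpow_prime_order_inj_on) auto
    hence "inj_on (\<lambda>i. c ^^ i) {..<q}"
      by (auto simp: inj_on_def)
    thus ?thesis by (simp add: P_def card_image)
  qed
  have "subgroup P H.group_record"
  proof (rule \<H>.subgroupI; (simp only: H.group_record_simps)?)
    show "P \<subseteq> stab \<Delta>" using stab by (auto simp: P_def)
    show "P \<noteq> {}" using memP by auto
    show "x \<circ> y \<in> P" if xy: "x \<in> P" "y \<in> P" for x y
    proof -
      obtain i j where "x = c ^^ i" "y = c ^^ j" using xy by (auto simp: P_def)
      thus ?thesis using memP[of "i + j"] by (simp add: funpow_add)
    qed
    show "inv\<^bsub>H.group_record\<^esub> x \<in> P" if x: "x \<in> P" for x
    proof -
      obtain i where i: "x = c ^^ i" "i < q" using x by (auto simp: P_def)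
      have "c ^^ (q - i) \<circ> x = c ^^ (q - i + i)" by (simp only: funpow_add i(1))
      hence "c ^^ (q - i) \<circ> x = id" using i(2) c(3) by simp
      hence "inv\<^bsub>H.group_record\<^esub> x = c ^^ (q - i)"
        using stab i(1) by (intro \<H>.inv_equality) simp_all
      thus ?thesis using memP by simp
    qed
  qed
  \<comment> \<open>\<open>stab \<Delta>\<close> sits in the symmetric group of \<open>q\<close>
    points, and \<open>fact q\<close> contains the factor \<open>q\<close> only once.\<close>
  moreover have "\<not> q * q dvd Coset.order H.group_record"
  proof
    assume qq: "q * q dvd Coset.order H.group_record"
    define S where "S = {p. p permutes \<Delta>}"
    interpret S: permutation_group S \<Delta>
    proof
      show "finite \<Delta>" by (rule H.finite_\<Omega>)
      show "id \<in> S" unfolding S_def by (simp add: permutes_id)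
      show "g \<circ> h \<in> S" if "g \<in> S" "h \<in> S" for g h
        using permutes_compose[of h \<Delta> g] that by (simp add: S_def)
      show "invp g \<in> S" if "g \<in> S" for g
        using permutes_inv[of g \<Delta>] that by (simp add: S_def)
    qed (simp add: S_def)
    interpret \<S>: group S.group_record by (rule S.group)
    have "subgroup (stab \<Delta>) S.group_record"
    proof (rule \<S>.subgroupI; (simp only: S.group_record_simps)?)
      show "stab \<Delta> \<subseteq> S" using H.permutes by (auto simp: S_def)
      show "stab \<Delta> \<noteq> {}" using H.id_mem by auto
      show "x \<circ> y \<in> stab \<Delta>" if "x \<in> stab \<Delta>" "y \<in> stab \<Delta>" for x y
        using that by (rule H.comp_mem)
      show "inv\<^bsub>S.group_record\<^esub> x \<in> stab \<Delta>" if "x \<in> stab \<Delta>" for x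
        using S.group_record_inv[of x] H.inv_mem[OF that] H.permutes[OF that] by (simp add: S_def)
    qed
    hence "card (rcosets\<^bsub>S.group_record\<^esub> (stab \<Delta>)) * card (stab \<Delta>) = Coset.order S.group_record"
      by (rule \<S>.lagrange)
    hence "Coset.order H.group_record dvd Coset.order S.group_record"
      unfolding Coset.order_def H.group_record_simps(1) by (metis dvd_triv_right)
    also have "Coset.order S.group_record = fact q"
      using card_permutations[OF cyc(2) H.finite_\<Omega>]
      by (simp only: Coset.order_def S.group_record_simps) (simp only: S_def)
    also have "fact q = q * fact (q - 1)" using q0 fact_reduce[of q, where 'a = nat] by simp
    finally have "q * q dvd q * fact (q - 1)" using qq by (rule dvd_trans[rotated])
    hence "q dvd fact (q - 1)" using q0 by simp
    thus False using prime_dvd_fact_iff[OF c(1)] q0 by simp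
  qed
  moreover have gc: "g \<circ> c \<circ> invp g \<in> stab \<Delta>"
    using conj_stab[OF g(1) stab[of 1]] g(2) by (simp add: \<Delta>_def)
  moreover have "(g \<circ> c \<circ> invp g) ^^ q = id"
  proof -
    have "(g \<circ> c \<circ> invp g) ^^ k = g \<circ> c ^^ k \<circ> invp g" for k
    proof (induction k)
      case 0
      show ?case using inv_comp(2)[OF g(1)] by (simp add: id_def)
    next
      case (Suc k)
      show ?case by (simp only: funpow.simps Suc) (simp add: fun_eq_iff inv_apply[OF g(1)])
    qed
    thus ?thesis using c(3) inv_comp[OF g(1)] by simp
  qed
  ultimately obtain h where h: "h \<in> stab \<Delta>"
    "h \<circ> (g \<circ> c \<circ> invp g) \<circ> inv\<^bsub>H.group_record\<^esub> h \<in> P"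
    using \<H>.conjugate_in_subgroup_of_prime_order[of q P "g \<circ> c \<circ> invp g"]
    unfolding H.group_record_simps H.group_record_pow using H.finite_G c(1) \<open>card P = q\<close> by blast
  hence "h \<circ> (g \<circ> c \<circ> invp g) \<circ> invp h \<in> P" by (simp only: H.group_record_inv)
  then obtain i where i: "h \<circ> (g \<circ> c \<circ> invp g) \<circ> invp h = c ^^ i" by (auto simp: P_def)
  have hG: "h \<in> G" using h(1) by (rule stabD)
  \<comment> \<open>\<open>h\<close> brings the conjugate of \<open>c\<close> by \<open>g\<close>
    back to a power of \<open>c\<close>. It moves only points of \<open>\<Delta>\<close>, so
    \<open>h \<circ> g\<close> still acts like \<open>g\<close> on the fixed points of
    \<open>c\<close>.\<close>
  show thesis
  proof
    show "h \<circ> g \<in> G" using hG g(1) by (rule comp_mem)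
    show "(h \<circ> g) \<circ> c = c ^^ i \<circ> (h \<circ> g)"
      by (simp only: i[symmetric] fun_eq_iff comp_apply inv_apply[OF g(1)] inv_apply[OF hG] simp_thms)
    show "(h \<circ> g) x = g x" if "c x = x" for x
    proof -
      have "g x \<notin> \<Delta>"
      proof
        assume "g x \<in> \<Delta>"
        hence "g x \<in> g ` \<Delta>" using g(2) by (simp only: \<Delta>_def)
        then obtain y where "y \<in> \<Delta>" "g x = g y" by (rule imageE)
        thus False using that apply_eq_iff[OF g(1)] by (simp add: \<Delta>_def)
      qed
      thus ?thesis unfolding comp_apply by (rule stabD(2)[OF h(1)])
    qed
  qed
qed

section \<open>Three-cycles and even permutations\<close>

lemma comp_transpose: "g \<in> G \<Longrightarrow> g \<circ> transposition x y = transposition (g x) (g y) \<circ> g"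
  using apply_eq_iff[of g] unfolding fun_eq_iff Transposition.transpose_def by simp

text \<open>
  A commutator of elements normalizing \<open>\<langle>c\<rangle>\<close> centralizes \<open>\<langle>c\<rangle>\<close>, hence acts as a power of \<open>c\<close> on the
  support of \<open>c\<close>, and its \<open>q\<close>-th power only moves fixed points of \<open>c\<close>. On
  the fixed points, two transpositions sharing a point have a 3-cycle as commutator.
\<close>

lemma exists_three_cycle:
  assumes c: "Factorial_Ring.prime q" "c \<in> G" "c ^^ q = id" "c \<noteq> id" "card \<Omega> < 2 * q"
    and q: "q + 2 < card \<Omega>" and mt: "mult_transitive G \<Omega> (card \<Omega> - q)"
  obtains x y z where "distinct [x, y, z]" "{x, y, z} \<subseteq> \<Omega>" "transposition x y \<circ> transposition y z \<in> G"
proof -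
  obtain a where ca: "c a \<noteq> a" using c(4) by (auto simp: fun_eq_iff)
  define \<Delta> where "\<Delta> = {x. c x \<noteq> x}"
  note cyc = prime_order_cycle[OF c(1-3) ca c(5), folded \<Delta>_def]
  define F where "F = \<Omega> - \<Delta>"
  have finF: "finite F" using finite_\<Omega> by (simp add: F_def)
  have cardF: "card F = card \<Omega> - q"
    using cyc(1,2) finite_subset[OF cyc(1) finite_\<Omega>] by (simp add: F_def card_Diff_subset)
  obtain fs where fs: "set fs = F" "distinct fs" using finite_distinct_list[OF finF] by blast
  have "length fs = card F" using fs distinct_card by metis
  hence len: "length fs = card \<Omega> - q" "3 \<le> length fs" using cardF q by auto
  then obtain x y z r where fs_eq: "fs = x # y # z # r"
    by (cases fs; cases "tl fs"; cases "tl (tl fs)") auto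
  \<comment> \<open>The degree of transitivity equals the number of fixed points of
    \<open>c\<close>, so every ordering of these is realized in \<open>G\<close>, and the Frattini
    correction does not disturb it.\<close>
  have norm: "\<exists>u\<in>G. \<exists>i. u \<circ> c = c ^^ i \<circ> u \<and> map u fs = fs'"
    if fs': "set fs' = F" "distinct fs'" "length fs' = length fs" for fs'
  proof -
    obtain g where g: "g \<in> G" "map g fs = fs'"
      using mult_transitiveD[OF mt fs(2) fs'(2)] fs(1) fs' len by (metis Diff_subset F_def)
    have "g ` F = F" using g(2) fs(1) fs'(1) by (metis list.set_map)
    moreover have "g ` \<Omega> = \<Omega>" using permutes[OF g(1)] by (rule permutes_image)
    moreover have "\<Delta> = \<Omega> - F" using cyc(1) by (auto simp: F_def)
    ultimately have "g ` \<Delta> = \<Delta>" by (simp add: image_set_diff[OF inj_mem[OF g(1)]])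
    then obtain u i where u: "u \<in> G" "u \<circ> c = c ^^ i \<circ> u" "\<And>x. c x = x \<Longrightarrow> u x = g x"
      using exists_normalizing[OF c(1-3) ca c(5) g(1)] unfolding \<Delta>_def by metis
    have "map u fs = map g fs"
      using u(3) fs(1) by (auto simp: F_def \<Delta>_def)
    thus ?thesis using u g by auto
  qed
  obtain n1 i where n1: "n1 \<in> G" "n1 \<circ> c = c ^^ i \<circ> n1" "map n1 fs = y # x # z # r"
    using norm[of "y # x # z # r"] fs fs_eq by auto
  obtain n2 j where n2: "n2 \<in> G" "n2 \<circ> c = c ^^ j \<circ> n2" "map n2 fs = x # z # y # r"
    using norm[of "x # z # y # r"] fs fs_eq by auto
  have norm_pow: "n \<circ> c ^^ k = c ^^ (l * k) \<circ> n" if "n \<circ> c = c ^^ l \<circ> n" for n k l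
  proof (induction k)
    case (Suc k)
    have "n \<circ> c ^^ Suc k = (n \<circ> c) \<circ> c ^^ k" by (simp only: funpow.simps o_assoc)
    also have "\<dots> = c ^^ l \<circ> (n \<circ> c ^^ k)" by (simp only: that o_assoc)
    also have "\<dots> = c ^^ (l * Suc k) \<circ> n" by (simp only: Suc o_assoc funpow_add mult_Suc_right)
    finally show ?case .
  qed simp
  \<comment> \<open>The exponents \<open>i\<close> and \<open>j\<close> multiply commutatively, so
    both products conjugate \<open>c\<close> to the same power \<open>d\<close>. Their quotient
    \<open>k\<close>, the commutator of \<open>n1\<close> and \<open>n2\<close>, therefore commutes
    with \<open>d\<close>.\<close>
  define A B d where "A = n1 \<circ> n2" and "B = n2 \<circ> n1" and "d = c ^^ (i * j)"
  have AB: "A \<in> G" "B \<in> G" using n1(1) n2(1) comp_mem by (simp_all add: A_def B_def)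
  have dG: "d \<in> G" unfolding d_def using c(2) by (rule funpow_mem)
  have Ac: "A \<circ> c = d \<circ> A"
  proof -
    have "A \<circ> c = n1 \<circ> c ^^ j \<circ> n2" by (simp only: A_def o_assoc[symmetric] n2(2))
    also have "\<dots> = d \<circ> A" by (simp only: norm_pow[OF n1(2)] d_def A_def o_assoc)
    finally show ?thesis .
  qed
  have Bc: "B \<circ> c = d \<circ> B"
  proof -
    have "B \<circ> c = n2 \<circ> c ^^ i \<circ> n1" by (simp only: B_def o_assoc[symmetric] n1(2))
    also have "\<dots> = d \<circ> B" by (simp only: norm_pow[OF n2(2)] d_def B_def o_assoc mult.commute)
    finally show ?thesis .
  qed
  define k where "k = A \<circ> invp B"
  have kG: "k \<in> G" unfolding k_def using AB by (intro comp_mem inv_mem)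
  have kB: "k (B w) = A w" for w by (simp add: k_def inv_apply[OF AB(2)])
  have kd: "k (d w) = d (k w)" for w
  proof -
    have "k (d (B v)) = d (k (B v))" for v
      using fun_cong[OF Bc, of v] fun_cong[OF Ac, of v] by (simp add: kB flip: kB[of "c v"])
    from this[of "invp B w"] show ?thesis by (simp add: inv_apply[OF AB(2)])
  qed
  have dpow: "d ^^ m = c ^^ (i * j * m)" for m by (simp add: d_def funpow_mult mult.commute)
  have c_pow_q: "c ^^ (q * m) = id" for m
  proof -
    have "c ^^ (q * m) = (c ^^ q) ^^ m" by (simp add: funpow_mult mult.commute)
    thus ?thesis by (simp add: c(3) id_funpow)
  qed
  have "d ^^ q = id" using c_pow_q[of "i * j"] by (simp add: dpow mult.commute)
  \<comment> \<open>\<open>d\<close> is conjugate to \<open>c\<close> by \<open>A\<close>, hence not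
    the identity; so \<open>q\<close> does not divide \<open>i * j\<close>, and \<open>d\<close>
    moves every point that \<open>c\<close> moves.\<close>
  have moves: "d w \<noteq> w" if "w \<in> \<Delta>" for w
  proof
    assume "d w = w"
    hence "q dvd i * j"
      using funpow_prime_order_fixed[OF c(1), where c = c and i = "i * j" and x = w] c(3) that
      by (auto simp: d_def \<Delta>_def)
    hence "d = id" using c_pow_q by (auto simp: d_def)
    hence "A (c a) = A a" using fun_cong[OF Ac, of a] by simp
    thus False using ca apply_eq_iff[OF AB(1)] by simp
  qed
  have fixed: "d w = w" if "w \<notin> \<Delta>" for w
  proof -
    have "c w = w" using that by (simp add: \<Delta>_def)
    hence "(c ^^ l) w = w" for l by (induction l) auto
    thus ?thesis by (simp add: d_def)
  qed
  have \<Delta>_d: "{w. d w \<noteq> w} = \<Delta>" using moves fixed by blast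
  have k_\<Delta>: "(k ^^ (q * q)) w = w" if w: "w \<in> \<Delta>" for w
  proof -
    have "d (k w) \<noteq> k w" using moves[OF w] apply_eq_iff[OF kG] by (simp flip: kd)
    hence "k w \<in> \<Delta>" using fixed by blast
    then obtain l where l: "(d ^^ l) w = k w"
      using prime_order_cycle(3)[OF c(1) dG \<open>d ^^ q = id\<close> moves[OF w] c(5)] w unfolding \<Delta>_d by blast
    have k_pow: "k ((d ^^ m) v) = (d ^^ m) (k v)" for m v
      by (induction m) (simp_all add: kd)
    have "(k ^^ m) w = (d ^^ (l * m)) w" for m
    proof (induction m)
      case (Suc m)
      have "(k ^^ Suc m) w = k ((k ^^ m) w)" by simp
      also have "\<dots> = (d ^^ (l * m)) ((d ^^ l) w)" by (simp only: Suc k_pow l)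
      also have "\<dots> = (d ^^ (l * m + l)) w" by (simp only: funpow_add comp_apply)
      finally show ?case by (simp add: add.commute)
    qed simp
    hence "(k ^^ (q * q)) w = (c ^^ (q * (i * j * (l * q)))) w"
      by (simp add: dpow mult_ac)
    thus ?thesis by (simp add: c_pow_q)
  qed
  have dist: "x \<noteq> y" "x \<noteq> z" "y \<noteq> z" "distinct r" "x \<notin> set r" "y \<notin> set r" "z \<notin> set r"
    using fs(2) fs_eq by auto
  have n1v: "n1 x = y" "n1 y = x" "n1 z = z" "\<And>w. w \<in> set r \<Longrightarrow> n1 w = w"
    and n2v: "n2 x = x" "n2 y = z" "n2 z = y" "\<And>w. w \<in> set r \<Longrightarrow> n2 w = w"
  proof -
    have "map n1 r = map (\<lambda>w. w) r" "map n2 r = map (\<lambda>w. w) r"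
      using n1(3) n2(3) fs_eq by simp_all
    thus "n1 w = w" "n2 w = w" if "w \<in> set r" for w
      using that by (simp_all only: map_eq_conv)
  qed (use n1(3) n2(3) fs_eq in simp_all)
  have kv: "k z = y" "k x = z" "k y = x" "\<And>w. w \<in> set r \<Longrightarrow> k w = w"
    using kB[of x] kB[of y] kB[of z] kB[of w for w] n1v n2v
    by (simp_all add: A_def B_def) (metis n1v(4) n2v(4))
  \<comment> \<open>The exponent is \<open>q * q\<close> because \<open>q\<close> may be 1 or 2
    modulo 3, while its square is 1: thus \<open>k ^^ (q * q)\<close> acts on the fixed points of
    \<open>c\<close> as the 3-cycle \<open>k\<close> and not as its inverse. For
    \<open>q = 3\<close> the bounds leave no value for \<open>card \<Omega>\<close>.\<close>
  have "\<not> 3 dvd q"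
  proof
    assume "3 dvd q"
    hence "q = 3" using c(1) primes_dvd_imp_eq[of 3 q] by simp
    thus False using c(5) q by simp
  qed
  hence "q mod 3 = 1 \<or> q mod 3 = 2" by presburger
  hence "q * q mod 3 = 1" using mod_mult_eq[of q 3 q] by auto
  then obtain s where s: "q * q = Suc (3 * s)" by (metis Suc_eq_plus1 mult_div_mod_eq)
  have k3: "(k ^^ (3 * m)) w = w" if "w \<in> F" for m w
  proof -
    have "(k ^^ 3) w = w" using that fs(1) fs_eq kv by (auto simp: numeral_3_eq_3)
    hence "((k ^^ 3) ^^ m) w = w" by (induction m) auto
    thus ?thesis by (simp add: funpow_mult mult.commute)
  qed
  have "k ^^ (q * q) = transposition z y \<circ> transposition y x"
  proof
    fix w
    have set_F: "x \<in> F" "y \<in> F" "z \<in> F" using fs(1) fs_eq by auto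
    show "(k ^^ (q * q)) w = (transposition z y \<circ> transposition y x) w"
    proof (cases "w \<in> F")
      case True
      hence "(k ^^ (q * q)) w = k w" using k3[of w s] by (simp add: s)
      thus ?thesis using True fs(1) fs_eq kv dist by (auto simp: Transposition.transpose_def)
    next
      case False
      hence "w \<in> \<Delta> \<or> w \<notin> \<Omega>" by (auto simp: F_def)
      hence "(k ^^ (q * q)) w = w"
        using k_\<Delta> permutes_not_in[OF permutes[OF funpow_mem[OF kG]]] by blast
      thus ?thesis using False set_F by (auto simp: Transposition.transpose_def)
    qed
  qed
  hence "transposition z y \<circ> transposition y x \<in> G" using funpow_mem[OF kG] by metis
  moreover have "{z, y, x} \<subseteq> \<Omega>" using fs(1) fs_eq by (auto simp: F_def)
  ultimately show thesis using that[of z y x] dist by auto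
qed

text \<open>A product of two transpositions becomes a product of 3-cycles after
  \<open>transposition y u\<close> is inserted twice. The induction adds one transposition at a time
  and so changes parity; hence its claim also covers odd permutations, which enter \<open>G\<close>
  after composition with any transposition of two points of \<open>\<Omega>\<close>.\<close>

lemma even_permutations_subset:
  assumes three: "\<And>x y z. distinct [x, y, z] \<Longrightarrow> {x, y, z} \<subseteq> \<Omega> \<Longrightarrow> transposition x y \<circ> transposition y z \<in> G"
    and "p permutes \<Omega>" "evenperm p"
  shows "p \<in> G"
proof -
  have two: "transposition x y \<circ> transposition u v \<in> G"
    if "x \<in> \<Omega>" "y \<in> \<Omega>" "u \<in> \<Omega>" "v \<in> \<Omega>" "x \<noteq> y" "u \<noteq> v" for x y u v
  proof -
    have share: "transposition x y \<circ> transposition y w \<in> G" if "x \<in> \<Omega>" "y \<in> \<Omega>" "w \<in> \<Omega>" "x \<noteq> y" "y \<noteq> w" for x y w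
    proof (cases "x = w")
      case True
      thus ?thesis using id_mem by (simp add: transpose_commute[of y w])
    next
      case False
      thus ?thesis using that three[of x y w] by simp
    qed
    show ?thesis
    proof (cases "y = u")
      case True
      thus ?thesis using share[of x y v] that by simp
    next
      case False
      have "transposition x y \<circ> transposition u v = (transposition x y \<circ> transposition y u) \<circ> (transposition y u \<circ> transposition u v)"
        by (simp add: fun_eq_iff)
      thus ?thesis using share[of x y u] share[of y u v] that False comp_mem by metis
    qed
  qed
  have "(evenperm p \<longrightarrow> p \<in> G) \<and>
    (\<not> evenperm p \<longrightarrow> (\<forall>x\<in>\<Omega>. \<forall>y\<in>\<Omega>. x \<noteq> y \<longrightarrow> transposition x y \<circ> p \<in> G))"
    using assms(2) finite_\<Omega>
  proof (induction rule: permutes_induct)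
    case id
    show ?case using id_mem by (simp add: id_def)
  next
    case (swap a b p)
    show ?case
    proof (cases "a = b")
      case True
      thus ?thesis using swap.IH by simp
    next
      case False
      have "permutation p" using swap.hyps finite_\<Omega> permutation_permutes by blast
      hence even: "evenperm (transposition a b \<circ> p) \<longleftrightarrow> \<not> evenperm p"
        using False by (simp add: evenperm_comp permutation_swap_id evenperm_swap)
      have "transposition x y \<circ> (transposition a b \<circ> p) \<in> G"
        if "evenperm p" "x \<in> \<Omega>" "y \<in> \<Omega>" "x \<noteq> y" for x y
        using comp_mem[OF two[of x y a b], of p] that swap False by (simp add: o_assoc)
      moreover have "transposition a b \<circ> p \<in> G" if "\<not> evenperm p"
        using that swap False by blast
      ultimately show ?thesis using even by blast
    qed
  qed
  thus ?thesis using assms(3) by simp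
qed

text \<open>The support of \<open>c\<close> yields transitivity of degree
  \<open>card \<Omega> - q + 1\<close>, which is at least 4. One degree less rearranges the fixed
  points of \<open>c\<close> freely and gives one 3-cycle; degree 3 conjugates this 3-cycle into all
  others.\<close>

theorem Jordan:
  assumes q: "Factorial_Ring.prime q" "card \<Omega> < 2 * q" "q + 2 < card \<Omega>" "q dvd card G"
    and trans: "\<And>x y. x \<in> \<Omega> \<Longrightarrow> y \<in> \<Omega> \<Longrightarrow> \<exists>g\<in>G. g x = y"
    and p: "p permutes \<Omega>" "evenperm p"
  shows "p \<in> G"
proof -
  obtain c where c: "c \<in> G" "c ^^ q = id" "c \<noteq> id" using Cauchy[OF q(1,4)] .
  then obtain a where ca: "c a \<noteq> a" by (auto simp: fun_eq_iff)
  define \<Delta> where "\<Delta> = {x. c x \<noteq> x}"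
  note cyc = prime_order_cycle[OF q(1) c(1,2) ca q(2), folded \<Delta>_def]
  note spread = spreading_prime_order_cycle[OF q(1) c(1,2) ca q(2), folded \<Delta>_def]
  have mt: "mult_transitive G \<Omega> k" if "k \<le> Suc (card \<Omega> - q)" for k
    using mult_transitive_G[OF cyc(1) spread(1) _ _ spread(2) trans, of k] that cyc(2) q(2)
      prime_ge_2_nat[OF q(1)] by simp
  obtain x y z where xyz: "distinct [x, y, z]" "{x, y, z} \<subseteq> \<Omega>" "transposition x y \<circ> transposition y z \<in> G"
    using exists_three_cycle[OF q(1) c q(2,3) mt] by auto
  show ?thesis
  proof (rule even_permutations_subset[OF _ p])
    fix u v w assume uvw: "distinct [u, v, w]" "{u, v, w} \<subseteq> \<Omega>"
    have "mult_transitive G \<Omega> 3" using mt[of 3] q(3) by simp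
    then obtain g where g: "g \<in> G" "map g [x, y, z] = [u, v, w]"
      using mult_transitiveD[of G \<Omega> 3 "[x, y, z]" "[u, v, w]"] xyz uvw by auto
    have "g \<circ> (transposition x y \<circ> transposition y z) \<circ> invp g = transposition u v \<circ> transposition v w"
    proof -
      have "g \<circ> (transposition x y \<circ> transposition y z) = (transposition u v \<circ> transposition v w) \<circ> g"
        using comp_transpose[OF g(1), of x y] comp_transpose[OF g(1), of y z] g(2)
        by (simp add: o_assoc) (simp add: o_assoc[symmetric])
      hence "g \<circ> (transposition x y \<circ> transposition y z) \<circ> invp g = (transposition u v \<circ> transposition v w) \<circ> (g \<circ> invp g)"
        by (simp add: o_assoc)
      thus ?thesis by (simp add: inv_comp[OF g(1)])
    qed
    thus "transposition u v \<circ> transposition v w \<in> G"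
      using comp_mem[OF comp_mem[OF g(1) xyz(3)] inv_mem[OF g(1)]] by simp
  qed
qed

end

section \<open>Extending a discrete valuation to the algebraic closure\<close>

definition subring_set :: "'b::comm_ring_1 set \<Rightarrow> bool" where
  "subring_set B \<longleftrightarrow> 1 \<in> B \<and> (\<forall>x\<in>B. \<forall>y\<in>B. x - y \<in> B \<and> x * y \<in> B)"

definition ring_adjoin :: "'b::comm_ring_1 set \<Rightarrow> 'b \<Rightarrow> 'b set" where
  "ring_adjoin B x = {poly p x | p. \<forall>i. Polynomial.coeff p i \<in> B}"

lemma subring_setD:
  assumes "subring_set B"
  shows "1 \<in> B" "0 \<in> B" "x \<in> B \<Longrightarrow> y \<in> B \<Longrightarrow> x - y \<in> B" "x \<in> B \<Longrightarrow> y \<in> B \<Longrightarrow> x * y \<in> B"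
    "x \<in> B \<Longrightarrow> - x \<in> B" "x \<in> B \<Longrightarrow> y \<in> B \<Longrightarrow> x + y \<in> B" "x \<in> B \<Longrightarrow> x ^ n \<in> B"
proof -
  show 1: "1 \<in> B" and diff: "\<And>x y. x \<in> B \<Longrightarrow> y \<in> B \<Longrightarrow> x - y \<in> B"
    and mult: "\<And>x y. x \<in> B \<Longrightarrow> y \<in> B \<Longrightarrow> x * y \<in> B"
    using assms by (auto simp: subring_set_def)
  show 0: "0 \<in> B" using diff[OF 1 1] by simp
  show minus: "- x \<in> B" if "x \<in> B" for x using diff[OF 0 that] by simp
  show "x + y \<in> B" if "x \<in> B" "y \<in> B" for x y using diff[OF that(1) minus[OF that(2)]] by simp
  show "x ^ n \<in> B" if "x \<in> B" using that 1 by (induction n) (auto intro: mult)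
qed

lemma subring_set_sum:
  assumes "subring_set B" "\<And>i. i \<in> I \<Longrightarrow> f i \<in> B"
  shows "sum f I \<in> B"
  using assms(2) by (induction I rule: infinite_finite_induct) (auto intro: subring_setD[OF assms(1)])

lemma subring_set_poly:
  assumes "subring_set B" "\<And>i. Polynomial.coeff p i \<in> B" "x \<in> B"
  shows "poly p x \<in> B"
  unfolding poly_altdef by (intro subring_set_sum subring_setD assms)

lemma coeff_mult_mem:
  assumes "subring_set B" "\<And>i. Polynomial.coeff p i \<in> B" "\<And>i. Polynomial.coeff q i \<in> B"
  shows "Polynomial.coeff (p * q) i \<in> B"
  unfolding Polynomial.coeff_mult by (intro subring_set_sum subring_setD assms)

lemma ring_adjoinI: "(\<And>i. Polynomial.coeff p i \<in> B) \<Longrightarrow> y = poly p x \<Longrightarrow> y \<in> ring_adjoin B x"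
  unfolding ring_adjoin_def by blast

lemma ring_adjoin_subset: "subring_set B \<Longrightarrow> B \<subseteq> ring_adjoin B x"
proof
  fix b assume B: "subring_set B" "b \<in> B"
  show "b \<in> ring_adjoin B x"
  proof (rule ring_adjoinI)
    show "Polynomial.coeff [:b:] i \<in> B" for i
      using subring_setD(2)[OF B(1)] B(2) by (cases i) simp_all
  qed simp
qed

lemma ring_adjoin_mem: "subring_set B \<Longrightarrow> x \<in> ring_adjoin B x"
proof -
  assume B: "subring_set B"
  show "x \<in> ring_adjoin B x"
  proof (rule ring_adjoinI)
    show "Polynomial.coeff [:0, 1:] i \<in> B" for i
      using subring_setD(1,2)[OF B] by (simp add: coeff_pCons split: nat.split)
  qed simp
qed

lemma ring_adjoin_least:
  assumes "subring_set S" "B \<subseteq> S" "x \<in> S"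
  shows "ring_adjoin B x \<subseteq> S"
proof
  fix y assume "y \<in> ring_adjoin B x"
  then obtain p where p: "y = poly p x" "\<And>i. Polynomial.coeff p i \<in> B" by (auto simp: ring_adjoin_def)
  show "y \<in> S" unfolding p(1) using p(2) assms(2) by (intro subring_set_poly[OF assms(1) _ assms(3)]) blast
qed

lemma subring_set_ring_adjoin:
  assumes "subring_set B"
  shows "subring_set (ring_adjoin B x)"
  unfolding subring_set_def
proof (intro conjI ballI)
  show "1 \<in> ring_adjoin B x" using ring_adjoin_subset[OF assms] subring_setD(1)[OF assms] by blast
  fix y z assume "y \<in> ring_adjoin B x" "z \<in> ring_adjoin B x"
  then obtain p q where p: "y = poly p x" "\<And>i. Polynomial.coeff p i \<in> B"
    and q: "z = poly q x" "\<And>i. Polynomial.coeff q i \<in> B" by (auto simp: ring_adjoin_def)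
  show "y - z \<in> ring_adjoin B x"
    by (rule ring_adjoinI[of "p - q"]) (use p q subring_setD(3)[OF assms] in simp_all)
  show "y * z \<in> ring_adjoin B x"
    by (rule ring_adjoinI[of "p * q"]) (use p(1) q(1) coeff_mult_mem[OF assms p(2) q(2)] in simp_all)
qed

text \<open>Clearing denominators brings an element of the ring generated by
  \<open>inverse u\<close> back into \<open>B\<close>.\<close>

lemma poly_inverse_mult_power_mem:
  fixes u :: "'b::field"
  assumes "subring_set B" "\<And>i. Polynomial.coeff p i \<in> B" "u \<in> B" "u \<noteq> 0"
  shows "poly p (inverse u) * u ^ Polynomial.degree p \<in> B"
proof -
  have "poly p (inverse u) * u ^ Polynomial.degree p =
      (\<Sum>i\<le>Polynomial.degree p. Polynomial.coeff p i * u ^ (Polynomial.degree p - i))"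
    unfolding poly_altdef sum_distrib_right
  proof (rule sum.cong[OF refl])
    fix i assume "i \<in> {..Polynomial.degree p}"
    hence "u ^ Polynomial.degree p = u ^ (Polynomial.degree p - i) * u ^ i"
      by (simp flip: power_add)
    thus "Polynomial.coeff p i * inverse u ^ i * u ^ Polynomial.degree p =
      Polynomial.coeff p i * u ^ (Polynomial.degree p - i)"
      using assms(4) by (simp add: power_inverse)
  qed
  also have "\<dots> \<in> B"
    by (intro subring_set_sum[OF assms(1)] subring_setD[OF assms(1)] assms)
  finally show ?thesis .
qed

text \<open>
  Chevalley: a subring that is maximal among those not containing \<open>inverse \<pi>\<close> is a valuation ring.
\<close>

lemma valuation_ring_if_maximal_aux:
  fixes B :: "'b::field set"
  assumes B: "subring_set B" "\<pi> \<in> B" "inverse \<pi> \<notin> B"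
    and local: "\<And>b. b \<in> B \<Longrightarrow> inverse (1 + \<pi> * b) \<in> B"
    and p: "\<And>i. Polynomial.coeff p i \<in> B" "\<pi> * poly p x = 1"
    and p_min: "\<And>r. (\<And>i. Polynomial.coeff r i \<in> B) \<Longrightarrow> \<pi> * poly r x = 1 \<Longrightarrow> Polynomial.degree p \<le> Polynomial.degree r"
    and q: "\<And>i. Polynomial.coeff q i \<in> B" "\<pi> * poly q (inverse x) = 1"
    and le: "Polynomial.degree q \<le> Polynomial.degree p"
    and x: "x \<noteq> 0"
  shows False
proof -
  note BD = subring_setD[OF B(1)]
  have \<pi>: "\<pi> \<noteq> 0" using p(2) by auto
  define n m where "n = Polynomial.degree p" and "m = Polynomial.degree q"
  have mn: "m \<le> n" using le by (simp add: n_def m_def)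
  define u where "u = inverse (1 + \<pi> * - Polynomial.coeff q 0)"
  have u: "u \<in> B" unfolding u_def by (intro local BD q)
  have unz: "1 - \<pi> * Polynomial.coeff q 0 \<noteq> 0"
  proof
    assume "1 - \<pi> * Polynomial.coeff q 0 = 0"
    hence "Polynomial.coeff q 0 = inverse \<pi>" using \<pi> by (simp add: field_simps)
    thus False using q(1)[of 0] B(3) by simp
  qed
  have n0: "n \<noteq> 0"
  proof
    assume "n = 0"
    then obtain c where c: "p = [:c:]" unfolding n_def by (metis degree_eq_zeroE)
    hence "c = inverse \<pi>" using p(2) \<pi> by (simp add: field_simps)
    thus False using p(1)[of 0] B(3) c by simp
  qed
  \<comment> \<open>Multiplied by \<open>x ^ n\<close>, the relation for \<open>inverse x\<close>
    reads \<open>x ^ n * (1 - \<pi> * coeff q 0) = \<pi> * poly R x\<close>, and \<open>u\<close>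
    inverts the factor on the left. \<open>R\<close> stays below degree \<open>n\<close> because its
    sum starts at \<open>i = 1\<close>.\<close>
  define R where "R = (\<Sum>i\<in>{1..m}. Polynomial.monom (Polynomial.coeff q i) (n - i))"
  have R: "poly R x = x ^ n * (\<Sum>i\<in>{1..m}. Polynomial.coeff q i * inverse x ^ i)"
    unfolding R_def poly_sum sum_distrib_left
  proof (rule sum.cong[OF refl])
    fix i assume "i \<in> {1..m}"
    hence "x ^ n = x ^ (n - i) * x ^ i" using mn by (simp flip: power_add)
    thus "poly (Polynomial.monom (Polynomial.coeff q i) (n - i)) x = x ^ n * (Polynomial.coeff q i * inverse x ^ i)"
      using x by (simp add: poly_monom power_inverse)
  qed
  have "poly q (inverse x) = Polynomial.coeff q 0 + (\<Sum>i\<in>{1..m}. Polynomial.coeff q i * inverse x ^ i)"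
    unfolding poly_altdef m_def[symmetric] atMost_atLeast0
    by (subst sum.atLeast_Suc_atMost) simp_all
  hence "1 = \<pi> * Polynomial.coeff q 0 + \<pi> * (\<Sum>i\<in>{1..m}. Polynomial.coeff q i * inverse x ^ i)"
    using q(2) by (simp add: distrib_left)
  hence eq: "1 - \<pi> * Polynomial.coeff q 0 = \<pi> * (\<Sum>i\<in>{1..m}. Polynomial.coeff q i * inverse x ^ i)"
    by (simp add: algebra_simps)
  have "x ^ n = \<pi> * u * poly R x"
  proof -
    have "\<pi> * u * poly R x = x ^ n * u * (\<pi> * (\<Sum>i\<in>{1..m}. Polynomial.coeff q i * inverse x ^ i))"
      by (simp add: R)
    also have "\<dots> = x ^ n * (u * (1 - \<pi> * Polynomial.coeff q 0))" by (simp only: eq mult.assoc)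
    also have "u * (1 - \<pi> * Polynomial.coeff q 0) = 1" using unz by (simp add: u_def)
    finally show ?thesis by simp
  qed
  define l where "l = Polynomial.coeff p n"
  \<comment> \<open>The leading monomial of \<open>p\<close> is traded for lower powers of
    \<open>x\<close>, against the minimality of its degree.\<close>
  define p' where "p' = (p - Polynomial.monom l n) + Polynomial.smult (l * \<pi> * u) R"
  have "poly p' x = poly p x"
    using \<open>x ^ n = \<pi> * u * poly R x\<close> by (simp add: p'_def poly_monom mult.assoc)
  hence "\<pi> * poly p' x = 1" using p(2) by simp
  moreover have "Polynomial.coeff p' i \<in> B" for i
  proof -
    have "Polynomial.coeff R i \<in> B"
      unfolding R_def Polynomial.coeff_sum by (intro subring_set_sum[OF B(1)]) (auto intro: q BD)
    thus ?thesis
      unfolding p'_def l_def using p(1) u B(2) by (auto intro!: BD(3-6) simp: BD(2))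
  qed
  ultimately have "n \<le> Polynomial.degree p'" unfolding n_def by (rule p_min[rotated])
  moreover have "Polynomial.coeff p' i = 0" if "i \<ge> n" for i
  proof -
    have "Polynomial.coeff R i = 0"
      unfolding R_def Polynomial.coeff_sum using that n0 by (intro sum.neutral) auto
    moreover have "Polynomial.coeff p i = 0" if "i \<noteq> n"
      using that \<open>i \<ge> n\<close> unfolding n_def by (intro coeff_eq_0) auto
    ultimately show ?thesis by (simp add: p'_def l_def)
  qed
  hence "Polynomial.degree p' < n \<or> p' = 0"
    using leading_coeff_0_iff[of p'] not_le by blast
  ultimately show False using \<open>\<pi> * poly p' x = 1\<close> by auto
qed

lemma exists_min_degree_poly:
  assumes "\<And>i. Polynomial.coeff p i \<in> B" "P p"
  obtains r where "\<And>i. Polynomial.coeff r i \<in> B" "P r"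
    "\<And>s. (\<And>i. Polynomial.coeff s i \<in> B) \<Longrightarrow> P s \<Longrightarrow> Polynomial.degree r \<le> Polynomial.degree s"
proof -
  define Q where "Q = (\<lambda>s. (\<forall>i. Polynomial.coeff s i \<in> B) \<and> P s)"
  have "Q p" using assms by (simp add: Q_def)
  then obtain r where "Q r" "\<forall>s. Q s \<longrightarrow> Polynomial.degree r \<le> Polynomial.degree s"
    using ex_has_least_nat[of Q p Polynomial.degree] by blast
  thus thesis using that unfolding Q_def by blast
qed

lemma exists_valuation_ring:
  fixes A :: "'b::field set"
  assumes A: "subring_set A" "\<pi> \<in> A" "inverse \<pi> \<notin> A"
  obtains B where "subring_set B" "A \<subseteq> B" "inverse \<pi> \<notin> B" "\<And>x. x \<notin> B \<Longrightarrow> inverse x \<in> B"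
proof -
  define \<S> where "\<S> = {B. subring_set B \<and> A \<subseteq> B \<and> inverse \<pi> \<notin> B}"
  have "\<exists>M\<in>\<S>. \<forall>V\<in>\<S>. M \<subseteq> V \<longrightarrow> V = M"
  proof (rule subset_Zorn_nonempty)
    show "\<S> \<noteq> {}" using A by (auto simp: \<S>_def)
    fix \<C> assume C: "\<C> \<noteq> {}" "subset.chain \<S> \<C>"
    have sub: "\<C> \<subseteq> \<S>" and tot: "\<And>V W. V \<in> \<C> \<Longrightarrow> W \<in> \<C> \<Longrightarrow> V \<subseteq> W \<or> W \<subseteq> V"
      using C(2) by (auto simp: subset_chain_def)
    have "subring_set (\<Union>\<C>)"
      unfolding subring_set_def
    proof (intro conjI ballI)
      show "1 \<in> \<Union>\<C>" using C(1) sub by (force simp: \<S>_def subring_set_def)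
      fix y z assume "y \<in> \<Union>\<C>" "z \<in> \<Union>\<C>"
      then obtain V where V: "V \<in> \<C>" "y \<in> V" "z \<in> V" using tot by blast
      hence "subring_set V" using sub by (auto simp: \<S>_def)
      thus "y - z \<in> \<Union>\<C>" "y * z \<in> \<Union>\<C>" using V by (auto simp: subring_set_def)
    qed
    thus "\<Union>\<C> \<in> \<S>" using C(1) sub by (auto simp: \<S>_def)
  qed
  then obtain B where B: "B \<in> \<S>" and max: "\<And>V. V \<in> \<S> \<Longrightarrow> B \<subseteq> V \<Longrightarrow> V = B" by blast
  have sr: "subring_set B" and AB: "A \<subseteq> B" and \<pi>B: "inverse \<pi> \<notin> B" using B by (auto simp: \<S>_def)
  note BD = subring_setD[OF sr]
  have \<pi>: "\<pi> \<in> B" "\<pi> \<noteq> 0"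
    using A(2) AB \<pi>B BD(2) by auto
  have adjoin: "inverse \<pi> \<in> ring_adjoin B x" if "x \<notin> B" for x
  proof (rule ccontr)
    assume "inverse \<pi> \<notin> ring_adjoin B x"
    hence "ring_adjoin B x \<in> \<S>"
      using subring_set_ring_adjoin[OF sr] ring_adjoin_subset[OF sr, of x] AB by (auto simp: \<S>_def)
    hence "ring_adjoin B x = B" using max ring_adjoin_subset[OF sr] by blast
    thus False using ring_adjoin_mem[OF sr, of x] that by simp
  qed
  \<comment> \<open>Otherwise \<open>inverse \<pi>\<close> is a polynomial in the inverse of
    \<open>u = 1 + \<pi> * b\<close>. Clearing denominators puts the product of
    \<open>inverse \<pi>\<close> and a power of \<open>u\<close> into \<open>B\<close>. That power
    is 1 plus a multiple of \<open>\<pi>\<close>, so \<open>inverse \<pi>\<close> itself would lie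
    in \<open>B\<close>.\<close>
  have local: "inverse (1 + \<pi> * b) \<in> B" if b: "b \<in> B" for b
  proof (rule ccontr)
    define u where "u = 1 + \<pi> * b"
    have u: "u \<in> B" unfolding u_def by (intro BD \<pi> b)
    assume "inverse (1 + \<pi> * b) \<notin> B"
    hence "inverse \<pi> \<in> ring_adjoin B (inverse u)" unfolding u_def by (rule adjoin)
    then obtain p where p: "inverse \<pi> = poly p (inverse u)" "\<And>i. Polynomial.coeff p i \<in> B"
      by (auto simp: ring_adjoin_def)
    have "u \<noteq> 0"
    proof
      assume "u = 0"
      hence "\<pi> * - b = 1" by (simp add: u_def add_eq_0_iff)
      hence "inverse \<pi> = - b" by (rule inverse_unique)
      thus False using \<pi>B BD(5)[OF b] by simp
    qed
    have "inverse \<pi> * u ^ Polynomial.degree p \<in> B"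
      using poly_inverse_mult_power_mem[OF sr p(2) u \<open>u \<noteq> 0\<close>] by (simp add: p(1))
    moreover have "\<exists>c\<in>B. u ^ k = 1 + \<pi> * c" for k
    proof (induction k)
      case 0
      show ?case using BD(2) by (intro bexI[of _ 0]) simp_all
    next
      case (Suc k)
      then obtain c where c: "c \<in> B" "u ^ k = 1 + \<pi> * c" by blast
      have "u ^ Suc k = 1 + \<pi> * (b + c + \<pi> * (b * c))"
        by (simp add: c(2)) (simp add: u_def algebra_simps)
      moreover have "b + c + \<pi> * (b * c) \<in> B" by (intro BD b c \<pi>)
      ultimately show ?case by blast
    qed
    then obtain c where c: "c \<in> B" "u ^ Polynomial.degree p = 1 + \<pi> * c" by blast
    moreover have "inverse \<pi> * (1 + \<pi> * c) = inverse \<pi> + c" using \<pi>(2) by (simp add: field_simps)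
    ultimately have "inverse \<pi> + c \<in> B" by simp
    hence "inverse \<pi> \<in> B" using BD(3)[OF _ c(1)] by fastforce
    thus False using \<pi>B by contradiction
  qed
  have "inverse x \<in> B" if x: "x \<notin> B" for x
  proof (rule ccontr)
    assume ix: "inverse x \<notin> B"
    have x0: "x \<noteq> 0" using x BD(2) by auto
    have ex: "\<exists>p. (\<forall>i. Polynomial.coeff p i \<in> B) \<and> \<pi> * poly p y = 1" if "y \<notin> B" for y
    proof -
      obtain p where "inverse \<pi> = poly p y" "\<forall>i. Polynomial.coeff p i \<in> B"
        using adjoin[OF \<open>y \<notin> B\<close>] by (auto simp: ring_adjoin_def)
      thus ?thesis using \<pi>(2) by (intro exI[of _ p]) (metis right_inverse)
    qed
    obtain p0 where p0: "\<And>i. Polynomial.coeff p0 i \<in> B" "\<pi> * poly p0 x = 1" using ex[OF x] by blast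
    obtain p where p: "\<And>i. Polynomial.coeff p i \<in> B" "\<pi> * poly p x = 1"
      "\<And>s. (\<And>i. Polynomial.coeff s i \<in> B) \<Longrightarrow> \<pi> * poly s x = 1 \<Longrightarrow> Polynomial.degree p \<le> Polynomial.degree s"
      using exists_min_degree_poly[of p0 B "\<lambda>p. \<pi> * poly p x = 1"] p0 by blast
    obtain q0 where q0: "\<And>i. Polynomial.coeff q0 i \<in> B" "\<pi> * poly q0 (inverse x) = 1" using ex[OF ix] by blast
    obtain q where q: "\<And>i. Polynomial.coeff q i \<in> B" "\<pi> * poly q (inverse x) = 1"
      "\<And>s. (\<And>i. Polynomial.coeff s i \<in> B) \<Longrightarrow> \<pi> * poly s (inverse x) = 1 \<Longrightarrow> Polynomial.degree q \<le> Polynomial.degree s"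
      using exists_min_degree_poly[of q0 B "\<lambda>p. \<pi> * poly p (inverse x) = 1"] q0 by blast
    \<comment> \<open>The situation is symmetric in \<open>x\<close> and \<open>inverse x\<close>;
      whichever minimal polynomial has the larger degree is the one that can be shortened.\<close>
    show False
    proof (cases "Polynomial.degree q \<le> Polynomial.degree p")
      case True
      show False
        by (rule valuation_ring_if_maximal_aux[OF sr \<pi>(1) \<pi>B local p(1,2) p(3) q(1,2) True x0])
    next
      case False
      hence le: "Polynomial.degree p \<le> Polynomial.degree q" by simp
      have p2: "\<pi> * poly p (inverse (inverse x)) = 1" using p(2) by simp
      show False
        by (rule valuation_ring_if_maximal_aux[OF sr \<pi>(1) \<pi>B local q(1,2) q(3) p(1) p2 le]) (use x0 in simp_all)
    qed
  qed
  thus thesis using that[OF sr AB \<pi>B] by blast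
qed

section \<open>The real norm attached to a valuation ring\<close>

definition nonarchimedean :: "('b::field \<Rightarrow> real) \<Rightarrow> bool" where
  "nonarchimedean N \<longleftrightarrow> (\<forall>x. 0 \<le> N x) \<and> (\<forall>x. N x = 0 \<longleftrightarrow> x = 0) \<and>
     (\<forall>x y. N (x * y) = N x * N y) \<and> (\<forall>x y. N (x + y) \<le> max (N x) (N y))"

locale valuation_ring =
  fixes B :: "'b::field set" and \<pi> :: 'b
  assumes subring: "subring_set B" and total: "x \<notin> B \<Longrightarrow> inverse x \<in> B"
    and \<pi>_mem: "\<pi> \<in> B" and inverse_\<pi>: "inverse \<pi> \<notin> B"
begin

lemmas BD = subring_setD[OF subring]

definition unit :: "'b \<Rightarrow> bool" where
  "unit y \<longleftrightarrow> y \<noteq> 0 \<and> y \<in> B \<and> inverse y \<in> B"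

lemma \<pi>_nonzero: "\<pi> \<noteq> 0"
  using inverse_\<pi> BD(2) by auto

lemma unit_mult: "unit x \<Longrightarrow> unit y \<Longrightarrow> unit (x * y)"
  by (simp add: unit_def BD(4))

lemma unit_inverse: "unit x \<Longrightarrow> unit (inverse x)"
  by (simp add: unit_def)

lemma unit_power: "unit x \<Longrightarrow> unit (x ^ n)"
  by (simp add: unit_def BD(7) flip: power_inverse)

text \<open>The nonunits form the maximal ideal. If \<open>x / y\<close> lies in \<open>B\<close>
  and \<open>x + y\<close> is a unit, then \<open>inverse y = (1 + x / y) * inverse (x + y)\<close>
  makes \<open>y\<close> a unit; otherwise \<open>x\<close> and \<open>y\<close> change
  places.\<close>

lemma nonunit_add:
  assumes "x \<in> B" "y \<in> B" "\<not> unit x" "\<not> unit y"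
  shows "\<not> unit (x + y)"
proof
  assume u: "unit (x + y)"
  have *: False if "x \<in> B" "y \<in> B" "\<not> unit y" "unit (x + y)" "y \<noteq> 0" "x / y \<in> B" for x y
  proof -
    have "inverse y = (1 + x / y) * inverse (x + y)"
      using that(4,5) by (simp add: unit_def field_simps)
    also have "\<dots> \<in> B" using that(4,6) by (intro BD) (simp_all add: unit_def BD(1))
    finally show False using that(2,3,5) by (simp add: unit_def)
  qed
  show False
  proof (cases "x = 0 \<or> y = 0")
    case True
    thus False using u assms by auto
  next
    case False
    have "x / y \<in> B \<or> y / x \<in> B" using total[of "x / y"] by auto
    thus False using *[of x y] *[of y x] assms u False by (auto simp: add.commute)
  qed
qed

lemma nonunit_sum:
  assumes "finite I" "\<And>i. i \<in> I \<Longrightarrow> f i \<in> B" "\<And>i. i \<in> I \<Longrightarrow> \<not> unit (f i)"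
  shows "\<not> unit (sum f I)"
  using assms
proof (induction I rule: finite_induct)
  case empty
  show ?case by (simp add: unit_def)
next
  case (insert i I)
  have "sum f I \<in> B" using insert.prems(1) by (intro subring_set_sum[OF subring]) auto
  thus ?case using insert nonunit_add[of "f i" "sum f I"] by simp
qed

text \<open>Divisibility in a valuation ring is a total preorder, so a finite nonempty family has a
  term of least valuation.\<close>

lemma exists_dominant:
  assumes "finite T" "T \<noteq> {}" "\<And>i. i \<in> T \<Longrightarrow> t i \<noteq> 0"
  shows "\<exists>i\<in>T. \<forall>k\<in>T. t k / t i \<in> B"
  using assms
proof (induction T rule: finite_ne_induct)
  case (singleton i)
  thus ?case using BD(1) by simp
next
  case (insert j T)
  then obtain i where i: "i \<in> T" "\<And>k. k \<in> T \<Longrightarrow> t k / t i \<in> B" by auto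
  show ?case
  proof (cases "t j / t i \<in> B")
    case True
    thus ?thesis using i by blast
  next
    case False
    have "inverse (t j / t i) \<in> B" using False by (rule total)
    hence ij: "t i / t j \<in> B" by (simp add: field_simps)
    have "t k / t j \<in> B" if k: "k \<in> T" for k
    proof -
      have "t i \<noteq> 0" using i(1) insert.prems by simp
      hence eq: "t k / t j = (t k / t i) * (t i / t j)" by simp
      show ?thesis by (subst eq) (rule BD(4)[OF i(2)[OF k] ij])
    qed
    moreover have "t j / t j \<in> B" using insert.prems[of j] BD(1) by simp
    ultimately show ?thesis by blast
  qed
qed

text \<open>The valuation of \<open>x\<close> is the fraction \<open>m / n\<close>, normalized by
  valuation 1 for \<open>\<pi>\<close>. Powers of \<open>x\<close> are needed because algebraic
  elements have rational, not integral, valuations.\<close>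

definition has_order :: "'b \<Rightarrow> nat \<Rightarrow> int \<Rightarrow> bool" where
  "has_order x n m \<longleftrightarrow> 0 < n \<and> unit (x ^ n * \<pi> powi (- m))"

lemma unit_\<pi>_powi: "unit (\<pi> powi k) \<Longrightarrow> k = 0"
proof (rule ccontr)
  have pos: False if "unit (\<pi> ^ Suc n)" for n
  proof -
    have "inverse \<pi> = \<pi> ^ n * inverse (\<pi> ^ Suc n)" using \<pi>_nonzero by (simp add: field_simps)
    also have "\<dots> \<in> B" using that by (intro BD) (simp_all add: unit_def \<pi>_mem)
    finally show False using inverse_\<pi> by contradiction
  qed
  assume k: "unit (\<pi> powi k)" "k \<noteq> 0"
  show False
  proof (cases "k > 0")
    case True
    then obtain n where "k = int (Suc n)" by (metis zero_less_imp_eq_int gr0_conv_Suc of_nat_0_less_iff)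
    hence "unit (\<pi> ^ Suc n)" using k(1) by (simp only: power_int_of_nat)
    thus False by (rule pos)
  next
    case False
    then obtain n where n: "- k = int (Suc n)" using k(2) by (metis zero_less_imp_eq_int gr0_conv_Suc neg_0_less_iff_less linorder_neqE_linordered_idom of_nat_0_less_iff)
    have "unit (inverse (\<pi> powi k))" using k(1) by (rule unit_inverse)
    hence "unit (\<pi> powi (- k))" by (simp only: power_int_minus)
    hence "unit (\<pi> ^ Suc n)" by (simp only: n power_int_of_nat)
    thus False by (rule pos)
  qed
qed

lemma has_order_power:
  assumes "has_order x n m" "0 < k"
  shows "has_order x (n * k) (m * int k)"
proof -
  have "(x ^ n * \<pi> powi (- m)) ^ k = x ^ (n * k) * \<pi> powi (- (m * int k))"
    using power_int_mult[of \<pi> "- m" "int k"] by (simp add: power_mult_distrib power_mult)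
  thus ?thesis using assms unit_power[of "x ^ n * \<pi> powi (- m)" k] by (simp add: has_order_def)
qed

lemma has_order_mult:
  assumes "has_order x n m" "has_order y n m'"
  shows "has_order (x * y) n (m + m')"
proof -
  have "(x ^ n * \<pi> powi (- m)) * (y ^ n * \<pi> powi (- m')) = (x * y) ^ n * \<pi> powi (- (m + m'))"
    using \<pi>_nonzero by (simp add: power_mult_distrib power_int_diff power_int_minus field_simps power_int_add)
  thus ?thesis
    using assms unit_mult[of "x ^ n * \<pi> powi (- m)" "y ^ n * \<pi> powi (- m')"] by (simp add: has_order_def)
qed

lemma has_order_unique:
  assumes "has_order x n m" "has_order x n' m'"
  shows "m * int n' = m' * int n"
proof -
  have n: "0 < n" "0 < n'" using assms by (auto simp: has_order_def)
  define y where "y = x ^ (n * n')"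
  have u: "unit (y * \<pi> powi (- (m * int n')))"
    using has_order_power[OF assms(1) n(2)] by (simp add: has_order_def y_def)
  have u': "unit (y * \<pi> powi (- (m' * int n)))"
    using has_order_power[OF assms(2) n(1)] by (simp add: has_order_def y_def mult.commute)
  have "unit (inverse (y * \<pi> powi (- (m * int n'))) * (y * \<pi> powi (- (m' * int n))))"
    by (rule unit_mult[OF unit_inverse[OF u] u'])
  moreover have "y \<noteq> 0" using u' by (auto simp: unit_def)
  hence "inverse (y * \<pi> powi (- (m * int n'))) * (y * \<pi> powi (- (m' * int n))) = \<pi> powi (m * int n' - m' * int n)"
    using \<pi>_nonzero by (simp add: power_int_diff power_int_minus field_simps)
  ultimately show ?thesis using unit_\<pi>_powi by fastforce
qed

text \<open>The choice among the pairs \<open>(n, m)\<close> is immaterial by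
  \<open>has_order_unique\<close>. The base 2 is a normalization that is kept throughout.\<close>

definition norm_of :: "'b \<Rightarrow> real" where
  "norm_of x = (if x = 0 then 0 else
     let (n, m) = (SOME (n, m). has_order x n m) in 2 powr (- (real_of_int m / real n)))"

lemma norm_of_eq:
  assumes "has_order x n m"
  shows "norm_of x = 2 powr (- (real_of_int m / real n))"
proof -
  obtain n' m' where nm: "(SOME (n, m). has_order x n m) = (n', m')" by fastforce
  have "case (SOME (n, m). has_order x n m) of (n, m) \<Rightarrow> has_order x n m"
    by (rule someI[of _ "(n, m)"]) (simp add: assms)
  hence o': "has_order x n' m'" by (simp add: nm)
  have x: "x \<noteq> 0" using assms by (auto simp: has_order_def unit_def)
  have n: "0 < n" "0 < n'" using assms o' by (auto simp: has_order_def)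
  have "real_of_int m * real n' = real_of_int m' * real n"
    using arg_cong[OF has_order_unique[OF assms o'], of real_of_int] by simp
  hence "real_of_int m / real n = real_of_int m' / real n'" using n by (simp add: field_simps)
  thus ?thesis using x by (simp add: norm_of_def nm)
qed

text \<open>The closed unit ball is exactly \<open>B\<close>. After division by the larger of two
  elements, the ultrametric inequality is therefore the closure of \<open>B\<close> under adding
  1.\<close>

lemma nonarchimedean_norm_of:
  assumes ex: "\<And>x. x \<noteq> 0 \<Longrightarrow> \<exists>n m. has_order x n m"
  shows "nonarchimedean norm_of"
proof -
  have zero: "norm_of x = 0 \<longleftrightarrow> x = 0" for x
    using ex[of x] norm_of_eq[of x] by (cases "x = 0") (auto simp: norm_of_def)
  have nonneg: "0 \<le> norm_of x" for x
    using ex[of x] norm_of_eq[of x] by (cases "x = 0") (auto simp: norm_of_def)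
  have mult: "norm_of (x * y) = norm_of x * norm_of y" for x y
  proof (cases "x = 0 \<or> y = 0")
    case True
    thus ?thesis by (auto simp: norm_of_def)
  next
    case False
    obtain n m where x: "has_order x n m" using ex False by blast
    obtain n' m' where y: "has_order y n' m'" using ex False by blast
    have n: "0 < n" "0 < n'" using x y by (auto simp: has_order_def)
    have x': "has_order x (n * n') (m * int n')" using has_order_power[OF x n(2)] .
    have y': "has_order y (n * n') (m' * int n)"
      using has_order_power[OF y n(1)] by (simp only: mult.commute[of n n'])
    show ?thesis
      unfolding norm_of_eq[OF x'] norm_of_eq[OF y'] norm_of_eq[OF has_order_mult[OF x' y']]
      by (simp add: powr_add[symmetric] add_divide_distrib)
  qed
  have norm1: "norm_of 1 = 1" using mult[of 1 1] zero[of 1] by simp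
  have le1: "norm_of x \<le> 1 \<longleftrightarrow> x \<in> B" if nz: "x \<noteq> 0" for x
  proof -
    obtain n m where x: "has_order x n m" using ex[OF nz] by blast
    hence n: "0 < n" and u: "unit (x ^ n * \<pi> powi (- m))" by (auto simp: has_order_def)
    have "norm_of x \<le> 1 \<longleftrightarrow> real_of_int m / real n \<ge> 0"
      using powr_le_cancel_iff[of 2 "- (real_of_int m / real n)" 0] by (simp add: norm_of_eq[OF x])
    also have "\<dots> \<longleftrightarrow> m \<ge> 0" using n by (simp add: zero_le_divide_iff)
    also have "\<dots> \<longleftrightarrow> x \<in> B"
    proof
      assume "x \<in> B"
      show "m \<ge> 0"
      proof (rule ccontr)
        assume "\<not> m \<ge> 0"
        then obtain k where k: "- m = int (Suc k)"
          by (metis zero_less_imp_eq_int gr0_conv_Suc neg_0_less_iff_less not_le of_nat_0_less_iff)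
        have "unit (x ^ n * \<pi> ^ Suc k)" using u by (simp only: k power_int_of_nat)
        hence i: "inverse (x ^ n * \<pi> ^ Suc k) \<in> B" by (simp add: unit_def)
        have "inverse \<pi> = x ^ n * \<pi> ^ k * inverse (x ^ n * \<pi> ^ Suc k)"
          using nz \<pi>_nonzero by (simp add: field_simps)
        also have "\<dots> \<in> B" using \<open>x \<in> B\<close> i \<pi>_mem by (intro BD)
        finally show False using inverse_\<pi> by contradiction
      qed
    next
      assume "m \<ge> 0"
      then obtain k where k: "m = int k" using zero_le_imp_eq_int by blast
      have "x ^ n = (x ^ n * \<pi> powi (- m)) * \<pi> ^ k"
        using \<pi>_nonzero by (simp add: k power_int_minus field_simps)
      also have "\<dots> \<in> B" using u by (intro BD(4)[OF _ BD(7)[OF \<pi>_mem]]) (simp only: unit_def)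
      finally have xn: "x ^ n \<in> B" .
      show "x \<in> B"
      proof (rule ccontr)
        assume "x \<notin> B"
        hence ix: "inverse x \<in> B" by (rule total)
        have "x ^ n = x * x ^ (n - 1)" using n by (metis power_eq_if neq0_conv)
        hence "x = x ^ n * inverse x ^ (n - 1)" using nz by (simp add: power_inverse field_simps)
        also have "\<dots> \<in> B" by (rule BD(4)[OF xn BD(7)[OF ix]])
        finally show False using \<open>x \<notin> B\<close> by contradiction
      qed
    qed
    finally show ?thesis .
  qed
  have ultra: "norm_of (x + y) \<le> norm_of y" if "norm_of x \<le> norm_of y" "y \<noteq> 0" for x y
  proof -
    have eq: "norm_of z = norm_of (z / y) * norm_of y" for z
      using mult[of "z / y" y] that(2) by simp
    have pos: "norm_of y > 0" using zero[of y] nonneg[of y] that(2) by simp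
    have "norm_of (x / y) \<le> 1" using that(1) eq[of x] pos by simp
    hence "x / y \<in> B" using le1[of "x / y"] BD(2) by (cases "x = 0") (simp_all add: that(2))
    hence "x / y + 1 \<in> B" using BD(1) by (intro BD)
    hence "norm_of (x / y + 1) \<le> 1" using le1 zero[of 0] by (cases "x / y + 1 = 0") auto
    hence "norm_of ((x + y) / y) \<le> 1" using that(2) by (simp add: add_divide_distrib)
    thus ?thesis using eq[of "x + y"] pos by (simp add: mult_le_cancel_right1)
  qed
  have "norm_of (x + y) \<le> max (norm_of x) (norm_of y)" for x y
  proof -
    consider "x = 0" | "y = 0" | "x \<noteq> 0" "y \<noteq> 0" "norm_of x \<le> norm_of y" | "x \<noteq> 0" "y \<noteq> 0" "norm_of y \<le> norm_of x"
      by linarith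
    thus ?thesis
    proof cases
      case 3
      thus ?thesis using ultra[of x y] by simp
    next
      case 4
      thus ?thesis using ultra[of y x] by (simp add: add.commute)
    qed auto
  qed
  thus ?thesis using zero nonneg mult by (auto simp: nonarchimedean_def)
qed

end

text \<open>The valuation ring \<open>A\<close> of \<open>v\<close> is carried into the closure and
  enlarged there. Units of \<open>A\<close> remain units, and the inverse of the uniformizer stays
  outside, so the orders on the base field are still those of \<open>v\<close>. The larger ring
  could a priori have a complicated value group; algebraicity forces every order to be rational,
  which is what a real norm requires.\<close>

lemma exists_norm_extending_valuation:
  fixes v :: "'a::field \<Rightarrow> int"
  assumes v: "normalized_discrete_valuation v"
  obtains N :: "'a alg_closure \<Rightarrow> real" where "nonarchimedean N"
    "\<And>a. a \<noteq> 0 \<Longrightarrow> N (to_ac a) = 2 powr (- real_of_int (v a))"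
proof -
  have mult: "v (x * y) = v x + v y" if "x \<noteq> 0" "y \<noteq> 0" for x y
    using v that by (simp add: normalized_discrete_valuation_def)
  have ultra: "min (v x) (v y) \<le> v (x + y)" if "x \<noteq> 0" "y \<noteq> 0" "x + y \<noteq> 0" for x y
    using v that by (simp add: normalized_discrete_valuation_def)
  have v1: "v 1 = 0" using mult[of 1 1] by simp
  have inverse: "v (inverse x) = - v x" if "x \<noteq> 0" for x
    using mult[of x "inverse x"] that v1 by simp
  have "v (- 1) = 0" using mult[of "- 1" "- 1"] v1 by simp
  hence minus: "v (- x) = v x" if "x \<noteq> 0" for x
    using mult[of "- 1" x] that by simp
  have "1 \<in> v ` (UNIV - {0})" using v by (simp add: normalized_discrete_valuation_def)
  then obtain p where "1 = v p" "p \<in> UNIV - {0}" by (rule imageE)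
  hence p: "p \<noteq> 0" "v p = 1" by simp_all
  define A where "A = to_ac ` {a. a = 0 \<or> 0 \<le> v a}"
  have "subring_set A"
    unfolding subring_set_def
  proof (intro conjI ballI)
    show "1 \<in> A" unfolding A_def by (rule image_eqI[of _ _ 1]) (simp_all add: v1)
    fix x y assume "x \<in> A" "y \<in> A"
    then obtain a b where ab: "x = to_ac a" "a = 0 \<or> 0 \<le> v a" "y = to_ac b" "b = 0 \<or> 0 \<le> v b"
      by (auto simp: A_def)
    have "a - b = 0 \<or> 0 \<le> v (a - b)"
      using ab(2,4) ultra[of a "- b"] minus[of b] by (cases "a = 0"; cases "b = 0"; cases "a = b") auto
    thus "x - y \<in> A" unfolding A_def ab by (intro image_eqI[of _ _ "a - b"]) auto
    have "a * b = 0 \<or> 0 \<le> v (a * b)" using ab(2,4) mult[of a b] by (cases "a = 0"; cases "b = 0") auto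
    thus "x * y \<in> A" unfolding A_def ab by (intro image_eqI[of _ _ "a * b"]) auto
  qed
  moreover have "to_ac p \<in> A" unfolding A_def using p by (intro imageI) simp
  moreover have "inverse (to_ac p) \<notin> A"
  proof
    assume "inverse (to_ac p) \<in> A"
    then obtain a where a: "inverse (to_ac p) = to_ac a" "a = 0 \<or> 0 \<le> v a" by (auto simp: A_def)
    hence "to_ac (inverse p) = to_ac a" by simp
    hence "inverse p = a" by (simp only: to_ac_eq_iff)
    thus False using inverse[OF p(1)] p a(2) by auto
  qed
  ultimately obtain B where B: "subring_set B" "A \<subseteq> B" "inverse (to_ac p) \<notin> B" "\<And>x. x \<notin> B \<Longrightarrow> inverse x \<in> B"
    using exists_valuation_ring by blast
  interpret valuation_ring B "to_ac p"
    by standard (use B \<open>to_ac p \<in> A\<close> in auto)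
  have v_powi: "v (p powi k) = k" for k
  proof -
    have nat: "v (p ^ n) = int n" for n using p mult[of p "p ^ n" for n] v1 by (induction n) simp_all
    show ?thesis
    proof (cases k)
      case (nonneg n)
      thus ?thesis using nat by simp
    next
      case (neg n)
      have "v (inverse (p ^ Suc n)) = - int (Suc n)" using inverse[of "p ^ Suc n"] p(1) nat[of "Suc n"] by simp
      thus ?thesis by (simp only: neg power_int_minus power_int_of_nat)
    qed
  qed
  have to_ac_powi: "to_ac (p powi k) = to_ac p powi k" for k
    by (cases k) (simp_all add: power_int_minus del: of_nat_Suc)
  have order_K: "has_order (to_ac a) 1 (v a)" if "a \<noteq> 0" for a
  proof -
    have val: "v (a * p powi (- v a)) = 0" using mult[of a "p powi (- v a)"] that p(1) v_powi[of "- v a"] by simp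
    have nz: "a * p powi (- v a) \<noteq> 0" using that p(1) by simp
    define y where "y = a * p powi (- v a)"
    have y: "y \<noteq> 0" "v y = 0" using val nz by (simp_all add: y_def)
    have "to_ac y \<in> A" "to_ac (inverse y) \<in> A"
      unfolding A_def using y inverse[OF y(1)] by (intro imageI; simp)+
    hence "unit (to_ac y)" using y(1) B(2) by (auto simp: unit_def)
    thus ?thesis by (simp add: has_order_def y_def to_ac_powi)
  qed
  have "\<exists>n m. has_order x n m" if x: "x \<noteq> 0" for x
  proof -
    obtain f :: "'a poly" where f: "f \<noteq> 0" "poly (map_poly to_ac f) x = 0"
      by (rule alg_closure_algebraic)
    define T where "T = {i. i \<le> Polynomial.degree f \<and> Polynomial.coeff f i \<noteq> 0}"
    define t where "t = (\<lambda>i. to_ac (Polynomial.coeff f i) * x ^ i)"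
    have finT: "finite T" by (simp add: T_def)
    have "Polynomial.degree f \<in> T" using f(1) by (simp add: T_def)
    hence "T \<noteq> {}" by blast
    have tnz: "t i \<noteq> 0" if "i \<in> T" for i using that x by (simp add: t_def T_def)
    have "\<exists>i\<in>T. \<forall>k\<in>T. t k / t i \<in> B"
      using finT \<open>T \<noteq> {}\<close> tnz by (rule exists_dominant)
    then obtain i where i: "i \<in> T" "\<And>k. k \<in> T \<Longrightarrow> t k / t i \<in> B" by blast
    have deg: "Polynomial.degree (map_poly to_ac f) = Polynomial.degree f"
      by (rule degree_map_poly) simp
    have "(\<Sum>k\<le>Polynomial.degree f. t k) = 0"
      using f(2) unfolding poly_altdef t_def deg by (simp add: coeff_map_poly)
    moreover have "(\<Sum>k\<le>Polynomial.degree f. t k) = sum t T"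
      by (rule sum.mono_neutral_right) (auto simp: T_def t_def)
    ultimately have "sum t T = 0" by simp
    hence "t i + sum t (T - {i}) = 0" using finT i(1) by (simp add: sum.remove)
    \<comment> \<open>After division by a dominant term the other terms of the equation for
      \<open>x\<close> add up to the unit \<open>- 1\<close>. Nonunits are closed under addition, so
      a second term has the same valuation as term \<open>i\<close>; comparing the two monomials, a
      power of \<open>x\<close> has the order of a base field element.\<close>
    hence "(\<Sum>k\<in>T - {i}. t k / t i) = - 1"
      using tnz[OF i(1)] by (simp add: sum_divide_distrib[symmetric] field_simps add_eq_0_iff)
    moreover have "unit (- 1)" using BD(1) BD(5) by (simp add: unit_def)
    ultimately have "unit (\<Sum>k\<in>T - {i}. t k / t i)" by simp
    then obtain k where k: "k \<in> T - {i}" "unit (t k / t i)"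
      using nonunit_sum[of "T - {i}" "\<lambda>k. t k / t i"] finT i(2) by blast
    define a where "a = Polynomial.coeff f k / Polynomial.coeff f i"
    have a: "a \<noteq> 0" using k(1) i(1) by (simp add: a_def T_def)
    define P where "P = to_ac p powi (- v a)"
    have P: "P \<noteq> 0" using p(1) by (simp add: P_def)
    have ua: "unit (to_ac a * P)" using order_K[OF a] by (simp add: has_order_def P_def)
    have tki: "t k / t i = to_ac a * (x ^ k / x ^ i)" by (simp add: t_def a_def)
    consider "i < k" | "k < i" using k(1) by fastforce
    thus ?thesis
    proof cases
      case 1
      have "unit ((t k / t i) * inverse (to_ac a * P))" by (intro unit_mult unit_inverse k(2) ua)
      moreover have "(t k / t i) * inverse (to_ac a * P) = x ^ (k - i) * inverse P"
        unfolding tki using 1 x a P by (simp add: power_diff field_simps)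
      moreover have "inverse P = to_ac p powi (- (- v a))"
        unfolding P_def by (simp only: power_int_minus inverse_inverse_eq)
      ultimately have "has_order x (k - i) (- v a)" using 1 by (simp add: has_order_def)
      thus ?thesis by blast
    next
      case 2
      have "unit (inverse (t k / t i) * (to_ac a * P))" by (intro unit_mult unit_inverse k(2) ua)
      moreover have "inverse (t k / t i) * (to_ac a * P) = x ^ (i - k) * P"
        unfolding tki using 2 x a P by (simp add: power_diff field_simps)
      ultimately have "has_order x (i - k) (v a)" using 2 by (simp add: has_order_def P_def)
      thus ?thesis by blast
    qed
  qed
  hence "nonarchimedean norm_of" by (rule nonarchimedean_norm_of)
  moreover have "norm_of (to_ac a) = 2 powr (- real_of_int (v a))" if "a \<noteq> 0" for a
    using norm_of_eq[OF order_K[OF that]] by simp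
  ultimately show thesis by (rule that)
qed

lemma nonarchimedeanD:
  assumes "nonarchimedean N"
  shows "0 \<le> N x" "N x = 0 \<longleftrightarrow> x = 0" "N (x * y) = N x * N y" "N (x + y) \<le> max (N x) (N y)"
    "N 1 = 1" "N (- x) = N x" "N (x - y) \<le> max (N x) (N y)" "N (x ^ n) = N x ^ n" "N (inverse x) = inverse (N x)"
proof -
  show nonneg: "0 \<le> N x" for x using assms by (simp add: nonarchimedean_def)
  show zero: "N x = 0 \<longleftrightarrow> x = 0" for x using assms by (simp add: nonarchimedean_def)
  show mult: "N (x * y) = N x * N y" for x y using assms by (simp add: nonarchimedean_def)
  show add: "N (x + y) \<le> max (N x) (N y)" for x y using assms by (simp add: nonarchimedean_def)
  show one: "N 1 = 1" using mult[of 1 1] zero[of 1] by simp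
  have "N (- 1) * N (- 1) = 1" using mult[of "- 1" "- 1"] one by simp
  hence "N (- 1) = 1" using nonneg[of "- 1"] by (simp add: square_eq_1_iff)
  thus minus: "N (- x) = N x" for x using mult[of "- 1" x] by simp
  show "N (x - y) \<le> max (N x) (N y)" using add[of x "- y"] minus[of y] by simp
  show "N (x ^ n) = N x ^ n" by (induction n) (simp_all add: one mult)
  show "N (inverse x) = inverse (N x)"
  proof (cases "x = 0")
    case False
    hence "N x * N (inverse x) = 1" using mult[of x "inverse x"] one by simp
    thus ?thesis by (simp add: inverse_unique)
  qed (use zero[of 0] in simp)
qed

lemma nonarchimedean_add_eq:
  assumes "nonarchimedean N" "N y < N x"
  shows "N (x + y) = N x"
proof (rule antisym)
  show "N (x + y) \<le> N x" using nonarchimedeanD(4)[OF assms(1), of x y] assms(2) by simp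
  have "N x \<le> max (N (x + y)) (N y)" using nonarchimedeanD(7)[OF assms(1), of "x + y" y] by simp
  thus "N x \<le> N (x + y)" using assms(2) by simp
qed

section \<open>Slopes of the Newton polygon and valuations of roots\<close>

text \<open>In contrapositive form, a tie for the largest term at radius \<open>r\<close> forces a
  root of norm \<open>r\<close>. Linear factors are multiplied in one by one: a factor with root
  \<open>\<beta>\<close> moves the dominant index up by one if \<open>N \<beta> < r\<close> and
  leaves it in place if \<open>N \<beta> > r\<close>.\<close>

lemma unique_dominant_term:
  fixes p :: "'b::alg_closed_field poly"
  assumes N: "nonarchimedean N" and r: "0 < r"
    and "p \<noteq> 0" "\<And>\<beta>. poly p \<beta> = 0 \<Longrightarrow> N \<beta> \<noteq> r"
  shows "\<exists>i. \<forall>k. k \<noteq> i \<longrightarrow> N (Polynomial.coeff p k) * r ^ k < N (Polynomial.coeff p i) * r ^ i"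
  using assms(3,4)
proof (induction "Polynomial.degree p" arbitrary: p)
  case 0
  then obtain c where c: "p = [:c:]" using degree_eq_zeroE by metis
  hence "c \<noteq> 0" using 0 by simp
  hence "N c > 0" using nonarchimedeanD(1,2)[OF N, of c] by simp
  hence "N (Polynomial.coeff p k) * r ^ k < N (Polynomial.coeff p 0) * r ^ 0" if "k \<noteq> 0" for k
    using that nonarchimedeanD(2)[OF N, of 0] by (cases k) (simp_all add: c)
  thus ?case by blast
next
  case (Suc d)
  have "0 < Polynomial.degree p" using Suc.hyps(2) by simp
  then obtain \<beta> where \<beta>: "poly p \<beta> = 0" using alg_closed_imp_poly_has_root by blast
  then obtain h where h: "p = [:- \<beta>, 1:] * h" by (auto simp: poly_eq_0_iff_dvd)
  have "h \<noteq> 0" using Suc.prems(1) h by auto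
  have "Polynomial.degree p = Suc (Polynomial.degree h)"
    unfolding h using \<open>h \<noteq> 0\<close> by (subst degree_mult_eq) auto
  hence "d = Polynomial.degree h" using Suc.hyps(2) by simp
  moreover have "N \<gamma> \<noteq> r" if "poly h \<gamma> = 0" for \<gamma> using Suc.prems(2)[of \<gamma>] that h by simp
  ultimately obtain i where
    i: "\<And>k. k \<noteq> i \<Longrightarrow> N (Polynomial.coeff h k) * r ^ k < N (Polynomial.coeff h i) * r ^ i"
    using Suc.hyps(1)[of h] \<open>h \<noteq> 0\<close> by blast
  define M where "M = N (Polynomial.coeff h i) * r ^ i"
  have le: "N (Polynomial.coeff h k) * r ^ k \<le> M" for k
    using i[of k] by (cases "k = i") (auto simp: M_def)
  have "Polynomial.coeff h i \<noteq> 0"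
  proof
    assume "Polynomial.coeff h i = 0"
    hence "M = 0" using nonarchimedeanD(2)[OF N, of 0] by (simp add: M_def)
    have "N (Polynomial.coeff h (Suc i)) * r ^ Suc i < M" using i[of "Suc i"] by (simp add: M_def)
    moreover have "0 \<le> N (Polynomial.coeff h (Suc i)) * r ^ Suc i" using nonarchimedeanD(1)[OF N] r by simp
    ultimately show False using \<open>M = 0\<close> by linarith
  qed
  hence M: "M > 0" using nonarchimedeanD(1,2)[OF N, of "Polynomial.coeff h i"] r by (simp add: M_def)
  \<comment> \<open>These are the coefficients of \<open>h\<close> times the variable and of
    \<open>h\<close> times \<open>- \<beta>\<close>. In the weighted norms at radius
    \<open>r\<close> the first carry a factor \<open>r\<close>, the second a factor
    \<open>N \<beta>\<close>.\<close>
  define a b where "a = (\<lambda>k. case k of 0 \<Rightarrow> 0 | Suc j \<Rightarrow> Polynomial.coeff h j)"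
    and "b = (\<lambda>k. - \<beta> * Polynomial.coeff h k)"
  have coeff: "Polynomial.coeff p k = a k + b k" for k
    unfolding h by (cases k) (simp_all add: a_def b_def)
  have Nb: "N (b k) * r ^ k = N \<beta> * (N (Polynomial.coeff h k) * r ^ k)" for k
    by (simp add: b_def nonarchimedeanD(3,6)[OF N])
  have Na: "N (a (Suc k)) * r ^ Suc k = r * (N (Polynomial.coeff h k) * r ^ k)" for k
    by (simp add: a_def)
  have Na0: "N (a 0) * r ^ 0 = 0" using nonarchimedeanD(2)[OF N, of 0] by (simp add: a_def)
  have sum_less: "N (Polynomial.coeff p k) * r ^ k < c"
    if c: "N (a k) * r ^ k < c" "N (b k) * r ^ k < c" for k c
  proof -
    have "N (Polynomial.coeff p k) * r ^ k \<le> max (N (a k)) (N (b k)) * r ^ k"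
      unfolding coeff using nonarchimedeanD(4)[OF N] r by (intro mult_right_mono) auto
    thus ?thesis using c by (auto simp: max_def split: if_splits)
  qed
  have N\<beta>: "N \<beta> \<noteq> r" using Suc.prems(2)[OF \<beta>] .
  show ?case
  proof (cases "N \<beta> < r")
    case True
    have b_less: "N (b k) * r ^ k < r * M" for k
    proof -
      have "N (b k) * r ^ k \<le> N \<beta> * M"
        unfolding Nb using le nonarchimedeanD(1)[OF N] by (intro mult_left_mono) auto
      also have "\<dots> < r * M" using True M by simp
      finally show ?thesis .
    qed
    have ai: "N (a (Suc i)) * r ^ Suc i = r * M" unfolding Na by (simp add: M_def)
    hence "N (b (Suc i)) < N (a (Suc i))"
      using b_less[of "Suc i"] r by (metis mult_less_cancel_right_pos zero_less_power)
    hence eq: "N (Polynomial.coeff p (Suc i)) * r ^ Suc i = r * M"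
      unfolding coeff using nonarchimedean_add_eq[OF N] ai by simp
    have "N (Polynomial.coeff p k) * r ^ k < N (Polynomial.coeff p (Suc i)) * r ^ Suc i" if "k \<noteq> Suc i" for k
      unfolding eq
    proof (rule sum_less[OF _ b_less])
      show "N (a k) * r ^ k < r * M"
      proof (cases k)
        case 0
        thus ?thesis using Na0 r M by simp
      next
        case (Suc j)
        thus ?thesis unfolding Suc Na using i[of j] that Suc r by (intro mult_strict_left_mono) (auto simp: M_def)
      qed
    qed
    thus ?thesis by blast
  next
    case False
    hence gt: "r < N \<beta>" using N\<beta> by simp
    have a_less: "N (a k) * r ^ k < N \<beta> * M" for k
    proof (cases k)
      case 0
      thus ?thesis using Na0 gt r M by simp
    next
      case (Suc j)
      have "N (a k) * r ^ k \<le> r * M" unfolding Suc Na using le r by (intro mult_left_mono) auto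
      also have "\<dots> < N \<beta> * M" using gt M by simp
      finally show ?thesis .
    qed
    have bi: "N (b i) * r ^ i = N \<beta> * M" unfolding Nb by (simp add: M_def)
    hence "N (a i) < N (b i)"
      using a_less[of i] r by (metis mult_less_cancel_right_pos zero_less_power)
    hence eq: "N (Polynomial.coeff p i) * r ^ i = N \<beta> * M"
      unfolding coeff using nonarchimedean_add_eq[OF N, of "a i" "b i"] bi by (simp add: add.commute)
    have "N (Polynomial.coeff p k) * r ^ k < N (Polynomial.coeff p i) * r ^ i" if "k \<noteq> i" for k
      unfolding eq
    proof (rule sum_less[OF a_less])
      show "N (b k) * r ^ k < N \<beta> * M"
        unfolding Nb using i[OF that] gt r by (intro mult_strict_left_mono) (auto simp: M_def)
    qed
    thus ?thesis by blast
  qed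
qed

text \<open>\<open>newton_slopes\<close> admits any segment inside the polygon, and its ends may be
  neither vertices nor lattice points. Recovered here is what the valuation argument uses: the line
  carrying the segment lies on or below all Newton points and passes through two of them.\<close>

lemma newton_slope_supporting_line:
  assumes "s \<in> newton_slopes v h"
  obtains i j where "i \<noteq> j" "Polynomial.coeff h i \<noteq> 0" "Polynomial.coeff h j \<noteq> 0"
    "real_of_int (v (Polynomial.coeff h j)) - s * real j = real_of_int (v (Polynomial.coeff h i)) - s * real i"
    "\<And>k. Polynomial.coeff h k \<noteq> 0 \<Longrightarrow>
       real_of_int (v (Polynomial.coeff h i)) - s * real i \<le> real_of_int (v (Polynomial.coeff h k)) - s * real k"
proof -
  define S where "S = newton_points v h"
  define H where "H = convex hull S"
  obtain P Q where PQ: "fst P < fst Q" "closed_segment P Q \<subseteq> newton_polygon v h"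
    and s: "s = (snd Q - snd P) / (fst Q - fst P)"
    using assms by (auto simp: newton_slopes_def)
  \<comment> \<open>The height above the line through \<open>P\<close> and \<open>Q\<close>, an
    affine function.\<close>
  define \<phi> where "\<phi> = (\<lambda>z::real \<times> real. snd z - snd P - s * (fst z - fst P))"
  have affine: "\<phi> ((1 - u) *\<^sub>R a + u *\<^sub>R b) = (1 - u) * \<phi> a + u * \<phi> b" for u a b
    by (simp add: \<phi>_def algebra_simps)
  have \<phi>P: "\<phi> P = 0" by (simp add: \<phi>_def)
  have \<phi>Q: "\<phi> Q = 0" using PQ(1) by (simp add: \<phi>_def s)
  have NP: "z \<in> H" "\<And>y'. (fst z, y') \<in> H \<Longrightarrow> snd z \<le> y'" if "z \<in> newton_polygon v h" for z
    using that by (auto simp: newton_polygon_def H_def S_def)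
  have PH: "P \<in> H" and QH: "Q \<in> H" using NP(1) PQ(2) ends_in_segment[of P Q] by blast+
  have convH: "(1 - u) *\<^sub>R a + u *\<^sub>R b \<in> H" if "a \<in> H" "b \<in> H" "0 \<le> u" "u \<le> 1" for a b u
    using convex_convex_hull[of S] that unfolding H_def by (intro convexD_alt) auto
  have between: "0 \<le> \<phi> z" if z: "z \<in> H" "fst P \<le> fst z" "fst z \<le> fst Q" for z
  proof -
    define u where "u = (fst z - fst P) / (fst Q - fst P)"
    have u: "0 \<le> u" "u \<le> 1" using z PQ(1) by (auto simp: u_def divide_le_eq)
    define R where "R = (1 - u) *\<^sub>R P + u *\<^sub>R Q"
    have "R \<in> newton_polygon v h" using PQ(2) u by (auto simp: R_def closed_segment_def)
    moreover have fR: "fst R = fst z"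
    proof -
      have "fst R = fst P + u * (fst Q - fst P)" by (simp add: R_def algebra_simps)
      also have "\<dots> = fst z" using PQ(1) by (simp add: u_def)
      finally show ?thesis .
    qed
    ultimately have "snd R \<le> snd z" using NP(2)[of R "snd z"] z(1) by simp
    moreover have "\<phi> R = 0" unfolding R_def affine by (simp add: \<phi>P \<phi>Q)
    ultimately show ?thesis using fR by (simp add: \<phi>_def)
  qed
  have nonneg: "0 \<le> \<phi> x" if x: "x \<in> S" for x
  proof (rule ccontr)
    assume neg: "\<not> 0 \<le> \<phi> x"
    have xH: "x \<in> H" using x by (simp add: H_def hull_inc)
    consider "fst P \<le> fst x" "fst x \<le> fst Q" | "fst x < fst P" | "fst Q < fst x" by linarith
    thus False
    proof cases
      case 1
      thus False using between[OF xH] neg by simp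
    next
      case 2
      \<comment> \<open>\<open>x\<close> is joined to the far end \<open>Q\<close>, and
        \<open>u\<close> marks where the join crosses the vertical line through \<open>P\<close>.
        The height there is nonnegative, yet it is a positive multiple of \<open>\<phi> x\<close>,
        because \<open>Q\<close> has height 0.\<close>
      define u where "u = (fst P - fst x) / (fst Q - fst x)"
      have u: "0 \<le> u" "u < 1" using 2 PQ(1) by (auto simp: u_def divide_less_eq)
      define z where "z = (1 - u) *\<^sub>R x + u *\<^sub>R Q"
      have "fst z = fst x + u * (fst Q - fst x)" by (simp add: z_def algebra_simps)
      also have "\<dots> = fst P" using 2 PQ(1) by (simp add: u_def)
      finally have "0 \<le> \<phi> z" using between[of z] convH[OF xH QH u(1)] u(2) PQ(1) by (simp add: z_def)
      moreover have "\<phi> z = (1 - u) * \<phi> x" unfolding z_def affine by (simp add: \<phi>Q)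
      ultimately show False using neg u(2) by (simp add: zero_le_mult_iff)
    next
      case 3
      define u where "u = (fst Q - fst P) / (fst x - fst P)"
      have u: "0 < u" "u \<le> 1" using 3 PQ(1) by (auto simp: u_def divide_le_eq)
      define z where "z = (1 - u) *\<^sub>R P + u *\<^sub>R x"
      have "fst z = fst P + u * (fst x - fst P)" by (simp add: z_def algebra_simps)
      also have "\<dots> = fst Q" using 3 PQ(1) by (simp add: u_def)
      finally have "0 \<le> \<phi> z" using between[of z] convH[OF PH xH _ u(2)] u(1) PQ(1) by (simp add: z_def)
      moreover have "\<phi> z = u * \<phi> x" unfolding z_def affine by (simp add: \<phi>P)
      ultimately show False using neg u(1) by (simp add: zero_le_mult_iff)
    qed
  qed
  have "\<exists>x\<in>S. \<exists>y\<in>S. \<phi> x = 0 \<and> \<phi> y = 0 \<and> x \<noteq> y"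
  proof (rule ccontr)
    assume no: "\<not> ?thesis"
    obtain x0 where x0: "\<And>x. x \<in> S \<Longrightarrow> \<phi> x = 0 \<Longrightarrow> x = x0" using no by metis
    \<comment> \<open>With at most one Newton point on the line, the open upper half plane together
      with that point is convex and contains all Newton points, hence their hull. But the hull
      contains the two points \<open>P\<close> and \<open>Q\<close> of height 0.\<close>
    define T where "T = {z. 0 \<le> \<phi> z \<and> (\<phi> z = 0 \<longrightarrow> z = x0)}"
    have "convex T"
      unfolding convex_alt
    proof (intro ballI allI impI)
      fix a b and u :: real assume ab: "a \<in> T" "b \<in> T" and u: "0 \<le> u \<and> u \<le> 1"
      have nn: "0 \<le> (1 - u) * \<phi> a" "0 \<le> u * \<phi> b" using ab u by (auto simp: T_def)
      have "(1 - u) *\<^sub>R a + u *\<^sub>R b = x0" if "(1 - u) * \<phi> a + u * \<phi> b = 0"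
      proof -
        have "(1 - u) * \<phi> a = 0" "u * \<phi> b = 0" using that nn by linarith+
        hence "u = 0 \<and> \<phi> a = 0 \<or> u = 1 \<and> \<phi> b = 0 \<or> \<phi> a = 0 \<and> \<phi> b = 0" by auto
        hence "u = 0 \<and> a = x0 \<or> u = 1 \<and> b = x0 \<or> a = x0 \<and> b = x0" using ab by (auto simp: T_def)
        thus ?thesis by (auto simp: algebra_simps)
      qed
      thus "(1 - u) *\<^sub>R a + u *\<^sub>R b \<in> T" using nn by (simp add: T_def affine)
    qed
    moreover have "S \<subseteq> T" using nonneg x0 by (auto simp: T_def)
    ultimately have "H \<subseteq> T" unfolding H_def by (rule hull_minimal[rotated])
    hence "P = x0" "Q = x0" using PH QH \<phi>P \<phi>Q by (auto simp: T_def)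
    thus False using PQ(1) by simp
  qed
  then obtain x y where xy: "x \<in> S" "y \<in> S" "\<phi> x = 0" "\<phi> y = 0" "x \<noteq> y" by blast
  obtain i j where i: "x = (real i, real_of_int (v (Polynomial.coeff h i)))" "Polynomial.coeff h i \<noteq> 0"
    and j: "y = (real j, real_of_int (v (Polynomial.coeff h j)))" "Polynomial.coeff h j \<noteq> 0"
    using xy(1,2) by (auto simp: S_def newton_points_def)
  show thesis
  proof (rule that)
    show "i \<noteq> j" using xy(5) i j by auto
    show "real_of_int (v (Polynomial.coeff h j)) - s * real j = real_of_int (v (Polynomial.coeff h i)) - s * real i"
      using xy(3,4) by (simp add: i j \<phi>_def algebra_simps)
    fix k assume k: "Polynomial.coeff h k \<noteq> 0"
    hence "(real k, real_of_int (v (Polynomial.coeff h k))) \<in> S" by (auto simp: S_def newton_points_def)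
    hence "0 \<le> \<phi> (real k, real_of_int (v (Polynomial.coeff h k)))" by (rule nonneg)
    thus "real_of_int (v (Polynomial.coeff h i)) - s * real i \<le> real_of_int (v (Polynomial.coeff h k)) - s * real k"
      using xy(3) by (simp add: i \<phi>_def algebra_simps)
  qed (use i j in auto)
qed

text \<open>At radius \<open>2 powr s\<close> the weighted norm of a term is 2 to the negative of
  \<open>v\<close> of its coefficient minus \<open>s\<close> times its index. The points on the
  supporting line give the largest terms, and two of them tie.\<close>

lemma exists_root_of_newton_slope:
  fixes h :: "'a::field poly"
  assumes N: "nonarchimedean N" "\<And>a. a \<noteq> 0 \<Longrightarrow> N (to_ac a) = 2 powr (- real_of_int (v a))"
    and s: "s \<in> newton_slopes v h"
  obtains \<beta> where "poly (map_poly to_ac h) \<beta> = 0" "N \<beta> = 2 powr s"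
proof (rule ccontr)
  assume no: "\<not> thesis"
  obtain i j where ij: "i \<noteq> j" "Polynomial.coeff h i \<noteq> 0" "Polynomial.coeff h j \<noteq> 0"
    and eq: "real_of_int (v (Polynomial.coeff h j)) - s * real j = real_of_int (v (Polynomial.coeff h i)) - s * real i"
    and le: "\<And>k. Polynomial.coeff h k \<noteq> 0 \<Longrightarrow>
       real_of_int (v (Polynomial.coeff h i)) - s * real i \<le> real_of_int (v (Polynomial.coeff h k)) - s * real k"
    using newton_slope_supporting_line[OF s] by blast
  define p where "p = map_poly to_ac h"
  define r where "r = (2::real) powr s"
  have coeff: "Polynomial.coeff p k = to_ac (Polynomial.coeff h k)" for k by (simp add: p_def coeff_map_poly)
  have size: "N (Polynomial.coeff p k) * r ^ k = 2 powr (- (real_of_int (v (Polynomial.coeff h k)) - s * real k))"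
    if "Polynomial.coeff h k \<noteq> 0" for k
  proof -
    have "r ^ k = 2 powr (s * real k)" by (simp add: r_def powr_powr[symmetric] powr_realpow)
    thus ?thesis unfolding coeff N(2)[OF that] by (simp add: powr_add[symmetric])
  qed
  have "p \<noteq> 0" using ij(2) coeff[of i] by auto
  moreover have "N \<beta> \<noteq> r" if "poly p \<beta> = 0" for \<beta> using that no \<open>\<And>\<beta>. poly (map_poly to_ac h) \<beta> = 0 \<Longrightarrow> N \<beta> = 2 powr s \<Longrightarrow> thesis\<close> by (auto simp: p_def r_def)
  moreover have "0 < r" by (simp add: r_def)
  ultimately obtain l where l: "\<And>k. k \<noteq> l \<Longrightarrow> N (Polynomial.coeff p k) * r ^ k < N (Polynomial.coeff p l) * r ^ l"
    using unique_dominant_term[OF N(1), of r p] by blast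
  have "Polynomial.coeff h l \<noteq> 0"
  proof
    assume "Polynomial.coeff h l = 0"
    hence 0: "N (Polynomial.coeff p l) * r ^ l = 0" using nonarchimedeanD(2)[OF N(1), of 0] by (simp add: coeff)
    hence "l \<noteq> i" using \<open>Polynomial.coeff h l = 0\<close> ij(2) by auto
    hence "N (Polynomial.coeff p i) * r ^ i < 0" using l[of i] 0 by simp
    thus False using size[OF ij(2)] by simp
  qed
  hence "N (Polynomial.coeff p l) * r ^ l \<le> N (Polynomial.coeff p i) * r ^ i"
    unfolding size[OF \<open>Polynomial.coeff h l \<noteq> 0\<close>] size[OF ij(2)] using le[of l] by simp
  moreover have "N (Polynomial.coeff p j) * r ^ j = N (Polynomial.coeff p i) * r ^ i"
    unfolding size[OF ij(2)] size[OF ij(3)] eq ..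
  ultimately show False using l[of i] l[of j] ij(1) by fastforce
qed

section \<open>Embeddings of intermediate fields\<close>

abbreviation base_field :: "'a::field alg_closure set" where
  "base_field \<equiv> range to_ac"

definition poly_over :: "'b::zero set \<Rightarrow> 'b poly \<Rightarrow> bool" where
  "poly_over S p \<longleftrightarrow> (\<forall>i. Polynomial.coeff p i \<in> S)"

lemma subring_set_base_field: "subring_set base_field"
proof -
  have "to_ac a - to_ac b \<in> base_field" "to_ac a * to_ac b \<in> base_field" for a b :: 'a
    by (metis rangeI to_ac_diff, metis rangeI to_ac_mult)
  moreover have "1 \<in> base_field" by (metis rangeI to_ac_1)
  ultimately show ?thesis by (auto simp: subring_set_def)
qed

lemma poly_over_map_to_ac: "base_field \<subseteq> S \<Longrightarrow> poly_over S (map_poly to_ac p)"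
  by (auto simp: poly_over_def coeff_map_poly)

lemma poly_over_base_fieldE:
  assumes "poly_over base_field p"
  obtains p0 where "p = map_poly to_ac p0"
proof
  show "p = map_poly to_ac (map_poly of_ac p)"
    using assms by (intro poly_eqI) (simp add: coeff_map_poly poly_over_def to_ac_of_ac)
qed

lemma map_poly_to_ac_mult: "map_poly to_ac (p * q) = map_poly to_ac p * map_poly to_ac q"
  by (rule poly_eqI) (simp add: coeff_map_poly Polynomial.coeff_mult to_ac_sum)

lemma map_poly_to_ac_eq_iff: "map_poly to_ac p = map_poly to_ac q \<longleftrightarrow> p = q"
proof
  assume "map_poly to_ac p = map_poly to_ac q"
  hence "to_ac (Polynomial.coeff p i) = to_ac (Polynomial.coeff q i)" for i
    by (metis coeff_map_poly to_ac_0)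
  thus "p = q" by (intro poly_eqI) simp
qed simp

lemma degree_map_poly_to_ac [simp]: "Polynomial.degree (map_poly to_ac p) = Polynomial.degree p"
  by (rule degree_map_poly) simp

text \<open>The closure being algebraic, subrings containing the base field are fields.\<close>

lemma inverse_mem_subring_set:
  fixes S :: "'a::field alg_closure set"
  assumes S: "subring_set S" "base_field \<subseteq> S" and x: "x \<in> S"
  shows "inverse x \<in> S"
proof (cases "x = 0")
  case False
  define Q where "Q = (\<lambda>p::'a poly. p \<noteq> 0 \<and> poly (map_poly to_ac p) x = 0)"
  obtain p0 :: "'a poly" where "p0 \<noteq> 0" "poly (map_poly to_ac p0) x = 0"
    by (rule alg_closure_algebraic)
  hence "Q p0" by (simp add: Q_def)
  then obtain p where p: "Q p" "\<forall>q. Q q \<longrightarrow> Polynomial.degree p \<le> Polynomial.degree q"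
    using ex_has_least_nat[of Q p0 Polynomial.degree] by blast
  obtain c q where pq: "p = pCons c q" by (rule pCons_cases)
  have eq: "to_ac c + x * poly (map_poly to_ac q) x = 0"
    using p(1) by (simp add: Q_def pq map_poly_pCons)
  have "c \<noteq> 0"
  proof
    assume "c = 0"
    hence "Q q" using p(1) eq False by (auto simp: Q_def pq)
    hence "Polynomial.degree p \<le> Polynomial.degree q" using p(2) by blast
    moreover have "q \<noteq> 0" using \<open>Q q\<close> by (simp add: Q_def)
    ultimately show False by (simp add: pq)
  qed
  hence "x * (- poly (map_poly to_ac q) x * to_ac (inverse c)) = 1"
    using eq by (simp add: field_simps add_eq_0_iff)
  hence "inverse x = - poly (map_poly to_ac q) x * to_ac (inverse c)"
    by (rule inverse_unique)
  also have "\<dots> \<in> S"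
  proof (rule subring_setD(4)[OF S(1)])
    have "Polynomial.coeff (map_poly to_ac q) i \<in> S" for i using S(2) by (auto simp: coeff_map_poly)
    thus "- poly (map_poly to_ac q) x \<in> S"
      using x by (intro subring_setD(5)[OF S(1)] subring_set_poly[OF S(1)])
    show "to_ac (inverse c) \<in> S" using S(2) by blast
  qed
  finally show ?thesis .
qed (use subring_setD(2)[OF S(1)] in simp)

section \<open>Division and minimal polynomials over intermediate fields\<close>

locale intermediate_field =
  fixes S :: "'a::field alg_closure set"
  assumes S: "subring_set S" "base_field \<subseteq> S"
begin

lemmas SD = subring_setD[OF S(1)]

lemma inverse_mem: "x \<in> S \<Longrightarrow> inverse x \<in> S"
  using inverse_mem_subring_set S by blast

lemma to_ac_mem: "to_ac a \<in> S"
  using S(2) by blast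

lemma poly_over_diff: "poly_over S p \<Longrightarrow> poly_over S q \<Longrightarrow> poly_over S (p - q)"
  by (simp add: poly_over_def SD(3))

lemma poly_over_add: "poly_over S p \<Longrightarrow> poly_over S q \<Longrightarrow> poly_over S (p + q)"
  by (simp add: poly_over_def SD(6))

lemma poly_over_mult: "poly_over S p \<Longrightarrow> poly_over S q \<Longrightarrow> poly_over S (p * q)"
  unfolding poly_over_def using coeff_mult_mem[OF S(1)] by blast

lemma poly_over_monom: "c \<in> S \<Longrightarrow> poly_over S (Polynomial.monom c n)"
  by (simp add: poly_over_def SD(2))

lemma poly_over_0: "poly_over S 0"
  by (simp add: poly_over_def SD(2))

lemma ring_adjoin_field: "intermediate_field (ring_adjoin S x)"
  using subring_set_ring_adjoin[OF S(1)] ring_adjoin_subset[OF S(1)] S(2)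
  by unfold_locales blast+

text \<open>Intermediate fields are subsets of the closure and not types of their own, so Euclidean
  division has to keep track of where the coefficients lie.\<close>

lemma poly_over_division:
  assumes m: "poly_over S m" "m \<noteq> 0" and h: "poly_over S h"
  shows "\<exists>q r. poly_over S q \<and> poly_over S r \<and> h = q * m + r \<and>
    (r = 0 \<or> Polynomial.degree r < Polynomial.degree m)"
  using h
proof (induction "Polynomial.degree h" arbitrary: h rule: less_induct)
  case less
  show ?case
  proof (cases "h = 0 \<or> Polynomial.degree h < Polynomial.degree m")
    case True
    thus ?thesis using less.prems poly_over_0 by (intro exI[of _ 0] exI[of _ h]) auto
  next
    case False
    define c t where "c = Polynomial.lead_coeff h * inverse (Polynomial.lead_coeff m)"
      and "t = Polynomial.monom c (Polynomial.degree h - Polynomial.degree m)"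
    have "c \<in> S" unfolding c_def
      using less.prems m(1) by (intro SD(4) inverse_mem) (auto simp: poly_over_def)
    hence t: "poly_over S t" unfolding t_def by (rule poly_over_monom)
    have "c \<noteq> 0" using False m(2) by (simp add: c_def)
    define h' where "h' = h - t * m"
    have h': "poly_over S h'" unfolding h'_def using less.prems t m(1)
      by (intro poly_over_diff poly_over_mult)
    have "t \<noteq> 0" using \<open>c \<noteq> 0\<close> by (simp add: t_def)
    hence "Polynomial.degree (t * m) = Polynomial.degree t + Polynomial.degree m"
      using m(2) by (rule degree_mult_eq)
    moreover have "Polynomial.degree t = Polynomial.degree h - Polynomial.degree m"
      using \<open>c \<noteq> 0\<close> by (simp add: t_def degree_monom_eq)
    ultimately have deg: "Polynomial.degree (t * m) = Polynomial.degree h" using False by simp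
    have "Polynomial.lead_coeff (t * m) = Polynomial.lead_coeff h"
      using m(2) \<open>c \<noteq> 0\<close> by (simp add: lead_coeff_mult t_def degree_monom_eq c_def)
    hence lc0: "Polynomial.coeff h' (Polynomial.degree h) = 0" by (simp add: h'_def deg)
    have "Polynomial.degree h' \<le> Polynomial.degree h"
      unfolding h'_def using deg by (intro degree_diff_le) simp_all
    hence "h' = 0 \<or> Polynomial.degree h' < Polynomial.degree h"
      using lc0 leading_coeff_0_iff[of h'] by (cases "Polynomial.degree h' = Polynomial.degree h") auto
    then consider "h' = 0" | "Polynomial.degree h' < Polynomial.degree h" by blast
    thus ?thesis
    proof cases
      case 1
      hence "h = t * m + 0" by (simp add: h'_def)
      thus ?thesis using t poly_over_0 by blast
    next
      case 2
      then obtain q r where qr: "poly_over S q" "poly_over S r" "h' = q * m + r"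
        "r = 0 \<or> Polynomial.degree r < Polynomial.degree m"
        using less.hyps[OF 2 h'] by blast
      have "h = (t + q) * m + r" using qr(3) by (simp add: h'_def algebra_simps)
      thus ?thesis using qr poly_over_add[OF t qr(1)] by blast
    qed
  qed
qed

text \<open>Not made monic, hence a relation and not a function: the polynomial is determined up to
  a scalar, and only its degree and divisibility matter.\<close>

definition minpoly :: "'a alg_closure \<Rightarrow> 'a alg_closure poly \<Rightarrow> bool" where
  "minpoly x m \<longleftrightarrow> poly_over S m \<and> m \<noteq> 0 \<and> poly m x = 0 \<and>
     (\<forall>h. poly_over S h \<longrightarrow> h \<noteq> 0 \<longrightarrow> poly h x = 0 \<longrightarrow> Polynomial.degree m \<le> Polynomial.degree h)"

lemma minpoly_exists: "\<exists>m. minpoly x m"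
proof -
  define Q where "Q = (\<lambda>p. poly_over S p \<and> p \<noteq> 0 \<and> poly p x = 0)"
  obtain p :: "'a poly" where p: "p \<noteq> 0" "poly (map_poly to_ac p) x = 0" by (rule alg_closure_algebraic)
  have "map_poly to_ac p \<noteq> 0" using p(1) map_poly_to_ac_eq_iff[of p 0] by simp
  hence "Q (map_poly to_ac p)" using p(2) poly_over_map_to_ac[OF S(2)] by (simp add: Q_def)
  then obtain m where "Q m" "\<forall>q. Q q \<longrightarrow> Polynomial.degree m \<le> Polynomial.degree q"
    using ex_has_least_nat[of Q _ Polynomial.degree] by blast
  thus ?thesis unfolding minpoly_def Q_def by blast
qed

lemma minpoly_dvd:
  assumes m: "minpoly x m" and h: "poly_over S h" "poly h x = 0"
  obtains q where "poly_over S q" "h = q * m"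
proof -
  obtain q r where qr: "poly_over S q" "poly_over S r" "h = q * m + r"
    "r = 0 \<or> Polynomial.degree r < Polynomial.degree m"
    using poly_over_division[of m h] m h(1) unfolding minpoly_def by blast
  have "poly r x = 0" using h(2) m qr(3) by (simp add: minpoly_def)
  hence "r = 0" using qr m unfolding minpoly_def by (metis not_le)
  thus thesis using that qr by simp
qed

lemma degree_minpoly_pos: "minpoly x m \<Longrightarrow> 0 < Polynomial.degree m"
proof (rule ccontr)
  assume m: "minpoly x m" and "\<not> 0 < Polynomial.degree m"
  then obtain c where "m = [:c:]" by (metis degree_eq_zeroE neq0_conv)
  thus False using m by (auto simp: minpoly_def)
qed

lemma ring_adjoin_reduced:
  assumes m: "minpoly x m" and y: "y \<in> ring_adjoin S x"
  obtains h where "poly_over S h" "y = poly h x" "Polynomial.degree h < Polynomial.degree m"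
proof -
  obtain g where g: "poly_over S g" "y = poly g x" using y by (auto simp: ring_adjoin_def poly_over_def)
  obtain q r where qr: "poly_over S q" "poly_over S r" "g = q * m + r"
    "r = 0 \<or> Polynomial.degree r < Polynomial.degree m"
    using poly_over_division[of m g] m g(1) unfolding minpoly_def by blast
  have "y = poly r x" using g(2) qr(3) m by (simp add: minpoly_def)
  moreover have "Polynomial.degree r < Polynomial.degree m" using qr(4) degree_minpoly_pos[OF m] by auto
  ultimately show thesis using that qr(2) by blast
qed

end

section \<open>Embeddings over the base field and their extension\<close>

definition base_embedding :: "'a::field alg_closure set \<Rightarrow> ('a alg_closure \<Rightarrow> 'a alg_closure) \<Rightarrow> bool" where
  "base_embedding S \<tau> \<longleftrightarrow> (\<forall>x\<in>S. \<forall>y\<in>S. \<tau> (x + y) = \<tau> x + \<tau> y \<and> \<tau> (x * y) = \<tau> x * \<tau> y) \<and>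
     (\<forall>a. \<tau> (to_ac a) = to_ac a)"

lemma base_embedding_subset: "base_embedding T \<tau> \<Longrightarrow> S \<subseteq> T \<Longrightarrow> base_embedding S \<tau>"
  unfolding base_embedding_def by blast

locale embedding = intermediate_field S for S :: "'a::field alg_closure set" +
  fixes \<tau> :: "'a alg_closure \<Rightarrow> 'a alg_closure"
  assumes emb: "base_embedding S \<tau>"
begin

lemma \<tau>_add: "x \<in> S \<Longrightarrow> y \<in> S \<Longrightarrow> \<tau> (x + y) = \<tau> x + \<tau> y"
  and \<tau>_mult: "x \<in> S \<Longrightarrow> y \<in> S \<Longrightarrow> \<tau> (x * y) = \<tau> x * \<tau> y"
  and \<tau>_to_ac: "\<tau> (to_ac a) = to_ac a"
  using emb by (auto simp: base_embedding_def)

lemma \<tau>_0 [simp]: "\<tau> 0 = 0" and \<tau>_1 [simp]: "\<tau> 1 = 1"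
  using \<tau>_to_ac[of 0] \<tau>_to_ac[of 1] by simp_all

lemma \<tau>_diff: "x \<in> S \<Longrightarrow> y \<in> S \<Longrightarrow> \<tau> (x - y) = \<tau> x - \<tau> y"
  using \<tau>_add[of "x - y" y] SD(3)[of x y] by simp

lemma \<tau>_eq_0: "x \<in> S \<Longrightarrow> \<tau> x = 0 \<Longrightarrow> x = 0"
  using \<tau>_mult[of x "inverse x"] inverse_mem[of x] by (cases "x = 0") auto

lemma \<tau>_inj: "x \<in> S \<Longrightarrow> y \<in> S \<Longrightarrow> \<tau> x = \<tau> y \<Longrightarrow> x = y"
  using \<tau>_diff[of x y] \<tau>_eq_0[of "x - y"] SD(3)[of x y] by simp

lemma \<tau>_sum: "(\<And>i. i \<in> I \<Longrightarrow> f i \<in> S) \<Longrightarrow> \<tau> (sum f I) = (\<Sum>i\<in>I. \<tau> (f i))"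
proof (induction I rule: infinite_finite_induct)
  case (insert i I)
  have "sum f I \<in> S" using insert.prems by (intro subring_set_sum[OF S(1)]) auto
  thus ?case using insert by (simp add: \<tau>_add)
qed simp_all

lemma \<tau>_power: "x \<in> S \<Longrightarrow> \<tau> (x ^ n) = \<tau> x ^ n"
  by (induction n) (simp_all add: \<tau>_mult SD(7))

lemma coeff_map_\<tau>: "Polynomial.coeff (map_poly \<tau> p) i = \<tau> (Polynomial.coeff p i)"
  by (simp add: coeff_map_poly)

lemma map_poly_\<tau>_add: "poly_over S p \<Longrightarrow> poly_over S q \<Longrightarrow> map_poly \<tau> (p + q) = map_poly \<tau> p + map_poly \<tau> q"
  by (rule poly_eqI) (simp add: coeff_map_\<tau> \<tau>_add poly_over_def)

lemma map_poly_\<tau>_diff: "poly_over S p \<Longrightarrow> poly_over S q \<Longrightarrow> map_poly \<tau> (p - q) = map_poly \<tau> p - map_poly \<tau> q"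
  by (rule poly_eqI) (simp add: coeff_map_\<tau> \<tau>_diff poly_over_def)

lemma map_poly_\<tau>_mult:
  assumes "poly_over S p" "poly_over S q"
  shows "map_poly \<tau> (p * q) = map_poly \<tau> p * map_poly \<tau> q"
proof (rule poly_eqI)
  fix n
  have "\<tau> (\<Sum>i\<le>n. Polynomial.coeff p i * Polynomial.coeff q (n - i)) =
      (\<Sum>i\<le>n. \<tau> (Polynomial.coeff p i * Polynomial.coeff q (n - i)))"
    using assms by (intro \<tau>_sum SD(4)) (auto simp: poly_over_def)
  also have "\<dots> = (\<Sum>i\<le>n. \<tau> (Polynomial.coeff p i) * \<tau> (Polynomial.coeff q (n - i)))"
    using assms by (intro sum.cong refl \<tau>_mult) (auto simp: poly_over_def)
  finally show "Polynomial.coeff (map_poly \<tau> (p * q)) n = Polynomial.coeff (map_poly \<tau> p * map_poly \<tau> q) n"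
    by (simp add: coeff_map_\<tau> Polynomial.coeff_mult)
qed

lemma degree_map_\<tau>:
  assumes "poly_over S p"
  shows "Polynomial.degree (map_poly \<tau> p) = Polynomial.degree p"
proof (cases "p = 0")
  case False
  hence "\<tau> (Polynomial.lead_coeff p) \<noteq> 0" using \<tau>_eq_0[of "Polynomial.lead_coeff p"] assms leading_coeff_0_iff[of p]
    by (simp add: poly_over_def) blast
  thus ?thesis by (rule map_poly_degree_eq)
qed simp

lemma \<tau>_poly:
  assumes "poly_over S p" "x \<in> S"
  shows "\<tau> (poly p x) = poly (map_poly \<tau> p) (\<tau> x)"
proof -
  have "\<tau> (poly p x) = (\<Sum>i\<le>Polynomial.degree p. \<tau> (Polynomial.coeff p i * x ^ i))"
    unfolding poly_altdef using assms by (intro \<tau>_sum SD(4,7)) (auto simp: poly_over_def)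
  also have "\<dots> = (\<Sum>i\<le>Polynomial.degree p. \<tau> (Polynomial.coeff p i) * \<tau> x ^ i)"
    using assms by (intro sum.cong refl) (simp add: \<tau>_mult \<tau>_power SD(7) poly_over_def)
  finally show ?thesis by (simp add: poly_altdef degree_map_\<tau>[OF assms(1)] coeff_map_\<tau>)
qed

lemma map_\<tau>_to_ac: "map_poly \<tau> (map_poly to_ac f) = map_poly to_ac f"
  by (rule poly_eqI) (simp add: coeff_map_\<tau> coeff_map_poly \<tau>_to_ac)

text \<open>The value at \<open>poly h x\<close> is read off from any representing \<open>h\<close>.
  Two representatives differ by a multiple of \<open>m\<close>, and the image of \<open>m\<close>
  under \<open>\<tau>\<close> vanishes at \<open>\<beta>\<close>, so the choice does not
  matter.\<close>

lemma extend_to_root: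
  assumes m: "minpoly x m" and \<beta>: "poly (map_poly \<tau> m) \<beta> = 0"
  obtains \<tau>' where "base_embedding (ring_adjoin S x) \<tau>'" "\<And>y. y \<in> S \<Longrightarrow> \<tau>' y = \<tau> y" "\<tau>' x = \<beta>"
proof -
  have mS: "poly_over S m" using m by (simp add: minpoly_def)
  define \<tau>' where "\<tau>' = (\<lambda>z. poly (map_poly \<tau> (SOME h. poly_over S h \<and> z = poly h x)) \<beta>)"
  have well: "poly (map_poly \<tau> h) \<beta> = poly (map_poly \<tau> g) \<beta>"
    if hg: "poly_over S h" "poly_over S g" "poly h x = poly g x" for h g
  proof -
    have "poly_over S (h - g)" "poly (h - g) x = 0" using hg by (simp_all add: poly_over_diff)
    then obtain q where q: "poly_over S q" "h - g = q * m" using minpoly_dvd[OF m] by metis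
    have "map_poly \<tau> h - map_poly \<tau> g = map_poly \<tau> q * map_poly \<tau> m"
      using q hg mS by (simp flip: map_poly_\<tau>_diff map_poly_\<tau>_mult)
    hence "poly (map_poly \<tau> h - map_poly \<tau> g) \<beta> = 0" using \<beta> by simp
    thus ?thesis by simp
  qed
  have \<tau>': "\<tau>' (poly h x) = poly (map_poly \<tau> h) \<beta>" if h: "poly_over S h" for h
  proof -
    have "poly_over S (SOME g. poly_over S g \<and> poly h x = poly g x) \<and>
        poly h x = poly (SOME g. poly_over S g \<and> poly h x = poly g x) x"
      by (rule someI[of _ h]) (use h in simp)
    thus ?thesis unfolding \<tau>'_def using h by (intro well) auto
  qed
  have const: "poly_over S [:y:]" if "y \<in> S" for y
    using that by (auto simp: poly_over_def coeff_pCons SD(2) split: nat.split)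
  have S': "\<tau>' y = \<tau> y" if "y \<in> S" for y
    using \<tau>'[OF const[OF that]] by (simp add: map_poly_pCons)
  have "poly_over S [:0, 1:]" by (auto simp: poly_over_def coeff_pCons SD(1,2) split: nat.split)
  hence x': "\<tau>' x = \<beta>" using \<tau>'[of "[:0, 1:]"] by (simp add: map_poly_pCons)
  have "base_embedding (ring_adjoin S x) \<tau>'"
    unfolding base_embedding_def
  proof (intro conjI ballI allI)
    fix y z assume "y \<in> ring_adjoin S x" "z \<in> ring_adjoin S x"
    then obtain h g where h: "poly_over S h" "y = poly h x" and g: "poly_over S g" "z = poly g x"
      by (auto simp: ring_adjoin_def poly_over_def)
    show "\<tau>' (y + z) = \<tau>' y + \<tau>' z"
      using \<tau>'[OF poly_over_add[OF h(1) g(1)]] \<tau>'[OF h(1)] \<tau>'[OF g(1)] h g by (simp add: map_poly_\<tau>_add)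
    show "\<tau>' (y * z) = \<tau>' y * \<tau>' z"
      using \<tau>'[OF poly_over_mult[OF h(1) g(1)]] \<tau>'[OF h(1)] \<tau>'[OF g(1)] h g by (simp add: map_poly_\<tau>_mult)
  next
    show "\<tau>' (to_ac a) = to_ac a" for a using S'[OF to_ac_mem] \<tau>_to_ac by simp
  qed
  thus thesis using that S' x' by blast
qed

lemma extend_adjoin:
  fixes x :: "'a alg_closure"
  obtains \<tau>' where "base_embedding (ring_adjoin S x) \<tau>'" "\<And>y. y \<in> S \<Longrightarrow> \<tau>' y = \<tau> y"
proof -
  obtain m where m: "minpoly x m" using minpoly_exists by blast
  have "0 < Polynomial.degree (map_poly \<tau> m)"
    using degree_minpoly_pos[OF m] m by (simp add: degree_map_\<tau> minpoly_def)
  then obtain \<beta> where "poly (map_poly \<tau> m) \<beta> = 0" using alg_closed_imp_poly_has_root by blast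
  then obtain \<tau>' where "base_embedding (ring_adjoin S x) \<tau>'" "\<And>y. y \<in> S \<Longrightarrow> \<tau>' y = \<tau> y"
    using extend_to_root[OF m] by blast
  thus thesis by (rule that)
qed

end

section \<open>Towers of simple adjunctions\<close>

primrec adjoin_list :: "'b::comm_ring_1 set \<Rightarrow> 'b list \<Rightarrow> 'b set" where
  "adjoin_list S [] = S"
| "adjoin_list S (x # xs) = adjoin_list (ring_adjoin S x) xs"

lemma adjoin_list_intermediate_field:
  "intermediate_field S \<Longrightarrow> intermediate_field (adjoin_list S xs)"
  by (induction xs arbitrary: S) (simp_all add: intermediate_field.ring_adjoin_field)

lemma adjoin_list_superset:
  "intermediate_field S \<Longrightarrow> S \<subseteq> adjoin_list S xs \<and> set xs \<subseteq> adjoin_list S xs"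
proof (induction xs arbitrary: S)
  case (Cons x xs)
  have "S \<subseteq> ring_adjoin S x" "x \<in> ring_adjoin S x"
    using ring_adjoin_subset ring_adjoin_mem intermediate_field.S(1)[OF Cons.prems] by blast+
  thus ?case using Cons.IH[OF intermediate_field.ring_adjoin_field[OF Cons.prems, of x]] by auto
qed simp

lemma adjoin_list_least:
  "subring_set T \<Longrightarrow> S \<subseteq> T \<Longrightarrow> set xs \<subseteq> T \<Longrightarrow> adjoin_list S xs \<subseteq> T"
  by (induction xs arbitrary: S) (simp_all add: ring_adjoin_least)

lemma embedding_adjoin_list:
  assumes "intermediate_field S" "base_embedding S \<tau>"
  shows "\<exists>\<tau>'. base_embedding (adjoin_list S xs) \<tau>' \<and> (\<forall>y\<in>S. \<tau>' y = \<tau> y)"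
  using assms
proof (induction xs arbitrary: S \<tau>)
  case (Cons x xs)
  interpret embedding S \<tau>
    by (intro embedding.intro embedding_axioms.intro Cons.prems)
  obtain \<tau>1 where \<tau>1: "base_embedding (ring_adjoin S x) \<tau>1" "\<And>y. y \<in> S \<Longrightarrow> \<tau>1 y = \<tau> y"
    using extend_adjoin[of x] by blast
  obtain \<tau>2 where \<tau>2: "base_embedding (adjoin_list (ring_adjoin S x) xs) \<tau>2"
    "\<forall>y\<in>ring_adjoin S x. \<tau>2 y = \<tau>1 y"
    using Cons.IH[OF ring_adjoin_field \<tau>1(1)] by blast
  have "\<forall>y\<in>S. \<tau>2 y = \<tau> y"
  proof
    fix y assume y: "y \<in> S"
    hence "y \<in> ring_adjoin S x" using ring_adjoin_subset[OF S(1)] by (rule rev_subsetD)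
    thus "\<tau>2 y = \<tau> y" using \<tau>2(2) \<tau>1(2)[OF y] by simp
  qed
  thus ?case using \<tau>2(1) by auto
qed auto

lemma card_roots_squarefree:
  fixes p :: "'b::alg_closed_field poly"
  assumes "p \<noteq> 0" "\<And>a. \<not> [:- a, 1:] ^ 2 dvd p"
  shows "card {x. poly p x = 0} = Polynomial.degree p"
  using assms
proof (induction "Polynomial.degree p" arbitrary: p)
  case 0
  then obtain c where "p = [:c:]" using degree_eq_zeroE[of p] by auto
  thus ?case using 0 by simp
next
  case (Suc d)
  have "0 < Polynomial.degree p" using Suc.hyps(2) by simp
  then obtain a where a: "poly p a = 0" using alg_closed_imp_poly_has_root by blast
  then obtain q where q: "p = [:- a, 1:] * q" by (auto simp: poly_eq_0_iff_dvd)
  have "q \<noteq> 0" using Suc.prems(1) q by auto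
  have deg: "Polynomial.degree p = Suc (Polynomial.degree q)"
    unfolding q using \<open>q \<noteq> 0\<close> by (subst degree_mult_eq) auto
  have "poly q a \<noteq> 0"
  proof
    assume "poly q a = 0"
    then obtain r where "q = [:- a, 1:] * r" by (auto simp: poly_eq_0_iff_dvd)
    hence "p = [:- a, 1:] ^ 2 * r" using q by (simp only: power2_eq_square mult.assoc)
    hence "[:- a, 1:] ^ 2 dvd p" by (rule dvdI)
    thus False using Suc.prems(2)[of a] by contradiction
  qed
  moreover have "{x. poly p x = 0} = insert a {x. poly q x = 0}" unfolding q by auto
  moreover have "finite {x. poly q x = 0}" using \<open>q \<noteq> 0\<close> by (rule poly_roots_finite)
  moreover have "card {x. poly q x = 0} = Polynomial.degree q"
  proof (rule Suc.hyps(1))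
    show "d = Polynomial.degree q" using deg Suc.hyps(2) by simp
    show "\<not> [:- b, 1:] ^ 2 dvd q" for b
      using Suc.prems(2)[of b] dvd_mult[of "[:- b, 1:] ^ 2" q "[:- a, 1:]"] by (simp only: q) blast
  qed fact
  ultimately show ?case using deg by simp
qed

text \<open>Descent along the tower. By induction \<open>y\<close> lies in the field generated by
  \<open>x\<close> over \<open>S\<close>, so \<open>y = poly h x\<close> with \<open>h\<close> of
  smaller degree than the minimal polynomial \<open>m\<close>. Each root of \<open>m\<close> is the
  image of \<open>x\<close> under an embedding that extends to the whole tower and fixes
  \<open>y\<close>; hence \<open>h\<close> takes the value \<open>y\<close> at all roots of
  \<open>m\<close>. By separability these are as many as the degree of \<open>m\<close>, so
  \<open>h\<close> is constant.\<close>

lemma fixed_by_embeddings: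
  assumes "intermediate_field S"
    and sep: "\<And>x. x \<in> set xs \<Longrightarrow> poly (map_poly to_ac f) x = 0" "f \<noteq> 0"
      "\<And>a. \<not> [:- a, 1:] ^ 2 dvd map_poly to_ac f"
    and y: "y \<in> adjoin_list S xs"
    and fix_y: "\<And>\<tau>. base_embedding (adjoin_list S xs) \<tau> \<Longrightarrow> (\<forall>z\<in>S. \<tau> z = z) \<Longrightarrow> \<tau> y = y"
  shows "y \<in> S"
  using assms
proof (induction xs arbitrary: S)
  case (Cons x xs)
  define \<iota> :: "'a alg_closure \<Rightarrow> 'a alg_closure" where "\<iota> = (\<lambda>z. z)"
  have \<iota>: "\<iota> z = z" for z by (simp add: \<iota>_def)
  interpret embedding S \<iota>
    by (intro embedding.intro embedding_axioms.intro Cons.prems(1)) (simp add: base_embedding_def \<iota>)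
  have "S \<subseteq> ring_adjoin S x" using S(1) by (rule ring_adjoin_subset)
  have "y \<in> ring_adjoin S x"
  proof (rule Cons.IH[OF ring_adjoin_field])
    show "poly (map_poly to_ac f) z = 0" if "z \<in> set xs" for z using Cons.prems(2)[of z] that by simp
    show "y \<in> adjoin_list (ring_adjoin S x) xs" using Cons.prems(5) by simp
    show "\<tau> y = y" if "base_embedding (adjoin_list (ring_adjoin S x) xs) \<tau>" "\<forall>z\<in>ring_adjoin S x. \<tau> z = z" for \<tau>
      using Cons.prems(6)[of \<tau>] that \<open>S \<subseteq> ring_adjoin S x\<close> by auto
  qed (fact Cons.prems)+
  obtain m where m: "minpoly x m" using minpoly_exists by blast
  obtain h where h: "poly_over S h" "y = poly h x" "Polynomial.degree h < Polynomial.degree m"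
    using ring_adjoin_reduced[OF m \<open>y \<in> ring_adjoin S x\<close>] .
  have m0: "m \<noteq> 0" using m by (simp add: minpoly_def)
  have "poly h \<beta> = y" if \<beta>: "poly m \<beta> = 0" for \<beta>
  proof -
    have id: "map_poly \<iota> p = p" for p :: "'a alg_closure poly"
      by (rule poly_eqI) (simp add: coeff_map_poly \<iota>)
    have \<beta>': "poly (map_poly \<iota> m) \<beta> = 0" unfolding id by (rule \<beta>)
    obtain \<tau>1 where \<tau>1: "base_embedding (ring_adjoin S x) \<tau>1" "\<And>z. z \<in> S \<Longrightarrow> \<tau>1 z = z" "\<tau>1 x = \<beta>"
      using extend_to_root[OF m \<beta>'] unfolding \<iota> by blast
    interpret \<tau>1: embedding "ring_adjoin S x" \<tau>1
      by (intro embedding.intro embedding_axioms.intro ring_adjoin_field \<tau>1(1))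
    obtain \<tau>2 where \<tau>2: "base_embedding (adjoin_list (ring_adjoin S x) xs) \<tau>2"
      "\<forall>z\<in>ring_adjoin S x. \<tau>2 z = \<tau>1 z"
      using embedding_adjoin_list[OF ring_adjoin_field \<tau>1(1)] by blast
    have fix_S: "\<forall>z\<in>S. \<tau>2 z = z"
    proof
      fix z assume "z \<in> S"
      thus "\<tau>2 z = z" using \<tau>2(2) \<tau>1(2)[of z] \<open>S \<subseteq> ring_adjoin S x\<close> by (metis subsetD)
    qed
    have "base_embedding (adjoin_list S (x # xs)) \<tau>2" unfolding adjoin_list.simps by (rule \<tau>2(1))
    from Cons.prems(6)[OF this fix_S] have "\<tau>1 y = y" using \<tau>2(2) \<open>y \<in> ring_adjoin S x\<close> by metis
    hence "y = \<tau>1 (poly h x)" by (simp only: h(2))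
    also have "\<dots> = poly (map_poly \<tau>1 h) (\<tau>1 x)"
      using h(1) \<open>S \<subseteq> ring_adjoin S x\<close> ring_adjoin_mem[OF S(1)]
      by (intro \<tau>1.\<tau>_poly) (auto simp: poly_over_def)
    also have "map_poly \<tau>1 h = h"
      using h(1) \<tau>1(2) by (intro poly_eqI) (simp add: \<tau>1.coeff_map_\<tau> poly_over_def)
    finally show ?thesis using \<tau>1(3) by simp
  qed
  hence sub: "{\<beta>. poly m \<beta> = 0} \<subseteq> {\<beta>. poly (h - [:y:]) \<beta> = 0}" by auto
  obtain q where q: "map_poly to_ac f = q * m"
    using minpoly_dvd[OF m poly_over_map_to_ac[OF S(2)] Cons.prems(2)] list.set_intros(1) by metis
  have "card {\<beta>. poly m \<beta> = 0} = Polynomial.degree m"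
  proof (rule card_roots_squarefree[OF m0])
    show "\<not> [:- a, 1:] ^ 2 dvd m" for a
      using Cons.prems(4)[of a] dvd_mult[of "[:- a, 1:] ^ 2" m q] by (simp only: q) blast
  qed
  have "h - [:y:] = 0"
  proof (rule ccontr)
    assume nz: "h - [:y:] \<noteq> 0"
    have "Polynomial.degree m \<le> card {\<beta>. poly (h - [:y:]) \<beta> = 0}"
      using card_mono[OF poly_roots_finite[OF nz] sub] \<open>card {\<beta>. poly m \<beta> = 0} = _\<close> by simp
    also have "\<dots> \<le> Polynomial.degree (h - [:y:])" using nz by (rule card_poly_roots_bound)
    also have "\<dots> \<le> Polynomial.degree h"
      using degree_diff_le[of h "Polynomial.degree h" "[:y:]"] by simp
    finally show False using h(3) by simp
  qed
  hence "y = Polynomial.coeff h 0" by simp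
  thus ?case using h(1) by (simp add: poly_over_def)
qed simp

lemma map_poly_to_ac_add: "map_poly to_ac (p + q) = map_poly to_ac p + map_poly to_ac q"
  by (rule poly_eqI) (simp add: coeff_map_poly)

lemma map_poly_to_ac_pcompose:
  "map_poly to_ac (pcompose p q) = pcompose (map_poly to_ac p) (map_poly to_ac q)"
  by (induction p) (simp_all add: map_poly_pCons pcompose_pCons map_poly_to_ac_add map_poly_to_ac_mult)

lemma intermediate_field_base_field: "intermediate_field base_field"
  using subring_set_base_field by unfold_locales auto

section \<open>Weak approximation\<close>

text \<open>Automorphisms carry information only on the splitting field, so a conjugate of a norm is
  a norm only there.\<close>

definition norm_on :: "'a::field alg_closure set \<Rightarrow> ('a alg_closure \<Rightarrow> real) \<Rightarrow> bool" where
  "norm_on L M \<longleftrightarrow> (\<forall>x\<in>L. 0 \<le> M x \<and> (M x = 0 \<longleftrightarrow> x = 0)) \<and>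
     (\<forall>x\<in>L. \<forall>y\<in>L. M (x * y) = M x * M y \<and> M (x + y) \<le> max (M x) (M y))"

lemma norm_on_nonarchimedean: "nonarchimedean N \<Longrightarrow> norm_on L N"
  by (auto simp: norm_on_def nonarchimedean_def)

locale normed_field = intermediate_field S for S :: "'a::field alg_closure set" +
  fixes M :: "'a alg_closure \<Rightarrow> real"
  assumes M: "norm_on S M"
begin

lemma M_nonneg: "x \<in> S \<Longrightarrow> 0 \<le> M x" and M_0_iff: "x \<in> S \<Longrightarrow> M x = 0 \<longleftrightarrow> x = 0"
  and M_mult: "x \<in> S \<Longrightarrow> y \<in> S \<Longrightarrow> M (x * y) = M x * M y"
  and M_add: "x \<in> S \<Longrightarrow> y \<in> S \<Longrightarrow> M (x + y) \<le> max (M x) (M y)"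
  using M by (auto simp: norm_on_def)

lemma M_pos: "x \<in> S \<Longrightarrow> x \<noteq> 0 \<Longrightarrow> 0 < M x"
  using M_nonneg[of x] M_0_iff[of x] by linarith

lemma M_1: "M 1 = 1"
  using M_mult[of 1 1] M_0_iff[of 1] SD(1) by simp

lemma M_power: "x \<in> S \<Longrightarrow> M (x ^ n) = M x ^ n"
  by (induction n) (simp_all add: M_1 M_mult SD(7))

lemma M_inverse: "x \<in> S \<Longrightarrow> M (inverse x) = inverse (M x)"
  using M_mult[of x "inverse x"] inverse_mem[of x] M_1 M_0_iff[of x]
  by (cases "x = 0") (simp_all add: inverse_unique)

lemma M_minus: "x \<in> S \<Longrightarrow> M (- x) = M x"
proof -
  have "M (- 1) * M (- 1) = 1" using M_mult[of "- 1" "- 1"] M_1 SD(5)[OF SD(1)] by simp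
  hence "M (- 1) = 1" using M_nonneg[OF SD(5)[OF SD(1)]] by (simp add: square_eq_1_iff)
  thus "x \<in> S \<Longrightarrow> M (- x) = M x" using M_mult[of "- 1" x] SD(5)[OF SD(1)] by simp
qed

lemma M_add_eq:
  assumes "x \<in> S" "y \<in> S" "M y < M x"
  shows "M (x + y) = M x"
proof (rule antisym)
  show "M (x + y) \<le> M x" using M_add[OF assms(1,2)] assms(3) by simp
  have "M x \<le> max (M (x + y)) (M y)"
    using M_add[OF SD(6)[OF assms(1,2)] SD(5)[OF assms(2)]] M_minus[OF assms(2)] by simp
  thus "M x \<le> M (x + y)" using assms(3) by simp
qed

end

text \<open>Let \<open>M x < N x\<close>. A power \<open>x ^ k\<close> opens a gap larger than 1
  between the logarithms of the two values, so an integer \<open>m\<close> falls strictly between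
  them. Scaling by an element on which both norms are \<open>2 powr (- m)\<close> puts 1 in between.
  For the opposite inequality \<open>inverse x\<close> serves.\<close>

lemma exists_separating_pair:
  assumes S: "intermediate_field S" and N: "norm_on S N" and M: "norm_on S M"
    and scale: "\<And>m::int. \<exists>c\<in>S. N c = 2 powr real_of_int m \<and> M c = 2 powr real_of_int m"
    and ne: "x \<in> S" "N x \<noteq> M x"
  shows "\<exists>z\<in>S. 1 < N z \<and> M z < 1"
proof -
  interpret N: normed_field S N by (intro normed_field.intro normed_field_axioms.intro S N)
  interpret M: normed_field S M by (intro normed_field.intro normed_field_axioms.intro S M)
  have main: "\<exists>z\<in>S. 1 < N z \<and> M z < 1" if x: "x \<in> S" "M x < N x" "x \<noteq> 0" for x
  proof -
    define A B where "A = log 2 (N x)" and "B = log 2 (M x)"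
    have pos: "0 < N x" "0 < M x" using x N.M_pos M.M_pos by blast+
    have AB: "B < A" using pos x(2) by (simp add: A_def B_def)
    obtain k :: nat where k: "1 < real k * (A - B)" using AB by (metis diff_gt_0_iff_gt reals_Archimedean3)
    define m where "m = \<lfloor>real k * B\<rfloor> + 1"
    have m: "real k * B < real_of_int m" "real_of_int m < real k * A"
      using k unfolding m_def by (linarith, simp add: algebra_simps) linarith
    obtain c where c: "c \<in> S" "N c = 2 powr real_of_int (- m)" "M c = 2 powr real_of_int (- m)"
      using scale[of "- m"] by blast
    have Nx: "N x ^ k = 2 powr (real k * A)"
      using pos by (simp add: A_def powr_powr[symmetric] powr_realpow mult.commute[of "real k"])
    have Mx: "M x ^ k = 2 powr (real k * B)"
      using pos by (simp add: B_def powr_powr[symmetric] powr_realpow mult.commute[of "real k"])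
    have "N (x ^ k * c) = 2 powr (real k * A - real_of_int m)"
      using x c Nx by (simp add: N.M_mult N.M_power N.SD(7) powr_diff powr_minus field_simps)
    moreover have "M (x ^ k * c) = 2 powr (real k * B - real_of_int m)"
      using x c Mx by (simp add: M.M_mult M.M_power N.SD(7) powr_diff powr_minus field_simps)
    ultimately have "1 < N (x ^ k * c)" "M (x ^ k * c) < 1"
      using m powr_less_mono[of "real k * B - real_of_int m" 0 2] powr_less_mono[of 0 "real k * A - real_of_int m" 2]
      by simp_all
    moreover have "x ^ k * c \<in> S" using x(1) c(1) by (intro N.SD(4,7))
    ultimately show ?thesis by blast
  qed
  have "x \<noteq> 0" using ne N.M_0_iff[of 0] M.M_0_iff[of 0] N.SD(2) by auto
  show ?thesis
  proof (cases "M x < N x")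
    case True
    thus ?thesis using main ne(1) \<open>x \<noteq> 0\<close> by blast
  next
    case False
    hence "N x < M x" using ne(2) by simp
    hence "M (inverse x) < N (inverse x)"
      using N.M_inverse[OF ne(1)] M.M_inverse[OF ne(1)] N.M_pos[OF ne(1) \<open>x \<noteq> 0\<close>] by simp
    thus ?thesis using main[OF N.inverse_mem[OF ne(1)]] \<open>x \<noteq> 0\<close> by simp
  qed
qed

lemma eventually_power_mult_less_1:
  fixes a b :: real
  assumes "0 \<le> a" "a < 1"
  shows "eventually (\<lambda>k. b * a ^ k < 1) sequentially"
proof -
  have "(\<lambda>k. b * a ^ k) \<longlonglongrightarrow> b * 0"
    using assms by (intro tendsto_mult LIMSEQ_realpow_zero tendsto_const)
  thus ?thesis by (intro order_tendstoD(2)) auto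
qed

text \<open>Let \<open>z\<close> work for \<open>I\<close> and let \<open>w\<close> separate the new
  norm. If \<open>z\<close> is small there, it works already; if it has norm 1,
  \<open>z ^ k * w\<close> works. If it is large, \<open>z ^ k\<close> is replaced by
  \<open>z ^ k / (z ^ k + 1)\<close>, which has norm 1 where \<open>z\<close> is large and the norm
  of \<open>z ^ k\<close> where \<open>z\<close> is small.\<close>

lemma exists_separating:
  assumes S: "intermediate_field S" and N: "norm_on S N" and I: "finite I"
    and M: "\<And>i. i \<in> I \<Longrightarrow> norm_on S (M i)"
    and scale: "\<And>m::int. \<exists>c\<in>S. N c = 2 powr real_of_int m \<and> (\<forall>i\<in>I. M i c = 2 powr real_of_int m)"
    and ne: "\<And>i. i \<in> I \<Longrightarrow> \<exists>x\<in>S. N x \<noteq> M i x"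
  shows "\<exists>z\<in>S. 1 < N z \<and> (\<forall>i\<in>I. M i z < 1)"
  using I M scale ne
proof (induction I rule: finite_induct)
  case empty
  obtain c where "c \<in> S" "N c = 2 powr real_of_int 1" using empty.prems(2)[of 1] by blast
  thus ?case by (intro bexI[of _ c]) auto
next
  case (insert i I)
  interpret N: normed_field S N by (intro normed_field.intro normed_field_axioms.intro S N)
  interpret Mi: normed_field S "M i"
    by (intro normed_field.intro normed_field_axioms.intro S insert.prems(1)) simp
  have norm_j: "normed_field S (M j)" if "j \<in> I" for j
    using that by (intro normed_field.intro normed_field_axioms.intro S insert.prems(1)) simp
  have "\<exists>z\<in>S. 1 < N z \<and> (\<forall>j\<in>I. M j z < 1)"
  proof (rule insert.IH)
    show "\<exists>c\<in>S. N c = 2 powr real_of_int m \<and> (\<forall>j\<in>I. M j c = 2 powr real_of_int m)" for m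
      using insert.prems(2)[of m] by auto
  qed (use insert.prems(1,3) in auto)
  then obtain z where z: "z \<in> S" "1 < N z" "\<And>j. j \<in> I \<Longrightarrow> M j z < 1" by blast
  obtain x where x: "x \<in> S" "N x \<noteq> M i x" using insert.prems(3)[of i] by auto
  have "\<exists>z\<in>S. 1 < N z \<and> M i z < 1"
  proof (rule exists_separating_pair[OF S N Mi.M _ x])
    show "\<exists>c\<in>S. N c = 2 powr real_of_int m \<and> M i c = 2 powr real_of_int m" for m
      using insert.prems(2)[of m] by auto
  qed
  then obtain w where w: "w \<in> S" "1 < N w" "M i w < 1" by blast
  have "eventually (\<lambda>k. \<forall>j\<in>I. M j w * M j z ^ k < 1) sequentially"
    using insert.hyps(1)
  proof (intro eventually_ball_finite ballI)
    fix j assume j: "j \<in> I"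
    show "eventually (\<lambda>k. M j w * M j z ^ k < 1) sequentially"
      using normed_field.M_nonneg[OF norm_j[OF j] z(1)] z(3)[OF j] by (rule eventually_power_mult_less_1)
  qed
  hence "eventually (\<lambda>k. 0 < k \<and> (\<forall>j\<in>I. M j w * M j z ^ k < 1)) sequentially"
    using eventually_gt_at_top[of 0] by eventually_elim auto
  then obtain k where k: "0 < k" "\<And>j. j \<in> I \<Longrightarrow> M j w * M j z ^ k < 1"
    unfolding eventually_sequentially by blast
  have zk: "z ^ k \<in> S" using z(1) by (rule N.SD(7))
  have Nzk: "1 < N (z ^ k)" using z k(1) by (simp add: N.M_power one_less_power)
  have Mzk: "M j (z ^ k) = M j z ^ k" if "j \<in> I" for j
    using normed_field.M_power[OF norm_j[OF that] z(1)] .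
  consider "M i z < 1" | "M i z = 1" | "1 < M i z" by linarith
  thus ?case
  proof cases
    case 1
    thus ?thesis using z by auto
  next
    case 2
    have "1 < N (z ^ k * w)"
      using less_1_mult[OF Nzk w(2)] by (simp add: N.M_mult zk w(1))
    moreover have "M i (z ^ k * w) < 1" using w 2 by (simp add: Mi.M_mult zk Mi.M_power z(1))
    moreover have "M j (z ^ k * w) < 1" if "j \<in> I" for j
      using k(2)[OF that] normed_field.M_mult[OF norm_j[OF that] zk w(1)] Mzk[OF that] by (simp add: mult.commute)
    ultimately show ?thesis using N.SD(4)[OF zk w(1)] by blast
  next
    case 3
    define u where "u = inverse (z ^ k + 1)"
    have z1: "z ^ k + 1 \<in> S" using zk N.SD(1) by (intro N.SD(6))
    have u: "u \<in> S" unfolding u_def using z1 by (rule N.inverse_mem)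
    have "N (z ^ k + 1) = N (z ^ k)" using Nzk N.M_1 by (intro N.M_add_eq zk N.SD(1)) simp
    hence Nu: "N (z ^ k * u) = 1" using Nzk by (simp add: N.M_mult zk u) (simp add: u_def N.M_inverse z1)
    have "1 < M i (z ^ k)" using 3 k(1) z(1) by (simp add: Mi.M_power one_less_power)
    moreover from this have "M i (z ^ k + 1) = M i (z ^ k)" using Mi.M_1 by (intro Mi.M_add_eq zk N.SD(1)) simp
    ultimately have Mu: "M i (z ^ k * u) = 1" by (simp add: Mi.M_mult zk u) (simp add: u_def Mi.M_inverse z1)
    have Mj: "M j (z ^ k * u) = M j z ^ k" if j: "j \<in> I" for j
    proof -
      interpret Mj: normed_field S "M j" using norm_j[OF j] .
      have "M j z ^ k < 1" using z(3)[OF j] Mj.M_nonneg[OF z(1)] k(1) by (simp add: power_less_one_iff)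
      hence "M j (1 + z ^ k) = 1" using Mj.M_1 Mzk[OF j] Mj.M_add_eq[OF N.SD(1) zk] by simp
      hence "M j (z ^ k + 1) = 1" by (simp only: add.commute)
      hence "M j u = 1" by (simp add: u_def Mj.M_inverse[OF z1])
      thus ?thesis using Mzk[OF j] by (simp add: Mj.M_mult zk u)
    qed
    have zu: "z ^ k * u \<in> S" using zk u by (rule N.SD(4))
    have "1 < N (z ^ k * u * w)" using w Nu by (simp add: N.M_mult[OF zu w(1)])
    moreover have "M i (z ^ k * u * w) < 1" using w Mu by (simp add: Mi.M_mult[OF zu w(1)])
    moreover have "M j (z ^ k * u * w) < 1" if "j \<in> I" for j
      using k(2)[OF that] normed_field.M_mult[OF norm_j[OF that] zu w(1)] Mj[OF that] by (simp add: mult.commute)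
    ultimately show ?thesis using N.SD(4)[OF zu w(1)] by blast
  qed
qed

lemma weak_approximation:
  assumes S: "intermediate_field S" and N: "norm_on S N" and I: "finite I"
    and M: "\<And>i. i \<in> I \<Longrightarrow> norm_on S (M i)"
    and scale: "\<And>m::int. \<exists>c\<in>S. N c = 2 powr real_of_int m \<and> (\<forall>i\<in>I. M i c = 2 powr real_of_int m)"
    and ne: "\<And>i. i \<in> I \<Longrightarrow> \<exists>x\<in>S. N x \<noteq> M i x"
    and \<beta>: "\<beta> \<in> S" "\<beta> \<noteq> 0"
  shows "\<exists>y\<in>S. N y = N \<beta> \<and> (\<forall>i\<in>I. M i y = 1)"
proof -
  interpret N: normed_field S N by (intro normed_field.intro normed_field_axioms.intro S N)
  have norm_i: "normed_field S (M i)" if "i \<in> I" for i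
    using that by (intro normed_field.intro normed_field_axioms.intro S M)
  obtain z where z: "z \<in> S" "1 < N z" "\<And>i. i \<in> I \<Longrightarrow> M i z < 1"
    using exists_separating[OF S N I M scale ne] by blast
  have N\<beta>: "0 < N \<beta>" using N.M_pos[OF \<beta>] .
  have "eventually (\<lambda>k. inverse (N \<beta>) * inverse (N z) ^ k < 1) sequentially"
    using z(2) by (intro eventually_power_mult_less_1) (simp_all add: inverse_less_1_iff)
  moreover have "eventually (\<lambda>k. \<forall>i\<in>I. M i \<beta> * M i z ^ k < 1) sequentially"
    using I
  proof (intro eventually_ball_finite ballI)
    fix i assume i: "i \<in> I"
    show "eventually (\<lambda>k. M i \<beta> * M i z ^ k < 1) sequentially"
      using normed_field.M_nonneg[OF norm_i[OF i] z(1)] z(3)[OF i] by (rule eventually_power_mult_less_1)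
  qed
  ultimately have "eventually (\<lambda>k. 0 < k \<and> inverse (N \<beta>) * inverse (N z) ^ k < 1 \<and>
      (\<forall>i\<in>I. M i \<beta> * M i z ^ k < 1)) sequentially"
    using eventually_gt_at_top[of 0] by eventually_elim auto
  then obtain k where k: "0 < k" "inverse (N \<beta>) * inverse (N z) ^ k < 1"
    "\<And>i. i \<in> I \<Longrightarrow> M i \<beta> * M i z ^ k < 1"
    unfolding eventually_sequentially by blast
  \<comment> \<open>Under \<open>N\<close> the terms with \<open>z ^ k\<close> dominate numerator
    and denominator, and their quotient is \<open>\<beta>\<close>; under every \<open>M i\<close>
    the ones dominate, with quotient 1. Only norms are prescribed, so no closeness to given elements
    has to be arranged.\<close>
  define y where "y = (\<beta> * z ^ k + 1) * inverse (z ^ k + 1)"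
  have zk: "z ^ k \<in> S" using z(1) by (rule N.SD(7))
  have \<beta>zk: "\<beta> * z ^ k \<in> S" using \<beta>(1) zk by (rule N.SD(4))
  have S1: "\<beta> * z ^ k + 1 \<in> S" "z ^ k + 1 \<in> S" using zk \<beta>zk N.SD(1) by (auto intro: N.SD(6))
  have inv: "inverse (z ^ k + 1) \<in> S" using S1(2) by (rule N.inverse_mem)
  have yS: "y \<in> S" unfolding y_def using S1(1) inv by (rule N.SD(4))
  have Nzk: "1 < N (z ^ k)" using z k(1) by (simp add: N.M_power one_less_power)
  have N1: "N (z ^ k + 1) = N (z ^ k)" using Nzk N.M_1 by (intro N.M_add_eq zk N.SD(1)) simp
  have "1 < N \<beta> * N (z ^ k)"
  proof -
    have "inverse (N \<beta> * N (z ^ k)) < 1" using k(2) z(1) by (simp add: N.M_power power_inverse)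
    moreover have "0 < N \<beta> * N (z ^ k)" using N\<beta> Nzk by simp
    ultimately show ?thesis by (auto simp only: inverse_less_1_iff)
  qed
  hence "N (\<beta> * z ^ k + 1) = N \<beta> * N (z ^ k)"
    using N.M_1 N.M_mult[OF \<beta>(1) zk] N.M_add_eq[OF \<beta>zk N.SD(1)] by simp
  hence "N y = N \<beta>"
    unfolding y_def N.M_mult[OF S1(1) inv] N.M_inverse[OF S1(2)] N1 using Nzk by simp
  moreover have "M i y = 1" if i: "i \<in> I" for i
  proof -
    interpret Mi: normed_field S "M i" using norm_i[OF i] .
    have Mzk: "M i (z ^ k) = M i z ^ k" using z(1) by (rule Mi.M_power)
    have "M i z ^ k < 1" using z(3)[OF i] Mi.M_nonneg[OF z(1)] k(1) by (simp add: power_less_one_iff)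
    hence "M i (1 + z ^ k) = 1" using Mi.M_1 Mzk Mi.M_add_eq[OF N.SD(1) zk] by simp
    moreover have "M i (1 + \<beta> * z ^ k) = 1"
      using Mi.M_1 Mzk Mi.M_add_eq[OF N.SD(1) \<beta>zk] k(3)[OF i] Mi.M_mult[OF \<beta>(1) zk] by simp
    ultimately show ?thesis
      unfolding y_def Mi.M_mult[OF S1(1) inv] Mi.M_inverse[OF S1(2)] by (simp add: add.commute)
  qed
  ultimately show ?thesis using yS by blast
qed

section \<open>The Galois group of the splitting field\<close>

lemma ring_of_type_algebra_simps:
  "carrier ring_of_type_algebra = UNIV" "x \<otimes>\<^bsub>ring_of_type_algebra\<^esub> y = x * y"
  "x \<oplus>\<^bsub>ring_of_type_algebra\<^esub> y = x + y" "\<one>\<^bsub>ring_of_type_algebra\<^esub> = 1" "\<zero>\<^bsub>ring_of_type_algebra\<^esub> = 0"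
  by (simp_all add: ring_of_type_algebra_def)

lemma ring_of_type_algebra_inverse:
  fixes x :: "'b::field"
  shows "\<ominus>\<^bsub>ring_of_type_algebra\<^esub> x = - x"
    and "x \<noteq> 0 \<Longrightarrow> inv\<^bsub>ring_of_type_algebra\<^esub> x = inverse x"
proof -
  interpret R: Ring.field "ring_of_type_algebra :: 'b ring" by (rule field_from_type_algebra)
  show "\<ominus>\<^bsub>ring_of_type_algebra\<^esub> x = - x"
    by (rule R.sum_zero_eq_neg[symmetric]) (simp_all add: ring_of_type_algebra_simps)
  show "inv\<^bsub>ring_of_type_algebra\<^esub> x = inverse x" if "x \<noteq> 0"
    by (rule R.comm_inv_char) (simp_all add: ring_of_type_algebra_simps that)
qed

text \<open>In an algebraic extension inverses come for free, so adjoining the roots one by one as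
  rings already yields the generated field. In this form inductions along the tower apply to
  it.\<close>

lemma splitting_field_eq:
  assumes rs: "set rs = ac_roots f"
  shows "splitting_field f = adjoin_list base_field rs"
proof
  interpret L: intermediate_field "adjoin_list base_field rs"
    by (rule adjoin_list_intermediate_field[OF intermediate_field_base_field])
  have sup: "base_field \<subseteq> adjoin_list base_field rs" "ac_roots f \<subseteq> adjoin_list base_field rs"
    using adjoin_list_superset[OF intermediate_field_base_field, of rs] rs by auto
  show "splitting_field f \<subseteq> adjoin_list base_field rs"
  proof
    fix x assume "x \<in> splitting_field f"
    thus "x \<in> adjoin_list base_field rs"
      unfolding splitting_field_def
    proof (induction rule: generate_field.induct)
      case one
      show ?case using L.SD(1) by (simp only: ring_of_type_algebra_simps)
    next
      case (incl h)
      thus ?case using sup by blast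
    next
      case (a_inv h)
      thus ?case using L.SD(5) by (simp only: ring_of_type_algebra_inverse)
    next
      case (m_inv h)
      have "h \<noteq> 0" using m_inv.hyps(2) by (simp only: ring_of_type_algebra_simps not_False_eq_True)
      show ?case
        unfolding ring_of_type_algebra_inverse(2)[OF \<open>h \<noteq> 0\<close>] using m_inv.IH by (rule L.inverse_mem)
    next
      case (eng_add h1 h2)
      thus ?case using L.SD(6) by (simp only: ring_of_type_algebra_simps)
    next
      case (eng_mult h1 h2)
      thus ?case using L.SD(4) by (simp only: ring_of_type_algebra_simps)
    qed
  qed
  show "adjoin_list base_field rs \<subseteq> splitting_field f"
  proof (rule adjoin_list_least)
    have neg: "- x \<in> splitting_field f" if "x \<in> splitting_field f" for x
      using generate_field.a_inv[of x ring_of_type_algebra] that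
      by (simp only: splitting_field_def ring_of_type_algebra_inverse)
    have add: "x + y \<in> splitting_field f" and mult: "x * y \<in> splitting_field f"
      if "x \<in> splitting_field f" "y \<in> splitting_field f" for x y
      using generate_field.eng_add[of x ring_of_type_algebra _ y]
        generate_field.eng_mult[of x ring_of_type_algebra _ y] that
      by (simp_all only: splitting_field_def ring_of_type_algebra_simps)
    have one: "1 \<in> splitting_field f"
      using generate_field.one[of ring_of_type_algebra] by (simp only: splitting_field_def ring_of_type_algebra_simps)
    have "x - y \<in> splitting_field f" if "x \<in> splitting_field f" "y \<in> splitting_field f" for x y
      using add[OF that(1) neg[OF that(2)]] by simp
    thus "subring_set (splitting_field f)" using one mult by (simp add: subring_set_def)
    show "base_field \<subseteq> splitting_field f" "set rs \<subseteq> splitting_field f"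
      unfolding splitting_field_def rs by (auto intro: generate_field.incl)
  qed
qed

lemma finite_ac_roots: "f \<noteq> 0 \<Longrightarrow> finite (ac_roots f)"
  unfolding ac_roots_def using map_poly_to_ac_eq_iff[of f 0] by (intro poly_roots_finite) simp

text \<open>Both factors have coefficients in the base field, so the factorization can be pulled
  back along \<open>to_ac\<close>, where irreducibility applies.\<close>

lemma irreducible_eq_smult_minpoly:
  fixes f :: "'a::field poly"
  assumes irr: "Factorial_Ring.irreducible f" and x: "x \<in> ac_roots f"
    and m: "intermediate_field.minpoly base_field x m"
  shows "\<exists>c. c \<noteq> 0 \<and> map_poly to_ac f = Polynomial.smult c m"
proof -
  interpret K: intermediate_field "base_field :: 'a alg_closure set" by (rule intermediate_field_base_field)
  obtain q where q: "poly_over base_field q" "map_poly to_ac f = q * m"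
    using K.minpoly_dvd[OF m poly_over_map_to_ac[OF order_refl]] x unfolding ac_roots_def by blast
  obtain q0 where q0: "q = map_poly to_ac q0" using poly_over_base_fieldE[OF q(1)] .
  have "poly_over base_field m" using m by (simp add: K.minpoly_def)
  then obtain m0 where m0: "m = map_poly to_ac m0" by (rule poly_over_base_fieldE)
  have "f = q0 * m0" using q(2) unfolding q0 m0 map_poly_to_ac_mult[symmetric] map_poly_to_ac_eq_iff .
  moreover have "\<not> m0 dvd 1" using K.degree_minpoly_pos[OF m] m0 by (auto simp: is_unit_poly_iff)
  ultimately have "q0 dvd 1" using Factorial_Ring.irreducibleD[OF irr] by blast
  then obtain c where c: "q0 = [:c:]" "c dvd 1" by (auto simp: is_unit_poly_iff)
  moreover have "c \<noteq> 0" using c(2) by auto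
  ultimately show ?thesis using q(2) by (intro exI[of _ "to_ac c"]) (simp add: q0 map_poly_pCons)
qed

text \<open>A double root would be a root of the derivative, which in characteristic 0 is nonzero
  and of smaller degree; but \<open>f\<close> is, up to a scalar, the minimal polynomial of each of
  its roots.\<close>

lemma squarefree_if_irreducible_char_0:
  fixes f :: "'a::field poly"
  assumes irr: "Factorial_Ring.irreducible f" and char: "CHAR('a) = 0"
  shows "\<not> [:- a, 1:] ^ 2 dvd map_poly to_ac f"
proof
  interpret K: intermediate_field "base_field :: 'a alg_closure set" by (rule intermediate_field_base_field)
  assume "[:- a, 1:] ^ 2 dvd map_poly to_ac f"
  then obtain r where r: "map_poly to_ac f = [:- a, 1:] ^ 2 * r" by (rule dvdE)
  have a: "a \<in> ac_roots f" by (simp add: ac_roots_def r)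
  obtain m where m: "K.minpoly a m" using K.minpoly_exists by blast
  obtain c where c: "c \<noteq> 0" "map_poly to_ac f = Polynomial.smult c m"
    using irreducible_eq_smult_minpoly[OF irr a m] by blast
  have deg: "Polynomial.degree m = Polynomial.degree f"
    using arg_cong[OF c(2), of Polynomial.degree] c(1) by simp
  have pos: "0 < Polynomial.degree f" using K.degree_minpoly_pos[OF m] deg by simp
  have "Polynomial.coeff (pderiv f) (Polynomial.degree f - 1) \<noteq> 0"
  proof -
    have "(of_nat (Polynomial.degree f) :: 'a) \<noteq> 0"
      using pos char of_nat_eq_0_iff_char_dvd[of "Polynomial.degree f", where 'a = 'a] by simp
    thus ?thesis using pos by (simp add: coeff_pderiv del: of_nat_Suc) auto
  qed
  hence "pderiv f \<noteq> 0" by auto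
  hence nz: "map_poly to_ac (pderiv f) \<noteq> 0" using map_poly_to_ac_eq_iff[of "pderiv f" 0] by simp
  have "map_poly to_ac (pderiv f) = pderiv (map_poly to_ac f)"
    by (rule poly_eqI) (simp add: coeff_map_poly coeff_pderiv del: of_nat_Suc)
  also have "poly \<dots> a = 0"
    by (simp add: r pderiv_mult power2_eq_square del: mult_pCons_left mult_pCons_right)
  finally have "Polynomial.degree m \<le> Polynomial.degree (map_poly to_ac (pderiv f))"
    using m nz poly_over_map_to_ac[OF order_refl] unfolding K.minpoly_def by blast
  also have "\<dots> < Polynomial.degree f"
  proof -
    have "Polynomial.degree (pderiv f) \<le> Polynomial.degree f - 1"
      by (rule degree_le) (auto simp: coeff_pderiv coeff_eq_0 simp del: of_nat_Suc)
    thus ?thesis using pos by simp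
  qed
  finally show False using deg by simp
qed

lemma squarefree_if_separable:
  assumes "separable_poly f"
  shows "\<not> [:- a, 1:] ^ 2 dvd map_poly to_ac f"
proof -
  have "map_poly to_ac f \<noteq> 0"
    and "Polynomial.order a (map_poly to_ac f) = 0 \<or> Polynomial.order a (map_poly to_ac f) = 1"
    using assms by (simp_all add: separable_poly_def rsquarefree_def)
  moreover from this(2) have "Polynomial.order a (map_poly to_ac f) < 2" by auto
  ultimately show ?thesis by (simp add: order_divides)
qed

section \<open>The Galois group of a splitting field\<close>

locale galois =
  fixes f :: "'a::field poly"
  assumes f_nonzero: "f \<noteq> 0"
begin

abbreviation L :: "'a alg_closure set" where "L \<equiv> splitting_field f"
abbreviation R :: "'a alg_closure set" where "R \<equiv> ac_roots f"
abbreviation \<G> where "\<G> \<equiv> galois_group f"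

lemma finite_R: "finite R"
  using f_nonzero by (rule finite_ac_roots)

sublocale L: intermediate_field L
proof -
  obtain rs where "set rs = R" using finite_list[OF finite_R] by blast
  thus "intermediate_field L"
    using splitting_field_eq[of rs f] adjoin_list_intermediate_field[OF intermediate_field_base_field] by simp
qed

lemma R_subset: "R \<subseteq> L"
  unfolding splitting_field_def by (auto intro: generate_field.incl)

text \<open>An induction principle for \<open>L\<close>: a property passes from the base field and
  the roots to all of \<open>L\<close> once the elements having it form a subring.\<close>

lemma L_least:
  assumes "subring_set T" "base_field \<subseteq> T" "R \<subseteq> T"
  shows "L \<subseteq> T"
proof -
  obtain rs where rs: "set rs = R" using finite_list[OF finite_R] by blast
  thus ?thesis unfolding splitting_field_eq[OF rs] using assms by (intro adjoin_list_least) simp_all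
qed

lemma carrier_iff: "\<sigma> \<in> carrier \<G> \<longleftrightarrow> \<sigma> \<in> Bij L \<and> base_embedding L \<sigma>"
proof
  assume "\<sigma> \<in> carrier \<G>"
  hence *: "\<sigma> \<in> Bij L" "\<sigma> \<in> ring_hom (ring_of_type_algebra \<lparr>carrier := L\<rparr>) (ring_of_type_algebra \<lparr>carrier := L\<rparr>)"
    "\<And>a. \<sigma> (to_ac a) = to_ac a" by (auto simp: galois_group_def)
  have "\<sigma> (x + y) = \<sigma> x + \<sigma> y" "\<sigma> (x * y) = \<sigma> x * \<sigma> y" if "x \<in> L" "y \<in> L" for x y
    using ring_hom_add[OF *(2), of x y] ring_hom_mult[OF *(2), of x y] that
    by (simp_all add: ring_of_type_algebra_simps)
  thus "\<sigma> \<in> Bij L \<and> base_embedding L \<sigma>" using *(1,3) by (simp add: base_embedding_def)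
next
  assume *: "\<sigma> \<in> Bij L \<and> base_embedding L \<sigma>"
  hence fixK: "\<sigma> (to_ac a) = to_ac a" for a by (simp add: base_embedding_def)
  have "\<sigma> \<in> ring_hom (ring_of_type_algebra \<lparr>carrier := L\<rparr>) (ring_of_type_algebra \<lparr>carrier := L\<rparr>)"
  proof (rule ring_hom_memI)
    show "\<sigma> x \<in> carrier (ring_of_type_algebra \<lparr>carrier := L\<rparr>)" if "x \<in> carrier (ring_of_type_algebra \<lparr>carrier := L\<rparr>)" for x
      using * that Bij_imp_funcset[of \<sigma> L] by auto
    show "\<sigma> \<one>\<^bsub>ring_of_type_algebra \<lparr>carrier := L\<rparr>\<^esub> = \<one>\<^bsub>ring_of_type_algebra \<lparr>carrier := L\<rparr>\<^esub>"
      using fixK[of 1] by (simp add: ring_of_type_algebra_simps)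
  qed (use * in \<open>simp_all add: base_embedding_def ring_of_type_algebra_simps\<close>)
  thus "\<sigma> \<in> carrier \<G>" using * fixK by (simp add: galois_group_def)
qed

lemma embedding_L: "base_embedding L \<tau> \<Longrightarrow> embedding L \<tau>"
  by (intro embedding.intro embedding_axioms.intro L.intermediate_field_axioms)

lemma embedding_roots:
  assumes "base_embedding L \<tau>"
  shows "\<tau> ` R = R"
proof -
  interpret embedding L \<tau> using assms by (rule embedding_L)
  have "\<tau> x \<in> R" if x: "x \<in> R" for x
  proof -
    have "\<tau> (poly (map_poly to_ac f) x) = poly (map_poly to_ac f) (\<tau> x)"
      using \<tau>_poly[OF poly_over_map_to_ac[OF L.S(2)] subsetD[OF R_subset x]] by (simp only: map_\<tau>_to_ac)
    thus ?thesis using x by (simp add: ac_roots_def)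
  qed
  moreover have "inj_on \<tau> R" by (rule inj_onI) (rule \<tau>_inj[OF subsetD[OF R_subset] subsetD[OF R_subset]])
  ultimately show ?thesis using finite_R by (intro endo_inj_surj) auto
qed

text \<open>Normality of the splitting field. An embedding permutes the roots, so both the elements
  sent into \<open>L\<close> and the image of \<open>L\<close> are subrings containing the base
  field and the roots.\<close>

lemma embedding_bij:
  assumes "base_embedding L \<tau>"
  shows "bij_betw \<tau> L L"
proof -
  interpret embedding L \<tau> using assms by (rule embedding_L)
  have "L \<subseteq> {x \<in> L. \<tau> x \<in> L}"
  proof (rule L_least)
    show "subring_set {x \<in> L. \<tau> x \<in> L}"
      unfolding subring_set_def using L.SD by (auto simp: \<tau>_diff \<tau>_mult)
    show "base_field \<subseteq> {x \<in> L. \<tau> x \<in> L}" using L.S(2) by (auto simp: \<tau>_to_ac)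
    show "R \<subseteq> {x \<in> L. \<tau> x \<in> L}" using R_subset embedding_roots[OF assms] by blast
  qed
  moreover have "L \<subseteq> \<tau> ` L"
  proof (rule L_least)
    show "subring_set (\<tau> ` L)"
      unfolding subring_set_def
    proof (intro conjI ballI)
      show "1 \<in> \<tau> ` L" using \<tau>_1 L.SD(1) by (rule image_eqI[OF sym])
      fix x y assume "x \<in> \<tau> ` L" "y \<in> \<tau> ` L"
      then obtain a b where ab: "x = \<tau> a" "a \<in> L" "y = \<tau> b" "b \<in> L" by auto
      show "x - y \<in> \<tau> ` L" using \<tau>_diff[OF ab(2,4)] L.SD(3)[OF ab(2,4)] ab(1,3) by (intro image_eqI) simp_all
      show "x * y \<in> \<tau> ` L" using \<tau>_mult[OF ab(2,4)] L.SD(4)[OF ab(2,4)] ab(1,3) by (intro image_eqI) simp_all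
    qed
    show "base_field \<subseteq> \<tau> ` L"
    proof
      fix x :: "'a alg_closure" assume "x \<in> base_field"
      then obtain a where "x = to_ac a" by blast
      thus "x \<in> \<tau> ` L" using \<tau>_to_ac[of a] L.to_ac_mem[of a] by (intro image_eqI[of _ _ "to_ac a"]) simp_all
    qed
    show "R \<subseteq> \<tau> ` L" using R_subset embedding_roots[OF assms] by blast
  qed
  ultimately have "\<tau> ` L = L" by blast
  moreover have "inj_on \<tau> L" by (rule inj_onI) (rule \<tau>_inj)
  ultimately show ?thesis by (simp add: bij_betw_def)
qed

lemma restrict_embedding:
  assumes "base_embedding L \<tau>"
  shows "restrict \<tau> L \<in> carrier \<G>"
proof -
  have "bij_betw (restrict \<tau> L) L L"
    using embedding_bij[OF assms] by (simp add: bij_betw_restrict_eq)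
  moreover have "base_embedding L (restrict \<tau> L)"
    using assms unfolding base_embedding_def by (simp add: L.SD(4,6) L.to_ac_mem)
  ultimately show ?thesis by (simp add: carrier_iff Bij_def)
qed

lemma carrierD:
  assumes "\<sigma> \<in> carrier \<G>"
  shows "\<sigma> \<in> Bij L" "base_embedding L \<sigma>" "x \<in> L \<Longrightarrow> \<sigma> x \<in> L" "\<sigma> ` R = R"
proof -
  show *: "\<sigma> \<in> Bij L" "base_embedding L \<sigma>" using assms unfolding carrier_iff by simp_all
  show "x \<in> L \<Longrightarrow> \<sigma> x \<in> L" using Bij_imp_funcset[OF *(1)] by (rule funcset_mem)
  show "\<sigma> ` R = R" using *(2) by (rule embedding_roots)
qed

lemma mult_eq: "\<sigma> \<in> carrier \<G> \<Longrightarrow> \<tau> \<in> carrier \<G> \<Longrightarrow> \<sigma> \<otimes>\<^bsub>\<G>\<^esub> \<tau> = compose L \<sigma> \<tau>"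
  using carrierD(1)[of \<sigma>] carrierD(1)[of \<tau>] by (simp add: galois_group_def BijGroup_def)

lemma one_eq: "\<one>\<^bsub>\<G>\<^esub> = (\<lambda>x\<in>L. x)"
  by (simp add: galois_group_def BijGroup_def)

lemma group: "group \<G>"
proof -
  interpret B: group "BijGroup L" by (rule group_BijGroup)
  have "subgroup (carrier \<G>) (BijGroup L)"
  proof (rule B.subgroupI)
    show "carrier \<G> \<subseteq> carrier (BijGroup L)"
      unfolding BijGroup_def partial_object.simps by (rule subsetI) (rule carrierD(1))
    have "base_embedding L (\<lambda>x. x)" by (simp add: base_embedding_def)
    thus "carrier \<G> \<noteq> {}" using restrict_embedding by blast
  next
    fix \<sigma> assume \<sigma>: "\<sigma> \<in> carrier \<G>"
    note D = carrierD[OF \<sigma>]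
    interpret embedding L \<sigma> using D(2) by (rule embedding_L)
    have add: "inv_into L \<sigma> (x + y) = inv_into L \<sigma> x + inv_into L \<sigma> y"
      and mult: "inv_into L \<sigma> (x * y) = inv_into L \<sigma> x * inv_into L \<sigma> y" if "x \<in> L" "y \<in> L" for x y
      using Bij_inv_into_lemma[of L \<sigma> "(+)" x y] Bij_inv_into_lemma[of L \<sigma> "(*)" x y]
        \<tau>_add \<tau>_mult D(1) L.SD(4,6) that by auto
    have "inj_on \<sigma> L" using D(1) by (simp add: Bij_def bij_betw_def)
    hence "inv_into L \<sigma> (to_ac a) = to_ac a" for a
      using inv_into_f_f[of \<sigma> L "to_ac a"] L.to_ac_mem[of a] \<tau>_to_ac[of a] by simp
    hence "base_embedding L (inv_into L \<sigma>)" using add mult by (simp add: base_embedding_def)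
    thus "inv\<^bsub>BijGroup L\<^esub> \<sigma> \<in> carrier \<G>"
      using restrict_embedding inv_BijGroup[OF D(1)] by simp
  next
    fix \<sigma> \<tau> assume \<sigma>: "\<sigma> \<in> carrier \<G>" and \<tau>: "\<tau> \<in> carrier \<G>"
    have "base_embedding L (\<lambda>x. \<sigma> (\<tau> x))"
      using carrierD(2)[OF \<sigma>] carrierD(2,3)[OF \<tau>] by (simp add: base_embedding_def)
    hence "compose L \<sigma> \<tau> \<in> carrier \<G>" unfolding compose_def by (rule restrict_embedding)
    thus "\<sigma> \<otimes>\<^bsub>BijGroup L\<^esub> \<tau> \<in> carrier \<G>"
      using carrierD(1)[OF \<sigma>] carrierD(1)[OF \<tau>] by (simp add: BijGroup_def)
  qed
  hence "group (BijGroup L\<lparr>carrier := carrier \<G>\<rparr>)" using group_BijGroup by (rule subgroup.subgroup_is_group)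
  thus ?thesis by (simp add: galois_group_def)
qed

sublocale \<G>: group \<G>
  by (rule group)

lemma apply_mult: "\<sigma> \<in> carrier \<G> \<Longrightarrow> \<tau> \<in> carrier \<G> \<Longrightarrow> x \<in> L \<Longrightarrow> (\<sigma> \<otimes>\<^bsub>\<G>\<^esub> \<tau>) x = \<sigma> (\<tau> x)"
  by (simp add: mult_eq compose_eq)

lemma apply_inv:
  assumes "\<sigma> \<in> carrier \<G>" "x \<in> L"
  shows "\<sigma> ((inv\<^bsub>\<G>\<^esub> \<sigma>) x) = x" "(inv\<^bsub>\<G>\<^esub> \<sigma>) (\<sigma> x) = x"
  using apply_mult[of \<sigma> "inv\<^bsub>\<G>\<^esub> \<sigma>" x] apply_mult[of "inv\<^bsub>\<G>\<^esub> \<sigma>" \<sigma> x] assms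
  by (simp_all add: one_eq)

section \<open>The action on the roots\<close>

definition root_perm :: "('a alg_closure \<Rightarrow> 'a alg_closure) \<Rightarrow> 'a alg_closure \<Rightarrow> 'a alg_closure" where
  "root_perm \<sigma> = perm_restrict \<sigma> R"

lemma root_perm_apply: "root_perm \<sigma> x = (if x \<in> R then \<sigma> x else x)"
  by (simp add: root_perm_def perm_restrict_def)

lemma galois_permutations_eq: "galois_permutations f = root_perm ` carrier \<G>"
  by (simp add: galois_permutations_def root_perm_def)

lemma root_perm_mult:
  assumes "\<sigma> \<in> carrier \<G>" "\<tau> \<in> carrier \<G>"
  shows "root_perm (\<sigma> \<otimes>\<^bsub>\<G>\<^esub> \<tau>) = root_perm \<sigma> \<circ> root_perm \<tau>"
proof
  fix x
  have "\<tau> x \<in> R" if "x \<in> R" using carrierD(4)[OF assms(2)] that by blast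
  thus "root_perm (\<sigma> \<otimes>\<^bsub>\<G>\<^esub> \<tau>) x = (root_perm \<sigma> \<circ> root_perm \<tau>) x"
    using R_subset by (auto simp: root_perm_apply apply_mult[OF assms])
qed

lemma root_perm_one: "root_perm \<one>\<^bsub>\<G>\<^esub> = id"
  using R_subset by (auto simp: fun_eq_iff root_perm_apply one_eq)

text \<open>The roots generate \<open>L\<close>, and extensionality settles the values outside
  \<open>L\<close>. Thus the permutation group has the same order as the Galois group.\<close>

lemma root_perm_inj: "inj_on root_perm (carrier \<G>)"
proof (rule inj_onI)
  fix \<sigma> \<tau> assume \<sigma>: "\<sigma> \<in> carrier \<G>" and \<tau>: "\<tau> \<in> carrier \<G>" and eq: "root_perm \<sigma> = root_perm \<tau>"
  interpret s: embedding L \<sigma> using carrierD(2)[OF \<sigma>] by (rule embedding_L)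
  interpret t: embedding L \<tau> using carrierD(2)[OF \<tau>] by (rule embedding_L)
  have "L \<subseteq> {x \<in> L. \<sigma> x = \<tau> x}"
  proof (rule L_least)
    show "subring_set {x \<in> L. \<sigma> x = \<tau> x}"
      unfolding subring_set_def using L.SD by (auto simp: s.\<tau>_diff s.\<tau>_mult t.\<tau>_diff t.\<tau>_mult)
    show "base_field \<subseteq> {x \<in> L. \<sigma> x = \<tau> x}" using L.S(2) by (auto simp: s.\<tau>_to_ac t.\<tau>_to_ac)
    have "\<sigma> x = \<tau> x" if "x \<in> R" for x using fun_cong[OF eq, of x] that by (simp add: root_perm_apply)
    thus "R \<subseteq> {x \<in> L. \<sigma> x = \<tau> x}" using R_subset by blast
  qed
  thus "\<sigma> = \<tau>"
    using carrierD(1)[OF \<sigma>] carrierD(1)[OF \<tau>] by (intro extensionalityI[of \<sigma> L]) (auto simp: Bij_def)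
qed

lemma permutation_group: "permutation_group (galois_permutations f) R"
proof
  show "finite R" by (rule finite_R)
  show "g permutes R" if g: "g \<in> galois_permutations f" for g
  proof -
    obtain \<sigma> where \<sigma>: "\<sigma> \<in> carrier \<G>" "g = root_perm \<sigma>" using g by (auto simp: galois_permutations_eq)
    have "inj_on \<sigma> R"
      using carrierD(1)[OF \<sigma>(1)] R_subset by (auto simp: Bij_def bij_betw_def intro: inj_on_subset)
    hence "inj_on g R" by (auto simp: inj_on_def \<sigma>(2) root_perm_apply)
    moreover have "g ` R = R" using carrierD(4)[OF \<sigma>(1)] by (auto simp: \<sigma>(2) root_perm_apply image_iff)
    ultimately have "bij_betw g R R" by (simp add: bij_betw_def)
    thus ?thesis by (rule bij_imp_permutes) (simp add: \<sigma>(2) root_perm_apply)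
  qed
  have "root_perm \<one>\<^bsub>\<G>\<^esub> \<in> galois_permutations f"
    unfolding galois_permutations_eq by (rule imageI[OF \<G>.one_closed])
  thus "id \<in> galois_permutations f" by (simp only: root_perm_one)
  show "g \<circ> h \<in> galois_permutations f" if "g \<in> galois_permutations f" "h \<in> galois_permutations f" for g h
  proof -
    obtain \<sigma> \<tau> where "\<sigma> \<in> carrier \<G>" "g = root_perm \<sigma>" "\<tau> \<in> carrier \<G>" "h = root_perm \<tau>"
      using \<open>g \<in> _\<close> \<open>h \<in> _\<close> by (auto simp: galois_permutations_eq)
    thus ?thesis using root_perm_mult[of \<sigma> \<tau>] \<G>.m_closed[of \<sigma> \<tau>] unfolding galois_permutations_eq by (metis imageI)
  qed
  show "invp g \<in> galois_permutations f" if g: "g \<in> galois_permutations f" for g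
  proof -
    obtain \<sigma> where \<sigma>: "\<sigma> \<in> carrier \<G>" "g = root_perm \<sigma>" using g by (auto simp: galois_permutations_eq)
    have "g \<circ> root_perm (inv\<^bsub>\<G>\<^esub> \<sigma>) = id" "root_perm (inv\<^bsub>\<G>\<^esub> \<sigma>) \<circ> g = id"
      using root_perm_mult[OF \<sigma>(1) \<G>.inv_closed[OF \<sigma>(1)]] root_perm_mult[OF \<G>.inv_closed[OF \<sigma>(1)] \<sigma>(1)]
      by (simp_all only: \<sigma>(2) \<G>.r_inv[OF \<sigma>(1)] \<G>.l_inv[OF \<sigma>(1)] root_perm_one)
    hence "invp g = root_perm (inv\<^bsub>\<G>\<^esub> \<sigma>)" by (rule inv_unique_comp)
    thus ?thesis using \<G>.inv_closed[OF \<sigma>(1)] by (simp only: galois_permutations_eq imageI)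
  qed
qed

lemma card_galois_permutations: "card (galois_permutations f) = Coset.order \<G>"
  unfolding galois_permutations_eq Coset.order_def by (rule card_image[OF root_perm_inj])

lemma finite_carrier: "finite (carrier \<G>)"
  using permutation_group.finite_G[OF permutation_group] root_perm_inj
  unfolding galois_permutations_eq by (rule finite_imageD)

lemma fixed_mem_base_field:
  assumes sep: "\<And>a. \<not> [:- a, 1:] ^ 2 dvd map_poly to_ac f"
    and y: "y \<in> L" "\<And>\<sigma>. \<sigma> \<in> carrier \<G> \<Longrightarrow> \<sigma> y = y"
  shows "y \<in> base_field"
proof -
  obtain rs where rs: "set rs = R" using finite_list[OF finite_R] by blast
  note L_eq = splitting_field_eq[OF rs]
  show ?thesis
  proof (rule fixed_by_embeddings[OF intermediate_field_base_field _ f_nonzero sep])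
    show "poly (map_poly to_ac f) x = 0" if "x \<in> set rs" for x using that rs by (simp add: ac_roots_def)
    show "y \<in> adjoin_list base_field rs" using y(1) by (simp only: L_eq)
    show "\<tau> y = y" if "base_embedding (adjoin_list base_field rs) \<tau>" for \<tau>
      using y(2)[OF restrict_embedding[of \<tau>]] that y(1) by (simp add: L_eq)
  qed
qed

text \<open>By irreducibility \<open>x\<close> and \<open>y\<close> have the same minimal
  polynomial, so sending \<open>x\<close> to \<open>y\<close> embeds the field generated by
  \<open>x\<close>. All roots are then adjoined on top of that field, and the extended embedding is
  restricted to \<open>L\<close>.\<close>

lemma transitive_on_roots:
  assumes irr: "Factorial_Ring.irreducible f" and x: "x \<in> R" and y: "y \<in> R"
  shows "\<exists>\<sigma>\<in>carrier \<G>. \<sigma> x = y"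
proof -
  define \<iota> :: "'a alg_closure \<Rightarrow> 'a alg_closure" where "\<iota> = (\<lambda>z. z)"
  have \<iota>: "\<iota> z = z" for z by (simp add: \<iota>_def)
  interpret K: embedding base_field \<iota>
    by (intro embedding.intro embedding_axioms.intro intermediate_field_base_field) (simp add: base_embedding_def \<iota>)
  obtain m where m: "K.minpoly x m" using K.minpoly_exists by blast
  obtain c where c: "c \<noteq> 0" "map_poly to_ac f = Polynomial.smult c m"
    using irreducible_eq_smult_minpoly[OF irr x m] by blast
  have "poly m y = 0" using y c by (simp add: ac_roots_def)
  moreover have "map_poly \<iota> m = m" by (rule poly_eqI) (simp add: coeff_map_poly \<iota>)
  ultimately have "poly (map_poly \<iota> m) y = 0" by simp
  then obtain \<tau> where \<tau>: "base_embedding (ring_adjoin base_field x) \<tau>" "\<tau> x = y"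
    using K.extend_to_root[OF m] by blast
  obtain rs where rs: "set rs = R" using finite_list[OF finite_R] by blast
  obtain \<tau>' where \<tau>': "base_embedding (adjoin_list (ring_adjoin base_field x) rs) \<tau>'"
    "\<forall>z\<in>ring_adjoin base_field x. \<tau>' z = \<tau> z"
    using embedding_adjoin_list[OF K.ring_adjoin_field \<tau>(1)] by blast
  have "L \<subseteq> adjoin_list (ring_adjoin base_field x) rs"
  proof -
    interpret A: intermediate_field "adjoin_list (ring_adjoin base_field x) rs"
      by (rule adjoin_list_intermediate_field[OF K.ring_adjoin_field])
    show ?thesis
      using A.S adjoin_list_superset[OF K.ring_adjoin_field, of x rs] rs by (intro L_least) auto
  qed
  hence "base_embedding L \<tau>'" using \<tau>'(1) by (rule base_embedding_subset[rotated])
  hence "restrict \<tau>' L \<in> carrier \<G>" by (rule restrict_embedding)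
  moreover have "restrict \<tau>' L x = y"
    using x R_subset \<tau>'(2) \<tau>(2) ring_adjoin_mem[OF K.S(1), of x] by auto
  ultimately show ?thesis by blast
qed

text \<open>
  Let \<open>D\<close> be the decomposition group of the norm. An element \<open>y\<close> with \<open>N y = N \<beta>\<close> and all conjugates
  outside \<open>D\<close> of norm 1 has a norm to the base field of valuation \<open>- card D * s\<close>, an integer.
\<close>

lemma denominator_dvd_order:
  assumes sep: "\<And>a. \<not> [:- a, 1:] ^ 2 dvd map_poly to_ac f"
    and v: "normalized_discrete_valuation v"
    and N: "nonarchimedean N" "\<And>a. a \<noteq> 0 \<Longrightarrow> N (to_ac a) = 2 powr (- real_of_int (v a))"
    and \<beta>: "\<beta> \<in> L" "N \<beta> = 2 powr real_of_rat s"
  shows "nat (snd (quotient_of s)) dvd Coset.order \<G>"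
proof -
  define D where "D = {\<sigma> \<in> carrier \<G>. \<forall>x\<in>L. N (\<sigma> x) = N x}"
  have D: "subgroup D \<G>"
  proof (rule \<G>.subgroupI)
    show "D \<subseteq> carrier \<G>" by (auto simp: D_def)
    have "\<one>\<^bsub>\<G>\<^esub> \<in> D" using \<G>.one_closed by (simp add: D_def one_eq)
    thus "D \<noteq> {}" by blast
    show "inv\<^bsub>\<G>\<^esub> \<sigma> \<in> D" if "\<sigma> \<in> D" for \<sigma>
    proof -
      have \<sigma>: "\<sigma> \<in> carrier \<G>" "\<And>x. x \<in> L \<Longrightarrow> N (\<sigma> x) = N x" using that by (auto simp: D_def)
      have "N ((inv\<^bsub>\<G>\<^esub> \<sigma>) x) = N x" if x: "x \<in> L" for x
        using \<sigma>(2)[OF carrierD(3)[OF \<G>.inv_closed[OF \<sigma>(1)] x]] apply_inv(1)[OF \<sigma>(1) x] by simp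
      thus ?thesis using \<G>.inv_closed[OF \<sigma>(1)] by (simp add: D_def)
    qed
    show "\<sigma> \<otimes>\<^bsub>\<G>\<^esub> \<tau> \<in> D" if "\<sigma> \<in> D" "\<tau> \<in> D" for \<sigma> \<tau>
    proof -
      have \<sigma>: "\<sigma> \<in> carrier \<G>" "\<And>x. x \<in> L \<Longrightarrow> N (\<sigma> x) = N x" using that(1) by (auto simp: D_def)
      have \<tau>: "\<tau> \<in> carrier \<G>" "\<And>x. x \<in> L \<Longrightarrow> N (\<tau> x) = N x" using that(2) by (auto simp: D_def)
      have "N ((\<sigma> \<otimes>\<^bsub>\<G>\<^esub> \<tau>) x) = N x" if x: "x \<in> L" for x
        using apply_mult[OF \<sigma>(1) \<tau>(1) x] \<sigma>(2)[OF carrierD(3)[OF \<tau>(1) x]] \<tau>(2)[OF x] by simp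
      thus ?thesis using \<G>.m_closed[OF \<sigma>(1) \<tau>(1)] by (simp add: D_def)
    qed
  qed
  note ND = nonarchimedeanD[OF N(1)]
  have "\<exists>y\<in>L. N y = N \<beta> \<and> (\<forall>\<sigma>\<in>carrier \<G> - D. N (\<sigma> y) = 1)"
  proof (rule weak_approximation[OF L.intermediate_field_axioms norm_on_nonarchimedean[OF N(1)]])
    show "finite (carrier \<G> - D)" using finite_carrier by simp
    show "norm_on L (\<lambda>x. N (\<sigma> x))" if "\<sigma> \<in> carrier \<G> - D" for \<sigma>
    proof -
      have \<sigma>: "base_embedding L \<sigma>" using carrierD(2) that by blast
      interpret embedding L \<sigma> using \<sigma> by (rule embedding_L)
      have "N (\<sigma> x) = 0 \<longleftrightarrow> x = 0" if "x \<in> L" for x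
        using ND(2)[of "\<sigma> x"] \<tau>_eq_0[OF that] \<tau>_0 by auto
      thus ?thesis using ND(1,3,4) by (simp add: norm_on_def \<tau>_add \<tau>_mult)
    qed
    \<comment> \<open>Since \<open>v\<close> takes every integer value, elements of the base field
      have every norm \<open>2 powr m\<close>; automorphisms fix them, so all conjugate norms agree
      on them.\<close>
    show "\<exists>c\<in>L. N c = 2 powr real_of_int m \<and> (\<forall>\<sigma>\<in>carrier \<G> - D. N (\<sigma> c) = 2 powr real_of_int m)" for m
    proof -
      have "- m \<in> v ` (UNIV - {0})" using v by (simp add: normalized_discrete_valuation_def)
      then obtain a where a: "- m = v a" "a \<in> UNIV - {0}" by (rule imageE)
      hence Na: "N (to_ac a) = 2 powr real_of_int m" using N(2)[of a] by (simp add: a(1)[symmetric])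
      have "N (\<sigma> (to_ac a)) = 2 powr real_of_int m" if "\<sigma> \<in> carrier \<G> - D" for \<sigma>
      proof -
        have "\<sigma> (to_ac a) = to_ac a" using carrierD(2)[of \<sigma>] that by (simp add: base_embedding_def)
        thus ?thesis by (simp only: Na)
      qed
      thus ?thesis using L.to_ac_mem[of a] Na by (intro bexI[of _ "to_ac a"] conjI ballI)
    qed
    show "\<exists>x\<in>L. N x \<noteq> N (\<sigma> x)" if "\<sigma> \<in> carrier \<G> - D" for \<sigma>
    proof (rule ccontr)
      assume "\<not> ?thesis"
      hence "\<forall>x\<in>L. N (\<sigma> x) = N x" by metis
      thus False using that by (simp add: D_def)
    qed
    show "\<beta> \<in> L" by fact
    show "\<beta> \<noteq> 0" using \<beta>(2) ND(2)[of \<beta>] by auto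
  qed
  then obtain y where y: "y \<in> L" "N y = N \<beta>" "\<And>\<sigma>. \<sigma> \<in> carrier \<G> - D \<Longrightarrow> N (\<sigma> y) = 1" by blast
  have memL: "(\<Prod>\<sigma>\<in>A. \<sigma> y) \<in> L" if "A \<subseteq> carrier \<G>" for A
    using finite_subset[OF that finite_carrier] that
  proof (induction A rule: finite_induct)
    case (insert \<sigma> A)
    thus ?case using carrierD(3)[of \<sigma> y] y(1) by (auto intro: L.SD(4))
  qed (simp add: L.SD(1))
  define z where "z = (\<Prod>\<sigma>\<in>carrier \<G>. \<sigma> y)"
  have zL: "z \<in> L" unfolding z_def by (rule memL) simp
  have "\<tau> z = z" if \<tau>: "\<tau> \<in> carrier \<G>" for \<tau>
  proof -
    interpret embedding L \<tau> using carrierD(2)[OF \<tau>] by (rule embedding_L)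
    have "\<tau> (\<Prod>\<sigma>\<in>A. \<sigma> y) = (\<Prod>\<sigma>\<in>A. \<tau> (\<sigma> y))" if "A \<subseteq> carrier \<G>" for A
      using finite_subset[OF that finite_carrier] that
    proof (induction A rule: finite_induct)
      case (insert \<sigma> A)
      have "\<sigma> y \<in> L" using insert.prems y(1) carrierD(3) by blast
      moreover have "(\<Prod>\<sigma>\<in>A. \<sigma> y) \<in> L" using insert.prems by (intro memL) auto
      ultimately have "\<tau> (\<sigma> y * (\<Prod>\<sigma>\<in>A. \<sigma> y)) = \<tau> (\<sigma> y) * \<tau> (\<Prod>\<sigma>\<in>A. \<sigma> y)" by (rule \<tau>_mult)
      thus ?case using insert.hyps insert.IH insert.prems by (simp only: prod.insert insert_subset simp_thms)
    qed simp
    hence "\<tau> z = (\<Prod>\<sigma>\<in>carrier \<G>. \<tau> (\<sigma> y))" unfolding z_def by blast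
    also have "\<dots> = (\<Prod>\<sigma>\<in>carrier \<G>. (\<tau> \<otimes>\<^bsub>\<G>\<^esub> \<sigma>) y)"
      using apply_mult[OF \<tau>] y(1) by (intro prod.cong) simp_all
    also have "\<dots> = (\<Prod>\<sigma>\<in>carrier \<G>. \<sigma> y)"
    proof (rule prod.reindex_bij_betw)
      have "inj_on (\<lambda>\<sigma>. \<tau> \<otimes>\<^bsub>\<G>\<^esub> \<sigma>) (carrier \<G>)" using \<tau> by (rule \<G>.inj_on_cmult)
      moreover have "(\<lambda>\<sigma>. \<tau> \<otimes>\<^bsub>\<G>\<^esub> \<sigma>) ` carrier \<G> \<subseteq> carrier \<G>" using \<tau> \<G>.m_closed by blast
      ultimately show "bij_betw (\<lambda>\<sigma>. \<tau> \<otimes>\<^bsub>\<G>\<^esub> \<sigma>) (carrier \<G>) (carrier \<G>)"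
        unfolding bij_betw_def using endo_inj_surj[OF finite_carrier] by blast
    qed
    finally show ?thesis by (simp add: z_def)
  qed
  hence "z \<in> base_field" using fixed_mem_base_field[OF sep zL] by blast
  then obtain a where a: "z = to_ac a" by blast
  have N_prod: "N (\<Prod>\<sigma>\<in>A. \<sigma> y) = (\<Prod>\<sigma>\<in>A. N (\<sigma> y))" for A
    by (induction A rule: infinite_finite_induct) (simp_all add: ND(3,5))
  have "N z = (\<Prod>\<sigma>\<in>carrier \<G>. if \<sigma> \<in> D then N \<beta> else 1)"
    unfolding z_def N_prod
  proof (rule prod.cong[OF refl])
    fix \<sigma> assume \<sigma>: "\<sigma> \<in> carrier \<G>"
    show "N (\<sigma> y) = (if \<sigma> \<in> D then N \<beta> else 1)"
    proof (cases "\<sigma> \<in> D")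
      case True
      hence "N (\<sigma> y) = N y" using y(1) unfolding D_def by blast
      thus ?thesis using True y(2) by simp
    next
      case False
      thus ?thesis using y(3)[of \<sigma>] \<sigma> by simp
    qed
  qed
  also have "\<dots> = (\<Prod>\<sigma>\<in>carrier \<G> \<inter> D. N \<beta>)"
    using finite_carrier by (simp add: prod.If_cases)
  also have "carrier \<G> \<inter> D = D" by (auto simp: D_def)
  finally have Nz: "N z = N \<beta> ^ card D" by simp
  hence "N z = 2 powr (real_of_rat s * real (card D))"
    unfolding \<beta>(2) by (simp add: powr_powr[symmetric] powr_realpow)
  moreover have "a \<noteq> 0" using Nz \<beta>(2) ND(2)[of z] a by auto
  ultimately have "2 powr (real_of_rat s * real (card D)) = 2 powr (- real_of_int (v a))"
    using N(2)[of a] a by simp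
  hence eq: "real_of_rat s * real (card D) = - real_of_int (v a)"
    using powr_inj[of 2 "real_of_rat s * real (card D)" "- real_of_int (v a)"] by linarith
  obtain p d where pd: "quotient_of s = (p, d)" by fastforce
  have d: "d > 0" "coprime p d" "s = of_int p / of_int d"
    using quotient_of_denom_pos[OF pd] quotient_of_coprime[OF pd] quotient_of_div[OF pd] by auto
  have "real_of_int p * real (card D) = - real_of_int (v a) * real_of_int d"
    using eq d(1) by (simp add: d(3) of_rat_divide field_simps)
  hence "real_of_int (p * int (card D)) = real_of_int (- v a * d)" by simp
  hence "p * int (card D) = - v a * d" by (simp only: of_int_eq_iff)
  hence "d dvd p * int (card D)" by simp
  hence "d dvd int (card D)" using d(2) by (simp add: coprime_dvd_mult_right_iff coprime_commute)
  hence "nat d dvd card D" using d(1) by (simp add: nat_dvd_iff)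
  also have "card D dvd Coset.order \<G>" using \<G>.lagrange[OF D] by (metis dvd_triv_right)
  finally show ?thesis by (simp add: pd)
qed

end

theorem theorem2p3:
  fixes f g :: "'a::field poly" and \<mu> :: 'a and n :: nat
  assumes "global_field TYPE('a)"
    and "Factorial_Ring.irreducible f"
    and "Polynomial.degree f = n"
    and "CHAR('a) \<noteq> 0 \<Longrightarrow> separable_poly f"
    and "g = pcompose f [:- \<mu>, 1:]"
    and "poly g 0 \<noteq> 0"
  shows "newton_index g dvd Coset.order (galois_group f) \<and>
    (\<forall>q::nat. Factorial_Ring.prime q \<and> q dvd newton_index g \<and> real n / 2 < real q \<and> real q < real n - 2
      \<longrightarrow> alternating_permutations (ac_roots f) \<subseteq> galois_permutations f)"
proof -
  have "f \<noteq> 0" using assms(2) by auto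
  then interpret galois f by unfold_locales
  \<comment> \<open>No multiple roots in the closure: by irreducibility in characteristic 0, by the
    separability assumption otherwise.\<close>
  have sep: "\<not> [:- a, 1:] ^ 2 dvd map_poly to_ac f" for a
    using assms(2,4) squarefree_if_irreducible_char_0 squarefree_if_separable by blast
  have dvd: "newton_index g dvd Coset.order \<G>"
    unfolding newton_index_def
  proof (rule Lcm_least)
    fix b assume "b \<in> {nat (snd (quotient_of s)) | s v.
        normalized_discrete_valuation v \<and> real_of_rat s \<in> newton_slopes v g}"
    then obtain s v where s: "b = nat (snd (quotient_of s))" "normalized_discrete_valuation v"
      "real_of_rat s \<in> newton_slopes v g" by blast
    obtain N :: "'a alg_closure \<Rightarrow> real" where N: "nonarchimedean N"
      "\<And>a. a \<noteq> 0 \<Longrightarrow> N (to_ac a) = 2 powr (- real_of_int (v a))"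
      using exists_norm_extending_valuation[OF s(2)] by blast
    obtain \<beta> where \<beta>: "poly (map_poly to_ac g) \<beta> = 0" "N \<beta> = 2 powr real_of_rat s"
      using exists_root_of_newton_slope[OF N s(3)] by blast
    \<comment> \<open>The roots of \<open>g\<close> are the roots of \<open>f\<close> shifted by
      \<open>\<mu>\<close>, so they lie in the splitting field of \<open>f\<close>.\<close>
    have "poly (map_poly to_ac f) (\<beta> - to_ac \<mu>) = 0"
      using \<beta>(1) by (simp add: assms(5) map_poly_to_ac_pcompose poly_pcompose map_poly_pCons)
    hence "\<beta> - to_ac \<mu> \<in> L" using R_subset by (auto simp: ac_roots_def)
    hence "\<beta> - to_ac \<mu> + to_ac \<mu> \<in> L" using L.to_ac_mem by (rule L.SD(6))
    hence "\<beta> \<in> L" by simp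
    show "b dvd Coset.order \<G>"
      unfolding s(1) by (rule denominator_dvd_order[OF sep s(2) N \<open>\<beta> \<in> L\<close> \<beta>(2)])
  qed
  have "alternating_permutations R \<subseteq> galois_permutations f"
    if q: "Factorial_Ring.prime q" "q dvd newton_index g" "real n / 2 < real q" "real q < real n - 2" for q
  proof
    interpret P: permutation_group "galois_permutations f" R by (rule permutation_group)
    have "card R = n"
      unfolding ac_roots_def using card_roots_squarefree[OF _ sep] assms(3) \<open>f \<noteq> 0\<close> map_poly_to_ac_eq_iff[of f 0]
      by simp
    \<comment> \<open>The range of \<open>q\<close> is given over the reals, so the subtraction of 2
      is not truncated.\<close>
    hence card: "card R < 2 * q" "q + 2 < card R" using q(3,4) by linarith+
    have dvd_card: "q dvd card (galois_permutations f)"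
      using dvd_trans[OF q(2) dvd] by (simp only: card_galois_permutations)
    have trans: "\<exists>g\<in>galois_permutations f. g x = y" if xy: "x \<in> R" "y \<in> R" for x y
    proof -
      obtain \<sigma> where "\<sigma> \<in> carrier \<G>" "\<sigma> x = y" using transitive_on_roots[OF assms(2) xy] by blast
      thus ?thesis using xy(1) unfolding galois_permutations_eq
        by (intro bexI[of _ "root_perm \<sigma>"]) (simp_all add: root_perm_apply)
    qed
    fix p assume "p \<in> alternating_permutations R"
    hence "p permutes R" "evenperm p" by (simp_all add: alternating_permutations_def)
    thus "p \<in> galois_permutations f" using P.Jordan[OF q(1) card dvd_card trans] by blast
  qed
  thus ?thesis using dvd by blast
qed

end
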